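(* Let $S_0$ be a Polish semigroup and let $\mu$ be a Borel probability measure on $S_0$. Suppose that the sequence $\{\mu^n\}_{n=1}^\infty$ of convolution powers is tight. Let $$S := \overline{\bigcup_{n=1}^\infty \mathcal{S}(\mu)^n}$$ be the closure of the semigroup generated by $\mathcal{S}(\mu)$. Then the following assertions hold: (i) There exists $\nu\in\mathcal{P}(S)$ such that $\nu*\nu=\nu$, $\mu*\nu=\nu*\mu=\nu$ and $$\mu_n := \frac1n\sum_{k=1}^n \mu^k \to \nu \quad \text{weakly as } n\to\infty.$$ (ii) The family $\mathcal{K}$ of cluster points of $\{\mu^n: n=1,2,\ldots\}$ (in the weak topology) is a compact abelian group under convolution such that $$\mathcal{S}(\nu)=\overline{\bigcup_{\lambda\in\mathcal{K}}\mathcal{S}(\lambda)}.$$ (iii) Let $\eta$ denote the identity of $\mathcal{K}$. Then $\mathcal{S}(\eta)$ is a completely simple semigroup. Let $\mathcal{S}(\eta)=LHR$ denote the Rees decomposition at $e\in E(\mathcal{S}(\eta))$. Then $H$ is a compact group and $$\eta=\eta^L*\omega_H*\eta^R .$$ (iv) $\mathcal{S}(\nu)$ is a completely simple kernel of $S$ containing the idempotent $e$. The Rees decomposition of $\mathcal{S}(\nu)$ at $e$ is of the form $\mathcal{S}(\nu)=LGR$ (with the same $L$ and $R$ as in (iii)), where $G$ is a compact group containing $H$, and $$\nu=\eta^L*\omega_G*\eta^R .$$ (v) For $g\in G$ write $\omega_{gH}:=\delta_g*\omega_H$. Then $H$ is a closed normal subgroup of $G$, and there exists a Polish group isomorphism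 (a group isomorphism that is a homeomorphism) $F:\mathcal{K}\to G/H$ such that $$\lambda=\eta^L*\omega_{F(\lambda)}*\eta^R,\qquad \lambda\in\mathcal{K}.$$ Consequently, there exists $\gamma\in G$ such that $$\mu^k*\eta=\eta^L*\omega_{\gamma^kH}*\eta^R,\qquad k=1,2,\ldots,$$ and furthermore $$\mathcal{K}=\overline{\{\eta,\mu*\eta,\mu^2*\eta,\ldots\}},\qquad G/H=\overline{\{H,\gamma H,\gamma^2H,\ldots\}}.$$
   Context: A Polish semigroup is a semigroup with a Polish (separable, completely metrizable) topology for which multiplication is jointly continuous. $\mathcal{P}(S)$ denotes the set of Borel probability measures on $S$ with the topology of weak convergence; measures on closed subsets of $S_0$ are regarded as measures on $S_0$. Convolution: $(\mu*\nu)(B)=\iint 1_B(xy)\,\mu(dx)\,\nu(dy)$; $\mu^1=\mu$, $\mu^n=\mu^{n-1}*\mu$. $\delta_g$ is the Dirac mass at $g$. The topological support $\mathcal{S}(\mu)$ is the set of $x$ such that $\mu(U)>0$ for every open neighbourhood $U$ of $x$. For subsets, $AB=\{ab:a\in A,b\in B\}$, $A^1=A$, $A^n=A^{n-1}A$. A cluster point of a sequence is a limit of some subsequence. $\omega_K$ denotes the normalized Haar measure on a compact group $K$. For a semigroup $T$, $E(T)=\{x\in T:x^2=x\}$. An ideal of $T$ is a non-empty $I\subset T$ with $TI\cup IT\subset I$; $T$ is simple if it has no ideal other than $T$; a kernel of $T$ is a minimal ideal of $T$. An idempotent $e$ of $T$ is primitive if $ex=xe=x\in E(T)$ implies $x=e$.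 $T$ is completely simple if it is simple and contains a primitive idempotent; in that case every idempotent of $T$ is primitive. The Rees decomposition of a completely simple semigroup $T$ at $e\in E(T)$ is the factorization $T=LGR$ with $L=E(Te)$, $G=eTe$, $R=E(eT)$. Here $G$ is a group with identity $e$ and the product map $L\times G\times R\to T$, $(x,g,y)\mapsto xgy$, is bijective with inverse $z\mapsto(z^L,z^G,z^R)=(ze(eze)^{-1},eze,(eze)^{-1}ez)$. With $T=\mathcal{S}(\eta)=LHR$, $\eta^L$ and $\eta^R$ are the laws under $\eta$ of $z\mapsto z^L$ and $z\mapsto z^R$: $\eta^L(B)=\eta(z:z^L\in B)$, $\eta^R(B)=\eta(z:z^R\in B)$. *)

theory Defs
  imports "HOL-Probability.Probability" "HOL-Algebra.Coset"
begin

section \<open>Powers in a semigroup without identity\<close>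

text \<open>
  Only exponents at least 1 are meaningful; the value at exponent 0 is unspecified. The operation is
  a parameter because the same recursion is used for elements, for sets and for measures. The
  product of two sets is the elementwise product of HOL-Library.Set_Algebras.
\<close>

fun semigroup_power :: "('b \<Rightarrow> 'b \<Rightarrow> 'b) \<Rightarrow> 'b \<Rightarrow> nat \<Rightarrow> 'b" where
  "semigroup_power f x (Suc 0) = x"
| "semigroup_power f x (Suc (Suc n)) = f (semigroup_power f x (Suc n)) x"


section \<open>Borel probability measures and weak convergence\<close>

definition borel_probs :: "'a::topological_space measure set" where
  "borel_probs = {\<mu>. sets \<mu> = sets borel \<and> prob_space \<mu>}"

text \<open>Measures on a closed subset \<open>C\<close> are identified with measures on the whole space
  that are carried by \<open>C\<close>.\<close>

definition borel_probs_on :: "'a::topological_space set \<Rightarrow> 'a measure set" where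
  "borel_probs_on C = {\<mu> \<in> borel_probs. emeasure \<mu> C = 1}"

definition weak_topology :: "'a::topological_space measure topology" where
  "weak_topology = topology_generated_by
     {{\<mu> \<in> borel_probs. (\<integral>x. f x \<partial>\<mu>) \<in> U} | (f :: 'a \<Rightarrow> real) U.
        continuous_on UNIV f \<and> bounded (range f) \<and> open U}"

lemma topspace_weak_topology: "topspace weak_topology = borel_probs"
proof -
  have "continuous_on UNIV (\<lambda>x::'a. 0::real) \<and> bounded (range (\<lambda>x::'a. 0::real)) \<and> open (UNIV::real set)"
    by (auto simp: image_constant_conv)
  then show ?thesis
    unfolding weak_topology_def topology_generated_by_topspace by blast
qed

lemma limitin_weak_topology:
  "limitin weak_topology M \<nu> F \<longleftrightarrow>
     \<nu> \<in> borel_probs \<and> (\<forall>\<^sub>F i in F. M i \<in> borel_probs) \<and>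
     (\<forall>f :: 'a::topological_space \<Rightarrow> real. continuous_on UNIV f \<and> bounded (range f) \<longrightarrow>
        ((\<lambda>i. \<integral>x. f x \<partial>M i) \<longlongrightarrow> (\<integral>x. f x \<partial>\<nu>)) F)" (is "?L \<longleftrightarrow> ?R")
proof
  assume L: ?L
  have 1: "\<nu> \<in> borel_probs"
    using limitin_topspace[OF L] by (simp add: topspace_weak_topology)
  have 2: "\<forall>\<^sub>F i in F. M i \<in> borel_probs"
    using L openin_topspace[of weak_topology] 1
    unfolding limitin_def topspace_weak_topology by blast
  have "((\<lambda>i. \<integral>x. f x \<partial>M i) \<longlongrightarrow> (\<integral>x. f x \<partial>\<nu>)) F"
    if f: "continuous_on UNIV f" "bounded (range f)" for f :: "'a \<Rightarrow> real"
  proof (rule topological_tendstoI)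
    fix U :: "real set" assume U: "open U" "(\<integral>x. f x \<partial>\<nu>) \<in> U"
    let ?V = "{\<mu> \<in> borel_probs. (\<integral>x. f x \<partial>\<mu>) \<in> U}"
    have "openin weak_topology ?V"
      unfolding weak_topology_def by (rule topology_generated_by_Basis) (use f U in blast)
    moreover have "\<nu> \<in> ?V" using 1 U by simp
    ultimately have "\<forall>\<^sub>F i in F. M i \<in> ?V" using L unfolding limitin_def by blast
    then show "\<forall>\<^sub>F i in F. (\<integral>x. f x \<partial>M i) \<in> U" by (rule eventually_mono) simp
  qed
  with 1 2 show ?R by blast
next
  assume R: ?R
  have "\<forall>\<^sub>F i in F. M i \<in> V" if "openin weak_topology V" "\<nu> \<in> V" for V
  proof -
    have "generate_topology_on {{\<mu> \<in> borel_probs. (\<integral>x. f x \<partial>\<mu>) \<in> U} | (f :: 'a \<Rightarrow> real) U.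
        continuous_on UNIV f \<and> bounded (range f) \<and> open U} V"
      using that(1) by (simp add: weak_topology_def openin_topology_generated_by_iff)
    then show ?thesis using that(2)
    proof induction
      case (Int A B)
      then show ?case by (auto intro: eventually_conj)
    next
      case (UN K)
      then obtain A where A: "A \<in> K" "\<nu> \<in> A" by blast
      then have "\<forall>\<^sub>F i in F. M i \<in> A" using UN by blast
      then show ?case by (rule eventually_mono) (use A in blast)
    next
      case (Basis s)
      then obtain f :: "'a \<Rightarrow> real" and U
        where s: "s = {\<mu> \<in> borel_probs. (\<integral>x. f x \<partial>\<mu>) \<in> U}"
          and f: "continuous_on UNIV f" "bounded (range f)" and U: "open U" by blast
      have lim: "((\<lambda>i. \<integral>x. f x \<partial>M i) \<longlongrightarrow> (\<integral>x. f x \<partial>\<nu>)) F" using R f by blast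
      have "(\<integral>x. f x \<partial>\<nu>) \<in> U" using Basis s by blast
      then have "\<forall>\<^sub>F i in F. (\<integral>x. f x \<partial>M i) \<in> U"
        using topological_tendstoD[OF lim U] by blast
      moreover have "\<forall>\<^sub>F i in F. M i \<in> borel_probs" using R by blast
      ultimately show ?case by eventually_elim (simp add: s)
    qed simp
  qed
  with R show ?L by (auto simp: limitin_def topspace_weak_topology)
qed

definition tight_measures :: "'a::topological_space measure set \<Rightarrow> bool" where
  "tight_measures M \<longleftrightarrow>
     (\<forall>\<epsilon>>0. \<exists>C. compact C \<and> (\<forall>\<mu>\<in>M. measure \<mu> (UNIV - C) \<le> \<epsilon>))"

definition supp :: "'a::topological_space measure \<Rightarrow> 'a set" where
  "supp \<mu> = {x. \<forall>U. open U \<and> x \<in> U \<longrightarrow> emeasure \<mu> U > 0}"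

definition cluster_points :: "'b topology \<Rightarrow> (nat \<Rightarrow> 'b) \<Rightarrow> 'b set" where
  "cluster_points X s = {l. \<exists>r. strict_mono r \<and> limitin X (s \<circ> r) l sequentially}"


section \<open>Convolution\<close>

definition conv :: "'a::{topological_space, semigroup_mult} measure \<Rightarrow> 'a measure \<Rightarrow> 'a measure"
    (infixl \<open>\<^bold>*\<close> 70) where
  "\<mu> \<^bold>* \<nu> = distr (\<mu> \<Otimes>\<^sub>M \<nu>) borel (\<lambda>(x, y). x * y)"

abbreviation conv_power :: "'a::{topological_space, semigroup_mult} measure \<Rightarrow> nat \<Rightarrow> 'a measure" where
  "conv_power \<equiv> semigroup_power (\<^bold>*)"

definition cesaro_mean :: "'a::{topological_space, semigroup_mult} measure \<Rightarrow> nat \<Rightarrow> 'a measure" where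
  "cesaro_mean \<mu> n = measure_of UNIV (sets borel)
     (\<lambda>B. (\<Sum>k=1..n. emeasure (conv_power \<mu> k) B) / of_nat n)"

definition support_semigroup :: "'a::{topological_space, semigroup_mult} measure \<Rightarrow> 'a set" where
  "support_semigroup \<mu> = closure (\<Union>n\<in>{1..}. semigroup_power (*) (supp \<mu>) n)"

text \<open>
  The cluster points of the sequence of convolution powers, whose exponents start at 1.
\<close>

definition conv_clusters :: "'a::{topological_space, semigroup_mult} measure \<Rightarrow> 'a measure set" where
  "conv_clusters \<mu> = cluster_points weak_topology (\<lambda>n. conv_power \<mu> (Suc n))"


section \<open>Topological groups\<close>

definition monoid_on :: "('b \<Rightarrow> 'b \<Rightarrow> 'b) \<Rightarrow> 'b set \<Rightarrow> 'b \<Rightarrow> 'b monoid" where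
  "monoid_on f A u = \<lparr>carrier = A, mult = f, one = u\<rparr>"

definition topological_group :: "'b topology \<Rightarrow> 'b monoid \<Rightarrow> bool" where
  "topological_group X G \<longleftrightarrow> group G \<and> topspace X = carrier G \<and>
     continuous_map (prod_topology X X) X (\<lambda>(x, y). x \<otimes>\<^bsub>G\<^esub> y) \<and>
     continuous_map X X (\<lambda>x. inv\<^bsub>G\<^esub> x)"

definition compact_group :: "'b topology \<Rightarrow> 'b monoid \<Rightarrow> bool" where
  "compact_group X G \<longleftrightarrow> topological_group X G \<and> compact_space X \<and> Hausdorff_space X"

definition polish_group :: "'b topology \<Rightarrow> 'b monoid \<Rightarrow> bool" where
  "polish_group X G \<longleftrightarrow>
     topological_group X G \<and> completely_metrizable_space X \<and> second_countable X"

definition polish_group_iso ::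
    "'b topology \<Rightarrow> 'b monoid \<Rightarrow> 'c topology \<Rightarrow> 'c monoid \<Rightarrow> ('b \<Rightarrow> 'c) \<Rightarrow> bool" where
  "polish_group_iso X G Y H F \<longleftrightarrow>
     polish_group X G \<and> polish_group Y H \<and> F \<in> iso G H \<and> homeomorphic_map X Y F"

definition quotient_topology :: "'b topology \<Rightarrow> ('b \<Rightarrow> 'c) \<Rightarrow> 'c topology" where
  "quotient_topology X q =
     topology (\<lambda>U. U \<subseteq> q ` topspace X \<and> openin X {x \<in> topspace X. q x \<in> U})"

lemma openin_quotient_topology:
  "openin (quotient_topology X q) U \<longleftrightarrow>
     U \<subseteq> q ` topspace X \<and> openin X {x \<in> topspace X. q x \<in> U}"
proof -
  have "istopology (\<lambda>U. U \<subseteq> q ` topspace X \<and> openin X {x \<in> topspace X. q x \<in> U})"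
    unfolding istopology_def
  proof (intro conjI allI impI)
    fix S T
    assume "S \<subseteq> q ` topspace X \<and> openin X {x \<in> topspace X. q x \<in> S}"
      and "T \<subseteq> q ` topspace X \<and> openin X {x \<in> topspace X. q x \<in> T}"
    moreover have "{x \<in> topspace X. q x \<in> S \<inter> T} =
        {x \<in> topspace X. q x \<in> S} \<inter> {x \<in> topspace X. q x \<in> T}" by blast
    ultimately show "S \<inter> T \<subseteq> q ` topspace X" "openin X {x \<in> topspace X. q x \<in> S \<inter> T}"
      by auto
  next
    fix K
    assume K: "\<forall>U\<in>K. U \<subseteq> q ` topspace X \<and> openin X {x \<in> topspace X. q x \<in> U}"
    then show "\<Union>K \<subseteq> q ` topspace X" by blast
    have "{x \<in> topspace X. q x \<in> \<Union>K} = (\<Union>U\<in>K. {x \<in> topspace X. q x \<in> U})" by blast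
    then show "openin X {x \<in> topspace X. q x \<in> \<Union>K}" using K by auto
  qed
  then show ?thesis by (simp add: quotient_topology_def)
qed

text \<open>For a normal subgroup the left cosets used here are the elements of \<open>G Mod H\<close>.\<close>

definition coset_topology :: "'b topology \<Rightarrow> 'b monoid \<Rightarrow> 'b set \<Rightarrow> 'b set topology" where
  "coset_topology X G H = quotient_topology X (\<lambda>g. g <#\<^bsub>G\<^esub> H)"

text \<open>
  Normalized Haar measure of a compact group \<open>K\<close> inside the ambient semigroup, regarded as a
  measure on the ambient space: the unique left-invariant Borel probability measure carried
  by \<open>K\<close>.
\<close>

definition haar :: "'a::{topological_space, semigroup_mult} set \<Rightarrow> 'a measure" where
  "haar K = (THE \<omega>. \<omega> \<in> borel_probs_on K \<and>
     (\<forall>g\<in>K. \<forall>B\<in>sets borel. B \<subseteq> K \<longrightarrow> emeasure \<omega> ((*) g ` B) = emeasure \<omega> B))"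

definition haar_coset :: "'a::{topological_space, semigroup_mult} \<Rightarrow> 'a set \<Rightarrow> 'a measure" where
  "haar_coset g H = return borel g \<^bold>* haar H"


section \<open>Algebraic semigroups\<close>

definition idempotents :: "'a::semigroup_mult set \<Rightarrow> 'a set" where
  "idempotents T = {x \<in> T. x * x = x}"

definition semigroup_ideal :: "'a::semigroup_mult set \<Rightarrow> 'a set \<Rightarrow> bool" where
  "semigroup_ideal T I \<longleftrightarrow> I \<noteq> {} \<and> I \<subseteq> T \<and> T * I \<union> I * T \<subseteq> I"

definition simple_semigroup :: "'a::semigroup_mult set \<Rightarrow> bool" where
  "simple_semigroup T \<longleftrightarrow> (\<forall>I. semigroup_ideal T I \<longrightarrow> I = T)"

definition semigroup_kernel :: "'a::semigroup_mult set \<Rightarrow> 'a set \<Rightarrow> bool" where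
  "semigroup_kernel T I \<longleftrightarrow>
     semigroup_ideal T I \<and> (\<forall>J. semigroup_ideal T J \<and> J \<subseteq> I \<longrightarrow> J = I)"

definition primitive_idempotent :: "'a::semigroup_mult set \<Rightarrow> 'a \<Rightarrow> bool" where
  "primitive_idempotent T e \<longleftrightarrow> e \<in> idempotents T \<and>
     (\<forall>x\<in>idempotents T. e * x = x \<and> x * e = x \<longrightarrow> x = e)"

definition completely_simple :: "'a::semigroup_mult set \<Rightarrow> bool" where
  "completely_simple T \<longleftrightarrow>
     T * T \<subseteq> T \<and> simple_semigroup T \<and> (\<exists>e. primitive_idempotent T e)"

definition rees_L :: "'a::semigroup_mult set \<Rightarrow> 'a \<Rightarrow> 'a set" where
  "rees_L T e = idempotents (T * {e})"

definition rees_G :: "'a::semigroup_mult set \<Rightarrow> 'a \<Rightarrow> 'a set" where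
  "rees_G T e = {e} * T * {e}"

definition rees_R :: "'a::semigroup_mult set \<Rightarrow> 'a \<Rightarrow> 'a set" where
  "rees_R T e = idempotents ({e} * T)"

definition rees_inverse :: "'a::semigroup_mult set \<Rightarrow> 'a \<Rightarrow> 'a \<Rightarrow> 'a" where
  "rees_inverse T e g = inv\<^bsub>monoid_on (*) (rees_G T e) e\<^esub> g"

definition rees_left :: "'a::semigroup_mult set \<Rightarrow> 'a \<Rightarrow> 'a \<Rightarrow> 'a" where
  "rees_left T e z = z * e * rees_inverse T e (e * z * e)"

definition rees_right :: "'a::semigroup_mult set \<Rightarrow> 'a \<Rightarrow> 'a \<Rightarrow> 'a" where
  "rees_right T e z = rees_inverse T e (e * z * e) * e * z"

text \<open>
  The laws of the outer Rees coordinates. These coordinates are only defined on the support, which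
  carries all the mass, hence the restriction to it before the push-forward.
\<close>

definition left_law :: "'a::{topological_space, semigroup_mult} measure \<Rightarrow> 'a \<Rightarrow> 'a measure" where
  "left_law \<eta> e = distr (restrict_space \<eta> (supp \<eta>)) borel (rees_left (supp \<eta>) e)"

definition right_law :: "'a::{topological_space, semigroup_mult} measure \<Rightarrow> 'a \<Rightarrow> 'a measure" where
  "right_law \<eta> e = distr (restrict_space \<eta> (supp \<eta>)) borel (rees_right (supp \<eta>) e)"

end

theory Submission
  imports Defs
begin

text \<open>
  Everything rests on one identity. If \<open>\<eta> \<^bold>* \<eta> = \<eta>\<close> and \<open>g x = \<integral>z. f (x * z) \<partial>\<eta>\<close>, then
  \<open>\<integral>y. g (x * y) \<partial>\<eta> = g x\<close>; hence \<open>g (x * y) - g x\<close> has vanishing second moment, and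
  \<open>dirac (x * y) \<^bold>* \<eta> = dirac x \<^bold>* \<eta>\<close> for \<open>x\<close>, \<open>y\<close> in the support \<open>T\<close> of \<open>\<eta>\<close>. Therefore
  \<open>dirac x \<^bold>* \<eta> \<^bold>* dirac x\<close> is invariant under left and right translation by the points of its
  support, and a closed semigroup that carries such a measure with full support is a compact group.
  For an idempotent \<open>e\<close> of \<open>T\<close> this group is \<open>e T e\<close>, with Haar measure \<open>dirac e \<^bold>* \<eta> \<^bold>* dirac e\<close>.
  The identity also gives \<open>\<eta> \<^bold>* dirac e \<^bold>* \<eta> = \<eta>\<close>, so that \<open>T e T\<close> is dense in \<open>T\<close>; the Rees
  decompositions of \<open>T\<close> and of \<open>\<eta>\<close> follow.

  Tightness enters through Prokhorov's theorem. The cluster points of the powers form a compact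
  abelian semigroup \<open>\<K>\<close> with \<open>\<lambda> \<^bold>* \<K> = \<K>\<close>, hence a group, and two cluster points of the averages
  absorb each other, hence coincide. If \<open>\<lambda>\<close> and \<open>\<kappa>\<close> are inverse to each other in \<open>\<K>\<close>, then
  \<open>dirac e \<^bold>* \<lambda> \<^bold>* dirac e\<close> and \<open>dirac e \<^bold>* \<kappa> \<^bold>* dirac e\<close> have the Haar measure of \<open>H\<close> as product,
  which forces the former to be carried by one coset of \<open>H\<close>; this coset is the image of \<open>\<lambda>\<close> in \<open>G/H\<close>.
\<close>

section \<open>Borel probability measures\<close>

text \<open>The space need not be locally compact, so compactness of tight families is drawn from
  Helly's selection theorem: points are coded by real numbers, sublimits are found on the line, and
  the coding is inverted on closed sets that carry almost all the mass. The weak topology is handled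
  through sequences; countably many integrals compare it with a product of lines, and this
  comparison becomes a homeomorphism on sequentially compact sets. Multiplication is uniformly
  continuous only on compact sets, so convolution is shown to be jointly continuous along tight
  families. Inverses are absent at the outset: invariance of a measure under its own support yields,
  through Fubini's theorem, one-sided identities and then inverses almost everywhere, and
  compactness follows because two sets of mass above one half must meet. The factorization into Rees
  coordinates is proved for every measure that absorbs the idempotent on both sides, so the formulas
  for \<open>\<eta>\<close>, \<open>\<nu>\<close> and each cluster point are instances of one
  statement.\<close>

abbreviation bounded_continuous :: "('a::topological_space \<Rightarrow> real) \<Rightarrow> bool" where
  "bounded_continuous f \<equiv> continuous_on UNIV f \<and> bounded (range f)"

lemma borel_probsD:
  assumes "\<mu> \<in> borel_probs"
  shows "sets \<mu> = sets borel" "space \<mu> = UNIV" "prob_space \<mu>"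
  using assms sets_eq_imp_space_eq[of \<mu> borel] by (auto simp: borel_probs_def)

lemma measurable_borel_probs: "\<mu> \<in> borel_probs \<Longrightarrow> measurable \<mu> M = measurable borel M"
  by (rule measurable_cong_sets) (auto dest: borel_probsD)

lemma borel_probs_distr:
  assumes "prob_space M" "f \<in> measurable M borel"
  shows "distr M borel f \<in> borel_probs"
  using prob_space.prob_space_distr[OF assms] by (simp add: borel_probs_def)

lemma integrable_borel_probs:
  fixes f :: "'a::topological_space \<Rightarrow> real"
  assumes "\<mu> \<in> borel_probs" "f \<in> borel_measurable borel" "bounded (range f)"
  shows "integrable \<mu> f"
proof -
  interpret prob_space \<mu> using assms borel_probsD by blast
  obtain B where "\<And>x. \<bar>f x\<bar> \<le> B" using assms(3) by (auto simp: bounded_iff)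
  then show ?thesis using assms
    by (intro integrable_const_bound[of _ B]) (auto simp: measurable_borel_probs)
qed

lemma integrable_bounded_continuous:
  "\<mu> \<in> borel_probs \<Longrightarrow> bounded_continuous f \<Longrightarrow> integrable \<mu> f"
  by (intro integrable_borel_probs borel_measurable_continuous_onI) auto

lemma abs_integral_le_borel_probs:
  fixes f :: "'a::topological_space \<Rightarrow> real"
  assumes "\<mu> \<in> borel_probs" "f \<in> borel_measurable borel" "\<And>x. \<bar>f x\<bar> \<le> B"
  shows "\<bar>\<integral>x. f x \<partial>\<mu>\<bar> \<le> B"
proof -
  interpret prob_space \<mu> using assms borel_probsD by blast
  have "integrable \<mu> f"
    using assms by (intro integrable_borel_probs) (auto simp: bounded_iff)
  then have "\<bar>\<integral>x. f x \<partial>\<mu>\<bar> \<le> (\<integral>x. B \<partial>\<mu>)"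
    using assms(3) by (intro order_trans[OF integral_abs_bound] integral_mono) auto
  then show ?thesis by (simp add: prob_space)
qed

text \<open>Tent functions of growing slope around \<open>F\<close>. They lie above the indicator,
  as the one-sided estimate for closed sets requires; closedness makes the distance positive off
  \<open>F\<close>, so the tents drop to 0 there.\<close>

lemma closed_indicator_approx:
  fixes F :: "'a::metric_space set"
  assumes "closed F"
  obtains h :: "nat \<Rightarrow> 'a \<Rightarrow> real" where
    "\<And>k. bounded_continuous (h k)" "\<And>k x. 0 \<le> h k x \<and> h k x \<le> 1" "\<And>k x. x \<in> F \<Longrightarrow> h k x = 1"
    "\<And>x. (\<lambda>k. h k x) \<longlonglongrightarrow> indicator F x"
\<comment> \<open>The distance to the empty set is 0 by convention, so the tent formula would return
  the constant 1.\<close>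
proof (cases "F = {}")
  case True
  show ?thesis by (rule that[of "\<lambda>_ _. 0"]) (auto simp: True image_constant_conv)
next
  case False
  define h where "h k x = max 0 (1 - real k * infdist x F)" for k x
  show ?thesis
  proof (rule that[of h])
    fix k
    have "\<bar>h k x\<bar> \<le> 1" for x using infdist_nonneg[of x F] by (simp add: h_def)
    then have "bounded (range (h k))" by (intro boundedI[of _ 1]) auto
    then show "bounded_continuous (h k)"
      by (auto simp: h_def[abs_def] intro!: continuous_intros)
  next
    fix x
    show "(\<lambda>k. h k x) \<longlonglongrightarrow> indicator F x"
    proof (cases "x \<in> F")
      case True then show ?thesis by (simp add: h_def)
    next
      case x: False
      then have d: "infdist x F > 0"
        using in_closed_iff_infdist_zero[OF assms False] infdist_nonneg[of x F] by force
      obtain N :: nat where N: "1 < real N * infdist x F" using reals_Archimedean3[OF d] by blast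
      have "h k x = 0" if "k \<ge> N" for k
      proof -
        have "real N * infdist x F \<le> real k * infdist x F" using that d by (intro mult_right_mono) auto
        then show ?thesis using N by (simp add: h_def)
      qed
      then show ?thesis using x
        by (intro tendsto_eventually) (auto simp: eventually_sequentially)
    qed
  qed (auto simp: h_def infdist_nonneg)
qed

lemma integral_indicator_approx:
  fixes \<mu> :: "'a::metric_space measure" and h :: "nat \<Rightarrow> 'a \<Rightarrow> real"
  assumes \<mu>: "\<mu> \<in> borel_probs" and F: "closed F"
    and h: "\<And>k. bounded_continuous (h k)" "\<And>k x. 0 \<le> h k x \<and> h k x \<le> 1"
      "\<And>x. (\<lambda>k. h k x) \<longlonglongrightarrow> indicator F x"
  shows "(\<lambda>k. \<integral>x. h k x \<partial>\<mu>) \<longlonglongrightarrow> measure \<mu> F"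
proof -
  interpret prob_space \<mu> using \<mu> borel_probsD by blast
  have "(\<lambda>k. \<integral>x. h k x \<partial>\<mu>) \<longlonglongrightarrow> (\<integral>x. indicator F x \<partial>\<mu>)"
  proof (rule integral_dominated_convergence[where w="\<lambda>_. 1"])
    show "h k \<in> borel_measurable \<mu>" for k
      using h(1) \<mu> by (simp add: measurable_borel_probs borel_measurable_continuous_onI)
  qed (use F h \<mu> borel_probsD[OF \<mu>] in \<open>auto simp: measurable_borel_probs\<close>)
  then show ?thesis using F borel_probsD[OF \<mu>] by simp
qed

text \<open>Complements of finite unions of basic open sets. Finite unions make the family
  intersection stable, closedness lets the measure of a member be recovered from integrals of
  continuous functions, and the empty union supplies \<open>UNIV\<close>.\<close>

lemma countable_Int_stable_closed_generator:
  obtains E :: "'a::second_countable_topology set set" where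
    "countable E" "Int_stable E" "UNIV \<in> E" "\<And>F. F \<in> E \<Longrightarrow> closed F" "sets borel = sigma_sets UNIV E"
proof -
  obtain B :: "'a set set" where B: "countable B" "topological_basis B"
    using ex_countable_basis by blast
  define E where "E = (\<lambda>\<F>. - \<Union>\<F>) ` {\<F>. finite \<F> \<and> \<F> \<subseteq> B}"
  have cl: "closed F" if "F \<in> E" for F
    using that topological_basis_open[OF B(2)] by (auto simp: E_def)
  have "sigma_sets UNIV E = sets borel"
  proof
    have "E \<subseteq> sets borel" using cl by (auto intro: borel_closed)
    then show "sigma_sets UNIV E \<subseteq> sets borel"
      using sets.sigma_sets_subset[of E borel] by simp
    have "U \<in> sigma_sets UNIV E" if "U \<in> B" for U
    proof -
      have "- U \<in> E" using that by (auto simp: E_def intro!: image_eqI[of _ _ "{U}"])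
      then show ?thesis using sigma_sets.Compl[OF sigma_sets.Basic, of "-U" E UNIV] by auto
    qed
    then have "sigma_sets UNIV B \<subseteq> sigma_sets UNIV E" by (intro sigma_sets_mono) blast
    then show "sets borel \<subseteq> sigma_sets UNIV E"
      by (simp add: borel_eq_countable_basis[OF B])
  qed
  moreover have "countable E"
    unfolding E_def using countable_Collect_finite_subset[OF B(1)] by (rule countable_image)
  moreover have "Int_stable E"
  proof (rule Int_stableI)
    fix X Y assume "X \<in> E" "Y \<in> E"
    then obtain \<F> \<G> where "finite \<F>" "\<F> \<subseteq> B" "X = - \<Union>\<F>" "finite \<G>" "\<G> \<subseteq> B" "Y = - \<Union>\<G>"
      by (auto simp: E_def)
    then show "X \<inter> Y \<in> E" by (auto simp: E_def intro!: image_eqI[of _ _ "\<F> \<union> \<G>"])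
  qed
  moreover have "UNIV \<in> E" by (auto simp: E_def intro!: image_eqI[of _ _ "{}"])
  ultimately show ?thesis using that cl by metis
qed

text \<open>Countability is the point: these integrals become the coordinates of the injection of
  the weak topology into a countable product of lines. Each generating closed set contributes its
  sequence of tents, indexed through \<open>prod_decode\<close>, and a pi-system argument does the
  rest.\<close>

lemma countable_separating_family:
  obtains \<phi> :: "nat \<Rightarrow> 'a::{metric_space, second_countable_topology} \<Rightarrow> real" where
    "\<And>k. bounded_continuous (\<phi> k)"
    "\<And>\<rho> \<sigma>. \<lbrakk>\<rho> \<in> borel_probs; \<sigma> \<in> borel_probs; \<And>k. (\<integral>x. \<phi> k x \<partial>\<rho>) = (\<integral>x. \<phi> k x \<partial>\<sigma>)\<rbrakk> \<Longrightarrow> \<rho> = \<sigma>"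
proof -
  obtain E :: "'a set set" where E: "countable E" "Int_stable E" "UNIV \<in> E" "\<And>F. F \<in> E \<Longrightarrow> closed F"
    "sets borel = sigma_sets UNIV E" by (rule countable_Int_stable_closed_generator) blast
  have "\<exists>h :: nat \<Rightarrow> 'a \<Rightarrow> real. (\<forall>k. bounded_continuous (h k)) \<and> (\<forall>k x. 0 \<le> h k x \<and> h k x \<le> 1) \<and>
      (\<forall>x. (\<lambda>k. h k x) \<longlonglongrightarrow> indicator F x)" if "F \<in> E" for F
    by (rule closed_indicator_approx[OF E(4)[OF that]]) blast
  then obtain h :: "'a set \<Rightarrow> nat \<Rightarrow> 'a \<Rightarrow> real" where h: "\<And>F k. F \<in> E \<Longrightarrow> bounded_continuous (h F k)"
    "\<And>F k x. F \<in> E \<Longrightarrow> 0 \<le> h F k x \<and> h F k x \<le> 1"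
    "\<And>F x. F \<in> E \<Longrightarrow> (\<lambda>k. h F k x) \<longlonglongrightarrow> indicator F x" by metis
  define \<phi> where "\<phi> = (\<lambda>n. case prod_decode n of (i, k) \<Rightarrow> h (from_nat_into E i) k)"
  have ne: "E \<noteq> {}" using E(3) by blast
  show ?thesis
  proof (rule that[of \<phi>])
    show "bounded_continuous (\<phi> k)" for k
      using h(1)[OF from_nat_into[OF ne]] by (simp add: \<phi>_def split: prod.split)
    fix \<rho> \<sigma> :: "'a measure"
    assume \<rho>: "\<rho> \<in> borel_probs" and \<sigma>: "\<sigma> \<in> borel_probs"
      and eq: "\<And>k. (\<integral>x. \<phi> k x \<partial>\<rho>) = (\<integral>x. \<phi> k x \<partial>\<sigma>)"
    interpret \<rho>: prob_space \<rho> using \<rho> borel_probsD by blast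
    interpret \<sigma>: prob_space \<sigma> using \<sigma> borel_probsD by blast
    show "\<rho> = \<sigma>"
    proof (rule measure_eqI_generator_eq[OF E(2), where \<Omega>=UNIV and A="\<lambda>_. UNIV"])
      fix F assume F: "F \<in> E"
      obtain i where i: "from_nat_into E i = F" using from_nat_into_surj[OF E(1) F] by blast
      have "(\<integral>x. h F k x \<partial>\<rho>) = (\<integral>x. h F k x \<partial>\<sigma>)" for k
        using eq[of "prod_encode (i, k)"] by (simp add: \<phi>_def i)
      moreover have "(\<lambda>k. \<integral>x. h F k x \<partial>\<rho>) \<longlonglongrightarrow> measure \<rho> F"
        by (rule integral_indicator_approx[OF \<rho> E(4)[OF F]]) (use h[OF F] in auto)
      moreover have "(\<lambda>k. \<integral>x. h F k x \<partial>\<sigma>) \<longlonglongrightarrow> measure \<sigma> F"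
        by (rule integral_indicator_approx[OF \<sigma> E(4)[OF F]]) (use h[OF F] in auto)
      ultimately show "emeasure \<rho> F = emeasure \<sigma> F"
        using LIMSEQ_unique by (simp add: \<rho>.emeasure_eq_measure \<sigma>.emeasure_eq_measure) blast
    qed (use E borel_probsD[OF \<rho>] borel_probsD[OF \<sigma>] in auto)
  qed
qed

lemma borel_probs_eqI:
  fixes \<rho> \<sigma> :: "'a::{metric_space, second_countable_topology} measure"
  assumes "\<rho> \<in> borel_probs" "\<sigma> \<in> borel_probs"
    and "\<And>f. bounded_continuous f \<Longrightarrow> (\<integral>x. f x \<partial>\<rho>) = (\<integral>x. f x \<partial>\<sigma>)"
  shows "\<rho> = \<sigma>"
  by (rule countable_separating_family[where 'a='a]) (use assms in blast)

lemma limitin_weak_unique: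
  fixes \<rho> :: "'a::{metric_space, second_countable_topology} measure"
  assumes "limitin weak_topology M \<rho> F" "limitin weak_topology M \<sigma> F" "F \<noteq> bot"
  shows "\<rho> = \<sigma>"
  using assms by (intro borel_probs_eqI) (auto simp: limitin_weak_topology intro: tendsto_unique)

text \<open>Half of the portmanteau theorem. The integrals of \<open>h k\<close> pass to the limit
  for fixed \<open>k\<close>, and only then does \<open>k\<close> tend to infinity. Closed sets thus
  lose no mass in the limit, and tightness bounds survive.\<close>

lemma measure_closed_ge_of_integrals:
  fixes \<rho> :: "'a::metric_space measure"
  assumes \<rho>: "\<rho> \<in> borel_probs" "\<And>n. M n \<in> borel_probs"
    and lim: "\<And>f. bounded_continuous f \<Longrightarrow> (\<lambda>n. \<integral>x. f x \<partial>M n) \<longlonglongrightarrow> (\<integral>x. f x \<partial>\<rho>)"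
    and F: "closed F" "\<And>n. measure (M n) F \<ge> c"
  shows "measure \<rho> F \<ge> c"
proof -
  obtain h :: "nat \<Rightarrow> 'a \<Rightarrow> real" where h: "\<And>k. bounded_continuous (h k)"
    "\<And>k x. 0 \<le> h k x \<and> h k x \<le> 1" "\<And>k x. x \<in> F \<Longrightarrow> h k x = 1"
    "\<And>x. (\<lambda>k. h k x) \<longlonglongrightarrow> indicator F x"
    by (rule closed_indicator_approx[OF F(1)]) blast
  have "(\<integral>x. h k x \<partial>\<rho>) \<ge> c" for k
  proof (rule LIMSEQ_le_const[OF lim[OF h(1)]], intro exI allI impI)
    fix n
    interpret prob_space "M n" using \<rho> borel_probsD by blast
    have "measure (M n) F = (\<integral>x. indicator F x \<partial>M n)"
      using borel_probsD[OF \<rho>(2)] F by simp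
    also have "\<dots> \<le> (\<integral>x. h k x \<partial>M n)"
    proof (rule integral_mono)
      show "integrable (M n) (h k)" by (rule integrable_bounded_continuous[OF \<rho>(2) h(1)])
      show "integrable (M n) (indicator F :: 'a \<Rightarrow> real)"
        using F borel_probsD[OF \<rho>(2)] by (auto simp: emeasure_eq_measure)
      show "indicator F x \<le> h k x" for x using h by (auto simp: indicator_def)
    qed
    finally show "c \<le> (\<integral>x. h k x \<partial>M n)" using F(2) by (rule order_trans[rotated])
  qed
  moreover have "(\<lambda>k. \<integral>x. h k x \<partial>\<rho>) \<longlonglongrightarrow> measure \<rho> F"
    by (rule integral_indicator_approx[OF \<rho>(1) F(1)]) (use h in auto)
  ultimately show ?thesis by (intro LIMSEQ_le_const) auto
qed

section \<open>Coding a Polish space by real numbers\<close>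

lemma summable_third_powers:
  fixes d :: "nat \<Rightarrow> real"
  assumes "\<And>i. \<bar>d i\<bar> \<le> 1"
  shows "summable (\<lambda>i. d i * (1/3) ^ i)"
proof (rule summable_comparison_test')
  show "summable (\<lambda>i. (1/3 :: real) ^ i)" by (rule summable_geometric) simp
  show "norm (d i * (1/3) ^ i) \<le> (1/3) ^ i" for i
    using assms[of i] by (simp add: abs_mult mult_left_le_one_le)
qed

text \<open>In base 3 the tail beyond index \<open>k\<close> is at most half of the leading term
  \<open>(1/3) ^ k\<close>, so differences of digits 0 and 1 cannot cancel it. In base 2 the tail
  could equal the leading term.\<close>

lemma geometric_third_gap:
  fixes c :: "nat \<Rightarrow> real"
  assumes c: "\<And>i. \<bar>c i\<bar> \<le> 1" "\<And>i. i < k \<Longrightarrow> c i = 0" "\<bar>c k\<bar> = 1"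
  shows "(1/3) ^ k / 2 \<le> \<bar>\<Sum>i. c i * (1/3) ^ i\<bar>"
proof -
  note sm = summable_third_powers
  define T where "T = (\<Sum>i. c (i + Suc k) * (1/3) ^ i)"
  have "(\<Sum>i. c i * (1/3) ^ i) = (\<Sum>i. c (i + Suc k) * (1/3) ^ (i + Suc k)) + (\<Sum>i<Suc k. c i * (1/3) ^ i)"
    by (rule suminf_split_initial_segment[OF sm]) (rule c)
  also have "(\<lambda>i. c (i + Suc k) * (1/3) ^ (i + Suc k)) = (\<lambda>i. (1/3) ^ Suc k * (c (i + Suc k) * (1/3) ^ i))"
    by (auto simp: power_add)
  also have "(\<Sum>i. (1/3) ^ Suc k * (c (i + Suc k) * (1/3) ^ i)) = (1/3) ^ Suc k * T"
    unfolding T_def by (rule suminf_mult[OF sm]) (rule c)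
  also have "(\<Sum>i<Suc k. c i * (1/3) ^ i) = c k * (1/3) ^ k" using c(2) by simp
  finally have eq: "(\<Sum>i. c i * (1/3) ^ i) = (1/3) ^ k * (c k + T / 3)" by (simp add: field_simps)
  have "\<bar>T\<bar> \<le> (\<Sum>i. (1/3 :: real) ^ i)"
  proof -
    have s: "summable (\<lambda>i. \<bar>c (i + Suc k) * (1/3) ^ i\<bar>)"
      using sm[of "\<lambda>i. \<bar>c (i + Suc k)\<bar>"] c(1) by (simp add: abs_mult)
    have "\<bar>T\<bar> \<le> (\<Sum>i. \<bar>c (i + Suc k) * (1/3) ^ i\<bar>)" unfolding T_def by (rule summable_rabs[OF s])
    also have "\<dots> \<le> (\<Sum>i. (1/3 :: real) ^ i)"
      by (rule suminf_le[OF _ s]) (use c(1) in \<open>auto simp: abs_mult mult_left_le_one_le\<close>)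
    finally show ?thesis .
  qed
  also have "\<dots> = 3/2" by (subst suminf_geometric) auto
  finally have "\<bar>c k + T / 3\<bar> \<ge> 1/2" using c(3) by (auto simp: abs_if split: if_splits)
  then show ?thesis unfolding eq abs_mult by (simp add: field_simps)
qed

text \<open>A Borel injection into the line along which compactness is reflected: on a compact set,
  convergence of the codes forces convergence of the points.\<close>

lemma borel_coding:
  obtains s :: "'a::{metric_space, second_countable_topology} \<Rightarrow> real" where
    "s \<in> borel_measurable borel" "\<And>x. 0 \<le> s x \<and> s x \<le> 2"
    "\<And>x y l l' t. \<lbrakk>x \<longlonglongrightarrow> l; y \<longlonglongrightarrow> l'; (\<lambda>n. s (x n)) \<longlonglongrightarrow> t; (\<lambda>n. s (y n)) \<longlonglongrightarrow> t\<rbrakk> \<Longrightarrow> l = l'"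
    "\<And>C x t. \<lbrakk>compact C; \<And>n::nat. x n \<in> C; (\<lambda>n. s (x n)) \<longlonglongrightarrow> t\<rbrakk> \<Longrightarrow> \<exists>l\<in>C. x \<longlonglongrightarrow> l"
proof -
  obtain B :: "'a set set" where B: "countable B" "topological_basis B"
    using ex_countable_basis by blast
  have Bne: "B \<noteq> {}" using topological_basisE[OF B(2) open_UNIV UNIV_I] by blast
  define U where "U = from_nat_into B"
  have U: "open (U i)" for i
    using from_nat_into[OF Bne] topological_basis_open[OF B(2)] by (auto simp: U_def)
  have Uex: "\<exists>i. l \<in> U i \<and> U i \<subseteq> V" if "open V" "l \<in> V" for l V
    using topological_basisE[OF B(2) that] from_nat_into_surj[OF B(1)] unfolding U_def by metis
  \<comment> \<open>A ternary expansion whose digits record membership in the basic open sets. It is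
    Borel but in general not continuous.\<close>
  define s :: "'a \<Rightarrow> real" where "s x = (\<Sum>i. indicator (U i) x * (1/3) ^ i)" for x
  note sm = summable_third_powers
  \<comment> \<open>A single digit can be read off from the code up to an explicit error: if digit
    \<open>i\<close> differs, then there is a first differing digit \<open>k \<le> i\<close>, and
    this already separates the codes by at least \<open>(1/3) ^ i / 2\<close>.\<close>
  have gap: "\<exists>e>0. \<forall>x y. \<bar>s x - s y\<bar> < e \<longrightarrow> (x \<in> U i \<longleftrightarrow> y \<in> U i)" for i
  proof (intro exI[of _ "(1/3) ^ i / 2"] conjI allI impI)
    fix x y assume less: "\<bar>s x - s y\<bar> < (1/3) ^ i / 2"
    show "x \<in> U i \<longleftrightarrow> y \<in> U i"
    proof (rule ccontr)
      assume ne: "(x \<in> U i) \<noteq> (y \<in> U i)"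
      define k where "k = (LEAST k. (x \<in> U k) \<noteq> (y \<in> U k))"
      have k: "(x \<in> U k) \<noteq> (y \<in> U k)" "k \<le> i" and kl: "\<And>j. j < k \<Longrightarrow> (x \<in> U j) = (y \<in> U j)"
        unfolding k_def using LeastI[of "\<lambda>k. (x \<in> U k) \<noteq> (y \<in> U k)", OF ne]
          Least_le[of "\<lambda>k. (x \<in> U k) \<noteq> (y \<in> U k)", OF ne] not_less_Least by blast+
      define c :: "nat \<Rightarrow> real" where "c j = indicator (U j) x - indicator (U j) y" for j
      have "(1/3) ^ k / 2 \<le> \<bar>\<Sum>j. c j * (1/3) ^ j\<bar>"
        by (rule geometric_third_gap) (use k kl in \<open>auto simp: c_def indicator_def\<close>)
      also have "(\<Sum>j. c j * (1/3) ^ j) = s x - s y"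
        unfolding s_def c_def left_diff_distrib by (rule suminf_diff[symmetric]; rule sm) auto
      finally have "(1/3) ^ k / 2 \<le> \<bar>s x - s y\<bar>" .
      moreover have "(1/3 :: real) ^ i \<le> (1/3) ^ k" using k(2) by (intro power_decreasing) auto
      ultimately show False using less by simp
    qed
  qed simp
  have agree: "\<forall>\<^sub>F n in sequentially. x n \<in> U i \<longleftrightarrow> y n \<in> U i"
    if "(\<lambda>n. s (x n)) \<longlonglongrightarrow> t" "(\<lambda>n. s (y n)) \<longlonglongrightarrow> t" for x y t i
  proof -
    obtain e where e: "e > 0" "\<And>x y. \<bar>s x - s y\<bar> < e \<Longrightarrow> (x \<in> U i \<longleftrightarrow> y \<in> U i)" using gap by blast
    have "(\<lambda>n. s (x n) - s (y n)) \<longlonglongrightarrow> t - t" by (intro tendsto_diff that)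
    then have "(\<lambda>n. s (x n) - s (y n)) \<longlonglongrightarrow> 0" by simp
    from tendstoD[OF this e(1)] show ?thesis by eventually_elim (use e(2) in \<open>auto simp: dist_norm\<close>)
  qed
  have uniq: "l = l'" if x: "x \<longlonglongrightarrow> l" and y: "y \<longlonglongrightarrow> l'"
    and s: "(\<lambda>n. s (x n)) \<longlonglongrightarrow> t" "(\<lambda>n. s (y n)) \<longlonglongrightarrow> t" for x y l l' t
  proof (rule ccontr)
    assume "l \<noteq> l'"
    then obtain V W where VW: "open V" "open W" "l \<in> V" "l' \<in> W" "V \<inter> W = {}" by (rule hausdorff[elim_format]) blast
    obtain i where i: "l \<in> U i" "U i \<subseteq> V" using Uex[OF VW(1,3)] by blast
    have "\<forall>\<^sub>F n in sequentially. False"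
      using topological_tendstoD[OF x U i(1)] topological_tendstoD[OF y VW(2,4)] agree[OF s, of i]
      by eventually_elim (use i VW in blast)
    then show False by simp
  qed
  show ?thesis
  proof (rule that[of s])
    show "s \<in> borel_measurable borel"
      unfolding s_def using U by (intro borel_measurable_suminf) auto
    show "0 \<le> s x \<and> s x \<le> 2" for x
    proof
      show "0 \<le> s x" unfolding s_def by (intro suminf_nonneg sm) auto
      have "s x \<le> (\<Sum>i. (1/3 :: real) ^ i)"
        unfolding s_def by (intro suminf_le sm summable_geometric) (auto simp: indicator_def)
      also have "\<dots> = 3/2" by (subst suminf_geometric) auto
      finally show "s x \<le> 2" by simp
    qed
    show "\<exists>l\<in>C. x \<longlonglongrightarrow> l" if C: "compact C" "\<And>n::nat. x n \<in> C" and t: "(\<lambda>n. s (x n)) \<longlonglongrightarrow> t" for C x t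
    proof -
      have sc: "seq_compact C" using C(1) compact_imp_seq_compact by blast
      obtain l r where l: "l \<in> C" "strict_mono r" "(x \<circ> r) \<longlonglongrightarrow> l"
        using seq_compactE[OF sc] C(2) by metis
      have tr: "(\<lambda>n. s ((x \<circ> r) n)) \<longlonglongrightarrow> t" using LIMSEQ_subseq_LIMSEQ[OF t l(2)] by (simp add: o_def)
      \<comment> \<open>Compactness gives a limit along one subsequence; a subsequence staying away
        from it would have another limit in \<open>C\<close> with the same limit code, against
        \<open>uniq\<close>.\<close>
      have "x \<longlonglongrightarrow> l"
      proof (rule ccontr)
        assume "\<not> x \<longlonglongrightarrow> l"
        then obtain V where V: "open V" "l \<in> V" "\<not> (\<forall>\<^sub>F n in sequentially. x n \<in> V)"
          by (auto simp: tendsto_def)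
        then have "\<forall>N. \<exists>n>N. x n \<notin> V" by (auto simp: eventually_at_top_dense)
        then have "infinite {n. x n \<notin> V}" by (auto simp: infinite_nat_iff_unbounded)
        then obtain q :: "nat \<Rightarrow> nat" where q: "strict_mono q" "\<And>n. x (q n) \<notin> V"
          using infinite_enumerate by (metis mem_Collect_eq)
        obtain l' r' where l': "l' \<in> C" "strict_mono r'" "((x \<circ> q) \<circ> r') \<longlonglongrightarrow> l'"
          using seq_compactE[OF sc, of "x \<circ> q"] C(2) by auto
        have "(\<lambda>n. s (((x \<circ> q) \<circ> r') n)) \<longlonglongrightarrow> t"
          using LIMSEQ_subseq_LIMSEQ[OF t strict_mono_o[OF q(1) l'(2)]] by (simp add: o_def)
        then have "l = l'" by (rule uniq[OF l(3) l'(3) tr])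
        then have "\<forall>\<^sub>F n in sequentially. ((x \<circ> q) \<circ> r') n \<in> V"
          using topological_tendstoD[OF l'(3) V(1)] V(2) by simp
        then have "\<forall>\<^sub>F n :: nat in sequentially. False" by eventually_elim (use q(2) in simp)
        then show False by simp
      qed
      then show ?thesis using l(1) by blast
    qed
  qed (use uniq in blast)
qed

section \<open>Relative sequential compactness of tight families\<close>

lemma prob_space_return_borel: "return borel x \<in> borel_probs"
  by (simp add: borel_probs_def prob_space_return)

text \<open>The sequential half of Prokhorov's theorem. The laws \<open>N n\<close> of the codes
  live on a bounded interval, so a subsequence converges on the line; its limit \<open>\<nu>\<close>
  is carried up to \<open>e m\<close> by the closure \<open>F m\<close> of the coded compact set
  \<open>C m\<close>, on which decoding is continuous. The limit on the space is the law of the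
  decoded point.\<close>

theorem weak_convergent_subsequence:
  fixes M :: "nat \<Rightarrow> 'a::polish_space measure"
  assumes M: "\<And>n. M n \<in> borel_probs" and C: "\<And>m. compact (C m)"
    and e: "e \<longlonglongrightarrow> 0" and ge: "\<And>n m. measure (M n) (C m) \<ge> 1 - e m"
  obtains r \<rho> where "strict_mono (r :: nat \<Rightarrow> nat)" "limitin weak_topology (M \<circ> r) \<rho> sequentially"
proof -
  obtain s :: "'a \<Rightarrow> real" where s[measurable]: "s \<in> borel_measurable borel"
    and s02: "\<And>x. 0 \<le> s x \<and> s x \<le> 2"
    and uniq: "\<And>x y l l' t. \<lbrakk>x \<longlonglongrightarrow> l; y \<longlonglongrightarrow> l'; (\<lambda>n. s (x n)) \<longlonglongrightarrow> t; (\<lambda>n. s (y n)) \<longlonglongrightarrow> t\<rbrakk> \<Longrightarrow> l = l'"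
    and conv: "\<And>C x t. \<lbrakk>compact C; \<And>n::nat. x n \<in> C; (\<lambda>n. s (x n)) \<longlonglongrightarrow> t\<rbrakk> \<Longrightarrow> \<exists>l\<in>C. x \<longlonglongrightarrow> l"
    by (rule borel_coding[where 'a='a]) blast
  define N where "N n = distr (M n) borel s" for n
  have N: "N n \<in> borel_probs" for n
    unfolding N_def using borel_probsD[OF M] s by (intro borel_probs_distr) (auto simp: measurable_borel_probs[OF M])
  have rd: "real_distribution (N n)" for n
    using borel_probsD[OF N[of n]] by (simp add: real_distribution_def real_distribution_axioms_def)
  have intN: "(\<integral>x. f x \<partial>N n) = (\<integral>x. f (s x) \<partial>M n)" if "f \<in> borel_measurable borel" for f :: "real \<Rightarrow> real" and n
    unfolding N_def using that s by (intro integral_distr) (auto simp: measurable_borel_probs[OF M])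
  have tight: "tight N"
  proof -
    \<comment> \<open>All codes lie between 0 and 2; the half-open interval demanded by
      \<open>tight\<close> only has to contain them.\<close>
    have "1 - \<epsilon> < measure (N n) {-1<..3}" if "\<epsilon> > 0" for \<epsilon> :: real and n
    proof -
      have "measure (N n) {-1<..3} = measure (M n) (s -` {-1<..3} \<inter> space (M n))"
        unfolding N_def by (rule measure_distr) (use s M in \<open>auto simp: measurable_borel_probs\<close>)
      also have "s -` {-1<..3} \<inter> space (M n) = space (M n)"
      proof -
        have "-1 < s x \<and> s x \<le> 3" for x using s02[of x] by linarith
        then show ?thesis by auto
      qed
      also have "measure (M n) (space (M n)) = 1"
        using borel_probsD(3)[OF M] by (rule prob_space.prob_space)
      finally show ?thesis using that by simp
    qed
    then have "-1 < (3 :: real) \<and> (\<forall>n. 1 - \<epsilon> < measure (N n) {-1<..3})" if "\<epsilon> > 0" for \<epsilon> :: real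
      using that by simp
    then show ?thesis
      unfolding tight_def using rd by blast
  qed
  have "\<exists>r \<nu>. strict_mono (r :: nat \<Rightarrow> nat) \<and> real_distribution \<nu> \<and> weak_conv_m (N \<circ> id \<circ> r) \<nu>"
    by (rule tight_imp_convergent_subsubsequence[OF tight strict_mono_id])
  then obtain r \<nu> where r: "strict_mono (r :: nat \<Rightarrow> nat)" and \<nu>: "real_distribution \<nu>" and w: "weak_conv_m (N \<circ> r) \<nu>"
    by auto
  have \<nu>P: "\<nu> \<in> borel_probs"
    using \<nu> by (simp add: borel_probs_def real_distribution_def real_distribution_axioms_def)
  interpret \<nu>: prob_space \<nu> using borel_probsD(3)[OF \<nu>P] .
  have wint: "(\<lambda>n. \<integral>x. f x \<partial>N (r n)) \<longlonglongrightarrow> (\<integral>x. f x \<partial>\<nu>)" if f: "bounded_continuous f" for f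
  proof -
    obtain B where "\<And>x. norm (f x) \<le> B" using f by (auto simp: bounded_iff)
    then show ?thesis
      using f weak_conv_imp_integral_bdd_continuous_conv[of "N \<circ> r" \<nu> f B] rd \<nu> w
      by (auto simp: o_def continuous_on_eq_continuous_at)
  qed
  \<comment> \<open>Since \<open>s\<close> is in general not continuous, the coded compact set may
    fail to be closed, and only closed sets are sure to keep their mass in the limit.\<close>
  define F where "F m = closure (s ` C m)" for m
  have Fcl: "closed (F m)" for m by (simp add: F_def)
  have NF: "measure (N n) (F m) \<ge> 1 - e m" for n m
  proof -
    interpret prob_space "M n" using borel_probsD(3)[OF M] .
    have "measure (M n) (C m) \<le> measure (M n) (s -` F m \<inter> space (M n))"
    proof (rule finite_measure_mono)
      show "C m \<subseteq> s -` F m \<inter> space (M n)"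
        using closure_subset[of "s ` C m"] borel_probsD(2)[OF M] by (auto simp: F_def)
      show "s -` F m \<inter> space (M n) \<in> sets (M n)"
        by (rule measurable_sets[of _ _ borel]) (use s Fcl in \<open>auto simp: measurable_borel_probs[OF M]\<close>)
    qed
    also have "\<dots> = measure (N n) (F m)"
      unfolding N_def by (rule measure_distr[symmetric]) (use s Fcl in \<open>auto simp: measurable_borel_probs[OF M]\<close>)
    finally show ?thesis using ge[of m n] by simp
  qed
  have \<nu>F: "measure \<nu> (F m) \<ge> 1 - e m" for m
    by (rule measure_closed_ge_of_integrals[where M="\<lambda>n. N (r n)"]) (use \<nu>P N NF wint Fcl in auto)
  \<comment> \<open>Decoding is defined on limits of codes, not only on codes: \<open>R t l\<close>
    says that some points tending to \<open>l\<close> have codes tending to \<open>t\<close>. By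
    \<open>uniq\<close> there is at most one such \<open>l\<close>, and constant sequences show that
    decoding inverts \<open>s\<close>.\<close>
  define R where "R t l \<longleftrightarrow> (\<exists>x::nat \<Rightarrow> 'a. x \<longlonglongrightarrow> l \<and> (\<lambda>n. s (x n)) \<longlonglongrightarrow> t)" for t l
  define \<phi> where "\<phi> t = (SOME l. R t l)" for t
  have \<phi>eq: "\<phi> t = l" if "R t l" for t l
    using someI[of "R t" l, OF that] that uniq unfolding \<phi>_def R_def by blast
  have seqF: "\<exists>x. (\<forall>n. x n \<in> C m) \<and> (\<lambda>n. s (x n)) \<longlonglongrightarrow> t \<and> x \<longlonglongrightarrow> \<phi> t" if tF: "t \<in> F m" for t m
  proof -
    obtain y where y: "\<forall>n. y n \<in> s ` C m" "y \<longlonglongrightarrow> t"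
      using tF unfolding F_def closure_sequential by blast
    have "\<forall>n. \<exists>x. x \<in> C m \<and> y n = s x" using y(1) by blast
    then obtain x where x: "\<And>n. x n \<in> C m" and "\<And>n. y n = s (x n)" by metis
    then have "y = (\<lambda>n. s (x n))" by blast
    with y(2) have sx: "(\<lambda>n. s (x n)) \<longlonglongrightarrow> t" by simp
    have "\<exists>l\<in>C m. x \<longlonglongrightarrow> l" by (rule conv[OF C x sx])
    then obtain l where "x \<longlonglongrightarrow> l" by blast
    with x sx \<phi>eq[of t l] show ?thesis unfolding R_def by blast
  qed
  have \<phi>s: "\<phi> (s x) = x" for x by (rule \<phi>eq) (auto simp: R_def)
  have \<phi>cont: "continuous_on (F m) \<phi>" for m
    unfolding continuous_on_sequentially
  proof (intro allI ballI impI, elim conjE)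
    fix t a assume a: "a \<in> F m" and t: "\<forall>n. t n \<in> F m" "t \<longlonglongrightarrow> a"
    \<comment> \<open>A diagonal choice: a point of \<open>C m\<close> close to the decoded
      \<open>\<phi> (t n)\<close> whose code is close to \<open>t n\<close>. The codes of these
      points tend to \<open>a\<close>, so compactness of \<open>C m\<close> makes the points
      converge to \<open>\<phi> a\<close>.\<close>
    have "\<exists>x. x \<in> C m \<and> dist (s x) (t n) < 1 / real (Suc n) \<and> dist x (\<phi> (t n)) < 1 / real (Suc n)" for n
    proof -
      obtain x where x: "\<forall>n. x n \<in> C m" "(\<lambda>n. s (x n)) \<longlonglongrightarrow> t n" "x \<longlonglongrightarrow> \<phi> (t n)"
        using seqF t(1) by blast
      have p: "1 / real (Suc n) > 0" by simp
      have "\<forall>\<^sub>F k in sequentially. dist (s (x k)) (t n) < 1 / real (Suc n) \<and> dist (x k) (\<phi> (t n)) < 1 / real (Suc n)"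
        using tendstoD[OF x(2) p] tendstoD[OF x(3) p] by eventually_elim simp
      from eventually_happens'[OF sequentially_bot this] show ?thesis using x(1) by blast
    qed
    then obtain x where x: "\<And>n. x n \<in> C m" "\<And>n. dist (s (x n)) (t n) < 1 / real (Suc n)"
      "\<And>n. dist (x n) (\<phi> (t n)) < 1 / real (Suc n)" by metis
    have z: "(\<lambda>n. 1 / real (Suc n)) \<longlonglongrightarrow> 0" using LIMSEQ_inverse_real_of_nat by (simp add: inverse_eq_divide)
    have "(\<lambda>n. dist (s (x n)) (t n)) \<longlonglongrightarrow> 0"
      by (rule tendsto_sandwich[OF _ _ tendsto_const z]) (use x(2) in \<open>auto intro!: always_eventually less_imp_le\<close>)
    then have "(\<lambda>n. s (x n) - t n) \<longlonglongrightarrow> 0" by (simp add: dist_real_def tendsto_rabs_zero_iff)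
    from tendsto_add[OF this t(2)] have sx: "(\<lambda>n. s (x n)) \<longlonglongrightarrow> a" by simp
    have "\<exists>l\<in>C m. x \<longlonglongrightarrow> l" by (rule conv[OF C x(1) sx])
    then obtain l where "x \<longlonglongrightarrow> l" by blast
    with sx have xa: "x \<longlonglongrightarrow> \<phi> a" using \<phi>eq[of a l] unfolding R_def by blast
    have d: "(\<lambda>n. dist (x n) (\<phi> (t n))) \<longlonglongrightarrow> 0"
      by (rule tendsto_sandwich[OF _ _ tendsto_const z]) (use x(3) in \<open>auto intro!: always_eventually less_imp_le\<close>)
    have "(\<lambda>n. dist (\<phi> (t n)) (\<phi> a)) \<longlonglongrightarrow> 0"
    proof (rule tendsto_sandwich[OF _ _ tendsto_const])
      show "(\<lambda>n. dist (x n) (\<phi> (t n)) + dist (x n) (\<phi> a)) \<longlonglongrightarrow> 0"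
        using tendsto_add[OF d] xa tendsto_dist_iff[of x] by fastforce
      show "\<forall>\<^sub>F n in sequentially. dist (\<phi> (t n)) (\<phi> a) \<le> dist (x n) (\<phi> (t n)) + dist (x n) (\<phi> a)"
        by (auto intro!: always_eventually dist_triangle3)
    qed auto
    then show "(\<phi> \<circ> t) \<longlonglongrightarrow> \<phi> a" by (subst tendsto_dist_iff) (simp add: o_def)
  qed
  \<comment> \<open>A countable Borel cover of the line, on each piece of which
    \<open>\<psi>\<close> is constant or continuous.\<close>
  define A where "A n = (case n of 0 \<Rightarrow> - (\<Union>m. F m) | Suc m \<Rightarrow> F m)" for n
  define x0 :: 'a where "x0 = undefined"
  define \<psi> where "\<psi> t = (if t \<in> (\<Union>m. F m) then \<phi> t else x0)" for t
  have \<psi>F: "\<psi> t = \<phi> t" if "t \<in> F m" for t m using that by (auto simp: \<psi>_def)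
  have \<psi>[measurable]: "\<psi> \<in> borel_measurable borel"
  proof (rule measurable_piecewise_restrict[where C="range A"])
    show "X \<inter> space borel \<in> sets borel" if "X \<in> range A" for X
      using that Fcl by (auto simp: A_def split: nat.split)
    show "space borel \<subseteq> \<Union> (range A)"
    proof
      fix t show "t \<in> \<Union> (range A)"
        by (cases "t \<in> (\<Union>m. F m)") (auto simp: A_def intro: UN_I[of "Suc _"] UN_I[of 0] split: nat.split)
    qed
    fix X assume "X \<in> range A"
    then obtain n where X: "X = A n" by blast
    show "\<psi> \<in> borel_measurable (restrict_space borel X)"
    proof (cases n)
      case 0
      then have "\<psi> t = x0" if "t \<in> X" for t using that X by (auto simp: A_def \<psi>_def)
      then show ?thesis
        by (subst measurable_cong[where g="\<lambda>_. x0"]) (auto simp: space_restrict_space)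
    next
      case (Suc m)
      then have "continuous_on X \<psi>"
        using continuous_on_cong[of "F m" "F m" \<psi> \<phi>] \<phi>cont X \<psi>F by (auto simp: A_def)
      then show ?thesis by (rule borel_measurable_continuous_on_restrict)
    qed
  qed simp
  define \<rho> where "\<rho> = distr \<nu> borel \<psi>"
  have \<rho>: "\<rho> \<in> borel_probs"
    unfolding \<rho>_def using \<psi> by (intro borel_probs_distr \<nu>.prob_space_axioms) (simp add: measurable_borel_probs[OF \<nu>P])
  have lim: "(\<lambda>n. \<integral>x. f x \<partial>M (r n)) \<longlonglongrightarrow> (\<integral>x. f x \<partial>\<rho>)" if f: "bounded_continuous f" for f
  proof -
    obtain B where B: "\<And>x. norm (f x) \<le> B" using f by (auto simp: bounded_iff)
    have B0: "B \<ge> 0" using B[of x0] norm_ge_zero order_trans by blast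
    have [measurable]: "f \<in> borel_measurable borel" using f by (simp add: borel_measurable_continuous_onI)
    have "\<exists>g. bounded_continuous g \<and> (\<forall>n. \<bar>(\<integral>x. g x \<partial>N n) - (\<integral>x. f x \<partial>M n)\<bar> \<le> 2 * B * e m) \<and>
        \<bar>(\<integral>x. g x \<partial>\<nu>) - (\<integral>x. f x \<partial>\<rho>)\<bar> \<le> 2 * B * e m" for m
    proof -
      \<comment> \<open>Convergence on the line is tested with functions continuous everywhere, so
        \<open>f \<circ> \<phi>\<close> is extended from \<open>F m\<close> by Tietze with the same
        bound \<open>B\<close>. The extension differs from \<open>f \<circ> \<psi>\<close> by at
        most \<open>2 * B\<close>, and only off \<open>F m\<close>, whence the error
        \<open>2 * B * e m\<close>.\<close>
      have "continuous_on (F m) (\<lambda>t. f (\<phi> t))"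
        using f continuous_on_compose2[of UNIV f "F m" \<phi>] \<phi>cont by auto
      from Tietze[OF this, of UNIV B] obtain g where g: "continuous_on UNIV g"
        "\<And>t. t \<in> F m \<Longrightarrow> g t = f (\<phi> t)" "\<And>t. norm (g t) \<le> B"
        using Fcl B B0 by auto
      have gb: "bounded_continuous g" using g(1,3) by (auto intro!: boundedI[of _ B])
      have [measurable]: "g \<in> borel_measurable borel" using g(1) by (simp add: borel_measurable_continuous_onI)
      have key: "\<bar>(\<integral>t. g t \<partial>\<mu>) - (\<integral>t. f (\<psi> t) \<partial>\<mu>)\<bar> \<le> 2 * B * e m"
        if \<mu>: "\<mu> \<in> borel_probs" and mF: "measure \<mu> (F m) \<ge> 1 - e m" for \<mu>
      proof -
        interpret prob_space \<mu> using borel_probsD(3)[OF \<mu>] .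
        have Fs: "F m \<in> sets \<mu>" using Fcl borel_probsD(1)[OF \<mu>] by auto
        have ig: "integrable \<mu> g" by (rule integrable_bounded_continuous[OF \<mu> gb])
        have if': "integrable \<mu> (\<lambda>t. f (\<psi> t))"
          by (rule integrable_borel_probs[OF \<mu>]) (use B in \<open>auto intro!: boundedI[of _ B]\<close>)
        have ii: "integrable \<mu> (\<lambda>t. 2 * B * indicator (- F m) t)"
        proof (rule integrable_borel_probs[OF \<mu>])
          show "(\<lambda>t. 2 * B * indicator (- F m) t) \<in> borel_measurable borel" using Fcl[of m] by measurable
          show "bounded (range (\<lambda>t. 2 * B * indicator (- F m) t))"
            using B0 by (intro boundedI[of _ "2 * B"]) (auto simp: indicator_def)
        qed
        have "\<bar>(\<integral>t. g t \<partial>\<mu>) - (\<integral>t. f (\<psi> t) \<partial>\<mu>)\<bar> = \<bar>\<integral>t. g t - f (\<psi> t) \<partial>\<mu>\<bar>"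
          using ig if' by simp
        also have "\<dots> \<le> (\<integral>t. \<bar>g t - f (\<psi> t)\<bar> \<partial>\<mu>)" by (rule integral_abs_bound)
        also have "\<dots> \<le> (\<integral>t. 2 * B * indicator (- F m) t \<partial>\<mu>)"
        proof (rule integral_mono[OF _ ii])
          show "integrable \<mu> (\<lambda>t. \<bar>g t - f (\<psi> t)\<bar>)" using ig if' by simp
          show "\<bar>g t - f (\<psi> t)\<bar> \<le> 2 * B * indicator (- F m) t" for t
          proof (cases "t \<in> F m")
            case True then show ?thesis using g(2) \<psi>F by simp
          next
            case False
            have "\<bar>g t - f (\<psi> t)\<bar> \<le> \<bar>g t\<bar> + \<bar>f (\<psi> t)\<bar>" by simp
            also have "\<dots> \<le> B + B" using g(3)[of t] B[of "\<psi> t"] by simp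
            finally show ?thesis using False by simp
          qed
        qed
        also have "\<dots> = 2 * B * measure \<mu> (- F m)"
          using Fs borel_probsD(2)[OF \<mu>] by (simp add: Compl_eq_Diff_UNIV)
        also have "measure \<mu> (- F m) = 1 - measure \<mu> (F m)"
          using prob_compl[OF Fs] borel_probsD(2)[OF \<mu>] by (simp add: Compl_eq_Diff_UNIV)
        also have "2 * B * (1 - measure \<mu> (F m)) \<le> 2 * B * e m"
          using mF B0 by (intro mult_left_mono) auto
        finally show ?thesis .
      qed
      \<comment> \<open>The sets \<open>C m\<close> exhaust the mass of \<open>M n\<close>, and on
        them decoding undoes coding.\<close>
      have comp: "(\<integral>t. f (\<psi> t) \<partial>N n) = (\<integral>x. f x \<partial>M n)" for n
      proof -
        have sE: "s x \<in> (\<Union>m. F m)" if "x \<in> C m'" for x m'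
          using that closure_subset[of "s ` C m'"] by (auto simp: F_def)
        interpret prob_space "M n" using borel_probsD(3)[OF M] .
        have "AE x in M n. x \<in> (\<Union>m. C m)"
        proof -
          have Cs: "(\<Union>m. C m) \<in> sets (M n)" using C borel_probsD(1)[OF M] by (auto intro: borel_compact)
          have "prob (\<Union>m. C m) \<ge> 1"
          proof (rule LIMSEQ_le_const2)
            show "(\<lambda>m. 1 - e m) \<longlonglongrightarrow> 1" using tendsto_diff[OF tendsto_const e, of 1] by simp
            have "1 - e m \<le> prob (\<Union>m. C m)" for m
              using finite_measure_mono[OF _ Cs, of "C m"] ge[of m n] by force
            then show "\<exists>N. \<forall>m\<ge>N. 1 - e m \<le> prob (\<Union>m. C m)" by blast
          qed
          then have "prob (\<Union>m. C m) = 1" using prob_le_1 by (rule antisym[rotated])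
          then show ?thesis using Cs by (subst AE_in_set_eq_1) auto
        qed
        then have "AE x in M n. f (\<psi> (s x)) = f x"
          by eventually_elim (use sE \<phi>s in \<open>auto simp: \<psi>_def\<close>)
        then have "(\<integral>x. f (\<psi> (s x)) \<partial>M n) = (\<integral>x. f x \<partial>M n)"
          by (intro integral_cong_AE) (auto simp: measurable_borel_probs[OF M])
        then show ?thesis by (subst intN) auto
      qed
      have comp\<nu>: "(\<integral>t. f (\<psi> t) \<partial>\<nu>) = (\<integral>x. f x \<partial>\<rho>)"
        unfolding \<rho>_def by (rule integral_distr[symmetric]) (auto simp: measurable_borel_probs[OF \<nu>P])
      show ?thesis using key[OF N NF, unfolded comp] key[OF \<nu>P \<nu>F, unfolded comp\<nu>] gb by blast
    qed
    then obtain g where g: "\<And>m. bounded_continuous (g m)"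
      "\<And>m n. \<bar>(\<integral>x. g m x \<partial>N n) - (\<integral>x. f x \<partial>M n)\<bar> \<le> 2 * B * e m"
      "\<And>m. \<bar>(\<integral>x. g m x \<partial>\<nu>) - (\<integral>x. f x \<partial>\<rho>)\<bar> \<le> 2 * B * e m" by metis
    show ?thesis
    proof (rule LIMSEQ_I)
      fix \<epsilon> :: real assume \<epsilon>: "\<epsilon> > 0"
      have "(\<lambda>m. 2 * B * e m) \<longlonglongrightarrow> 0" using tendsto_mult_left[OF e, of "2 * B"] by simp
      then have "\<forall>\<^sub>F m in sequentially. 2 * B * e m < \<epsilon> / 3" using \<epsilon> by (intro order_tendstoD) auto
      then obtain m where m: "2 * B * e m < \<epsilon> / 3" using eventually_happens' sequentially_bot by blast
      obtain n0 where n0: "\<And>n. n \<ge> n0 \<Longrightarrow> norm ((\<integral>x. g m x \<partial>N (r n)) - (\<integral>x. g m x \<partial>\<nu>)) < \<epsilon> / 3"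
        using LIMSEQ_D[OF wint[OF g(1)], of "\<epsilon> / 3" m] \<epsilon> by auto
      have "norm ((\<integral>x. f x \<partial>M (r n)) - (\<integral>x. f x \<partial>\<rho>)) < \<epsilon>" if "n \<ge> n0" for n
        using n0[OF that] g(2)[of "r n" m] g(3)[of m] m unfolding real_norm_def by linarith
      then show "\<exists>no. \<forall>n\<ge>no. norm ((\<integral>x. f x \<partial>M (r n)) - (\<integral>x. f x \<partial>\<rho>)) < \<epsilon>" by blast
    qed
  qed
  show ?thesis
    by (rule that[OF r, of \<rho>]) (use lim M \<rho> in \<open>auto simp: limitin_weak_topology\<close>)
qed

section \<open>The weak topology on tight families\<close>

lemma limitin_subsubsequence:
  assumes "\<And>r. strict_mono (r :: nat \<Rightarrow> nat) \<Longrightarrow>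
      \<exists>q. strict_mono (q :: nat \<Rightarrow> nat) \<and> limitin X (s \<circ> r \<circ> q) l sequentially"
  shows "limitin X s l sequentially"
  unfolding limitin_def
proof (intro conjI allI impI)
  show "l \<in> topspace X" using assms[OF strict_mono_id] limitin_topspace by metis
  fix U assume U: "openin X U \<and> l \<in> U"
  show "\<forall>\<^sub>F n in sequentially. s n \<in> U"
  proof (rule ccontr)
    assume "\<not> (\<forall>\<^sub>F n in sequentially. s n \<in> U)"
    then have "\<forall>N. \<exists>n>N. s n \<notin> U" by (auto simp: eventually_at_top_dense)
    then have "infinite {n. s n \<notin> U}" by (auto simp: infinite_nat_iff_unbounded)
    then obtain r :: "nat \<Rightarrow> nat" where r: "strict_mono r" "\<And>n. s (r n) \<notin> U"
      using infinite_enumerate by (metis mem_Collect_eq)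
    obtain q where "limitin X (s \<circ> r \<circ> q) l sequentially" using assms[OF r(1)] by blast
    then have "\<forall>\<^sub>F n in sequentially. (s \<circ> r \<circ> q) n \<in> U" using U unfolding limitin_def by blast
    then have "\<forall>\<^sub>F n :: nat in sequentially. False" by eventually_elim (use r(2) in simp)
    then show False by simp
  qed
qed

text \<open>Sequences detect closed sets in a metrizable domain. The target is arbitrary, so the
  weak topology, not shown to be metrizable as a whole, may take its place.\<close>

lemma continuous_map_sequentiallyI:
  assumes X: "metrizable_space X" and f: "f \<in> topspace X \<rightarrow> topspace Y"
    and seq: "\<And>\<sigma> z. \<lbrakk>range \<sigma> \<subseteq> topspace X; limitin X \<sigma> z sequentially\<rbrakk> \<Longrightarrow> limitin Y (f \<circ> \<sigma>) (f z) sequentially"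
  shows "continuous_map X Y f"
proof -
  obtain M d where Md: "Metric_space M d" and eq: "X = Metric_space.mtopology M d"
    using X unfolding metrizable_space_def by blast
  interpret Metric_space M d by fact
  show ?thesis
    unfolding continuous_map_closedin
  proof (intro conjI ballI allI impI)
    fix C assume C: "closedin Y C"
    show "closedin X {x \<in> topspace X. f x \<in> C}"
      unfolding eq metric_closedin_iff_sequentially_closed
    proof (intro conjI allI impI)
      fix \<sigma> z assume a: "range \<sigma> \<subseteq> {x \<in> topspace mtopology. f x \<in> C} \<and> limitin mtopology \<sigma> z sequentially"
      then have "limitin Y (f \<circ> \<sigma>) (f z) sequentially" by (intro seq) (auto simp: eq)
      then have "f z \<in> C"
        by (rule limitin_closedin[OF _ C]) (use a in \<open>auto intro!: always_eventually\<close>)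
      then show "z \<in> {x \<in> topspace mtopology. f x \<in> C}" using a limitin_topspace by fastforce
    qed auto
  qed (use f in blast)
qed

lemma continuous_map_weak_integral:
  fixes f :: "'a::topological_space \<Rightarrow> real"
  assumes "bounded_continuous f"
  shows "continuous_map weak_topology euclidean (\<lambda>\<rho>. \<integral>x. f x \<partial>\<rho>)"
  unfolding continuous_map_def
proof (intro conjI allI impI)
  fix U :: "real set" assume "openin euclidean U"
  then show "openin weak_topology {\<rho> \<in> topspace weak_topology. (\<integral>x. f x \<partial>\<rho>) \<in> U}"
    unfolding topspace_weak_topology unfolding weak_topology_def
    by (intro topology_generated_by_Basis) (use assms in auto)
qed auto

text \<open>A continuous injection; continuity of the inverse on the image is not claimed here. It
  gives the Hausdorff property and identifies limits.\<close>

lemma weak_topology_embedding: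
  obtains \<Phi> :: "'a::{metric_space, second_countable_topology} measure \<Rightarrow> nat \<Rightarrow> real" where
    "continuous_map weak_topology euclidean \<Phi>" "inj_on \<Phi> borel_probs"
proof -
  obtain \<phi> :: "nat \<Rightarrow> 'a \<Rightarrow> real" where \<phi>: "\<And>k. bounded_continuous (\<phi> k)"
    "\<And>\<rho> \<sigma>. \<lbrakk>\<rho> \<in> borel_probs; \<sigma> \<in> borel_probs; \<And>k. (\<integral>x. \<phi> k x \<partial>\<rho>) = (\<integral>x. \<phi> k x \<partial>\<sigma>)\<rbrakk> \<Longrightarrow> \<rho> = \<sigma>"
    by (rule countable_separating_family[where 'a='a]) blast
  show ?thesis
  proof (rule that[of "\<lambda>\<rho> k. \<integral>x. \<phi> k x \<partial>\<rho>"])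
    show "continuous_map weak_topology euclidean (\<lambda>\<rho> k. \<integral>x. \<phi> k x \<partial>\<rho>)"
      unfolding euclidean_product_topology[symmetric] continuous_map_componentwise_UNIV
      using continuous_map_weak_integral[OF \<phi>(1)] by blast
    show "inj_on (\<lambda>\<rho> k. \<integral>x. \<phi> k x \<partial>\<rho>) borel_probs"
      by (rule inj_onI) (rule \<phi>(2), auto dest: fun_cong)
  qed
qed

lemma Hausdorff_space_weak_topology:
  "Hausdorff_space (weak_topology :: 'a::{metric_space, second_countable_topology} measure topology)"
proof -
  obtain \<Phi> :: "'a measure \<Rightarrow> nat \<Rightarrow> real" where
    "continuous_map weak_topology euclidean \<Phi>" "inj_on \<Phi> borel_probs"
    by (rule weak_topology_embedding)
  then show ?thesis
    using Hausdorff_space_injective_preimage[OF Hausdorff_space_euclidean]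
    by (metis topspace_weak_topology)
qed

text \<open>The sequential form is what tight families provide directly;
  \<open>weak_seq_compact_homeomorphic\<close> turns it into topological compactness.\<close>

definition weak_seq_compact :: "'a::topological_space measure set \<Rightarrow> bool" where
  "weak_seq_compact K \<longleftrightarrow> K \<subseteq> borel_probs \<and>
     (\<forall>\<sigma> :: nat \<Rightarrow> 'a measure. range \<sigma> \<subseteq> K \<longrightarrow>
        (\<exists>r \<rho>. strict_mono r \<and> \<rho> \<in> K \<and> limitin weak_topology (\<sigma> \<circ> r) \<rho> sequentially))"

text \<open>The image under \<open>\<Phi>\<close> is compact because subsequences converge inside
  \<open>K\<close>. The inverse is continuous for the same reason: along a convergent sequence of
  images every weak sublimit has the prescribed image, hence is the prescribed measure.\<close>

lemma weak_seq_compact_homeomorphic: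
  fixes K :: "'a::{metric_space, second_countable_topology} measure set"
  assumes K: "weak_seq_compact K"
  obtains D :: "(nat \<Rightarrow> real) set" where "compact D"
    "subtopology weak_topology K homeomorphic_space top_of_set D"
proof -
  have KP: "K \<subseteq> borel_probs" using K by (simp add: weak_seq_compact_def)
  have sub: "\<exists>r \<rho>. strict_mono r \<and> \<rho> \<in> K \<and> limitin weak_topology (\<sigma> \<circ> r) \<rho> sequentially"
    if "range \<sigma> \<subseteq> K" for \<sigma> :: "nat \<Rightarrow> 'a measure"
    using K that by (simp add: weak_seq_compact_def)
  obtain \<Phi> :: "'a measure \<Rightarrow> nat \<Rightarrow> real" where
    cont: "continuous_map weak_topology euclidean \<Phi>" and inj: "inj_on \<Phi> borel_probs"
    by (rule weak_topology_embedding)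
  have lim: "(\<lambda>n. \<Phi> (\<sigma> n)) \<longlonglongrightarrow> \<Phi> \<rho>" if "limitin weak_topology \<sigma> \<rho> sequentially" for \<sigma> \<rho>
    using continuous_map_limit[OF cont that] by (simp add: o_def)
  define g where "g = inv_into K \<Phi>"
  have injK: "inj_on \<Phi> K" using inj KP inj_on_subset by blast
  have g\<Phi>: "g (\<Phi> \<rho>) = \<rho>" if "\<rho> \<in> K" for \<rho> using injK that by (simp add: g_def)
  have "compact (\<Phi> ` K)"
    unfolding compact_eq_seq_compact_metric
  proof (rule seq_compactI)
    fix t :: "nat \<Rightarrow> nat \<Rightarrow> real" assume "\<forall>n. t n \<in> \<Phi> ` K"
    then have t: "g (t n) \<in> K" "\<Phi> (g (t n)) = t n" for n
      unfolding g_def using inv_into_into[of "t n" \<Phi> K] f_inv_into_f[of "t n" \<Phi> K] by auto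
    have "range (\<lambda>n. g (t n)) \<subseteq> K" using t by auto
    from sub[OF this] obtain r \<rho> where r: "strict_mono r" "\<rho> \<in> K" "limitin weak_topology ((\<lambda>n. g (t n)) \<circ> r) \<rho> sequentially" by blast
    show "\<exists>l\<in>\<Phi> ` K. \<exists>r. strict_mono r \<and> (t \<circ> r) \<longlonglongrightarrow> l"
      using lim[OF r(3)] r(1,2) by (auto simp: t o_def intro!: exI[of _ r])
  qed
  moreover have "homeomorphic_maps (subtopology weak_topology K) (top_of_set (\<Phi> ` K)) \<Phi> g"
    unfolding homeomorphic_maps_def
  proof (intro conjI ballI)
    show "continuous_map (subtopology weak_topology K) (top_of_set (\<Phi> ` K)) \<Phi>"
      by (auto simp: continuous_map_in_subtopology intro: continuous_map_from_subtopology cont)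
    show "continuous_map (top_of_set (\<Phi> ` K)) (subtopology weak_topology K) g"
    proof (rule continuous_map_sequentiallyI)
      show "metrizable_space (top_of_set (\<Phi> ` K))" by (intro metrizable_space_subtopology metrizable_space_euclidean)
      show "g \<in> topspace (top_of_set (\<Phi> ` K)) \<rightarrow> topspace (subtopology weak_topology K)"
        using g\<Phi> KP by (auto simp: topspace_weak_topology)
      fix \<sigma> z assume \<sigma>: "range \<sigma> \<subseteq> topspace (top_of_set (\<Phi> ` K))" "limitin (top_of_set (\<Phi> ` K)) \<sigma> z sequentially"
      have z: "z \<in> \<Phi> ` K" "\<sigma> \<longlonglongrightarrow> z" using \<sigma>(2) by (auto simp: limitin_subtopology)
      have "\<sigma> n \<in> \<Phi> ` K" for n using \<sigma>(1) by auto
      then have s: "g (\<sigma> n) \<in> K" "\<Phi> (g (\<sigma> n)) = \<sigma> n" for n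
        unfolding g_def using inv_into_into[of "\<sigma> n" \<Phi> K] f_inv_into_f[of "\<sigma> n" \<Phi> K] by auto
      have gz: "g z \<in> K" "\<Phi> (g z) = z" using z(1) g\<Phi> by auto
      have "limitin weak_topology (g \<circ> \<sigma>) (g z) sequentially"
      proof (rule limitin_subsubsequence)
        fix r :: "nat \<Rightarrow> nat" assume r: "strict_mono r"
        have "range (g \<circ> \<sigma> \<circ> r) \<subseteq> K" using s by auto
        from sub[OF this] obtain q \<rho> where q: "strict_mono q" "\<rho> \<in> K" "limitin weak_topology (g \<circ> \<sigma> \<circ> r \<circ> q) \<rho> sequentially" by blast
        have "(\<lambda>n. \<sigma> (r (q n))) \<longlonglongrightarrow> \<Phi> \<rho>" using lim[OF q(3)] by (simp add: s)
        moreover have "(\<lambda>n. \<sigma> (r (q n))) \<longlonglongrightarrow> z"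
          using LIMSEQ_subseq_LIMSEQ[OF z(2) strict_mono_o[OF r q(1)]] by (simp add: o_def)
        ultimately have "\<Phi> \<rho> = \<Phi> (g z)" using LIMSEQ_unique gz by metis
        then have "\<rho> = g z" using injK q(2) gz(1) by (auto dest: inj_onD)
        then show "\<exists>q. strict_mono q \<and> limitin weak_topology (g \<circ> \<sigma> \<circ> r \<circ> q) (g z) sequentially"
          using q by blast
      qed
      then show "limitin (subtopology weak_topology K) (g \<circ> \<sigma>) (g z) sequentially"
        using s gz by (simp add: limitin_subtopology)
    qed
  qed (use g\<Phi> in auto)
  ultimately show ?thesis using that homeomorphic_maps_imp_homeomorphic_space by blast
qed

lemma weak_seq_compact_topology:
  fixes K :: "'a::{metric_space, second_countable_topology} measure set"
  assumes K: "weak_seq_compact K"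
  shows "compact_space (subtopology weak_topology K)" "Hausdorff_space (subtopology weak_topology K)"
    "completely_metrizable_space (subtopology weak_topology K)"
    "second_countable (subtopology weak_topology K)"
proof -
  obtain D :: "(nat \<Rightarrow> real) set" where D: "compact D"
    "subtopology weak_topology K homeomorphic_space top_of_set D"
    using weak_seq_compact_homeomorphic[OF K] by blast
  show "compact_space (subtopology weak_topology K)"
    using homeomorphic_compact_space[OF D(2)] D(1) by (simp add: compact_space_subtopology)
  show "Hausdorff_space (subtopology weak_topology K)"
    using Hausdorff_space_subtopology Hausdorff_space_weak_topology by blast
  have "completely_metrizable_space (top_of_set D)"
    using D(1) completely_metrizable_space_closedin[OF completely_metrizable_space_euclidean] compact_imp_closed by auto
  then show "completely_metrizable_space (subtopology weak_topology K)"
    using homeomorphic_completely_metrizable_space[OF D(2)] by blast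
  have "second_countable (euclidean :: (nat \<Rightarrow> real) topology)"
  proof -
    obtain B :: "(nat \<Rightarrow> real) set set" where B: "countable B" "\<And>C. C \<in> B \<Longrightarrow> open C"
      "\<And>S. open S \<Longrightarrow> \<exists>U. U \<subseteq> B \<and> S = \<Union>U" by (rule univ_second_countable) blast
    have "\<exists>U\<in>B. x \<in> U \<and> U \<subseteq> S" if "open S" "x \<in> S" for S x using B(3)[OF that(1)] that(2) by blast
    then show ?thesis unfolding second_countable_def using B(1,2) by (intro exI[of _ B]) simp
  qed
  then show "second_countable (subtopology weak_topology K)"
    using homeomorphic_space_second_countability[OF D(2)] second_countable_subtopology by blast
qed

lemma tight_convergent_subsequence:
  fixes s :: "nat \<Rightarrow> 'a::polish_space measure"
  assumes M: "tight_measures M" "M \<subseteq> borel_probs" and s: "range s \<subseteq> M"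
  obtains r \<rho> where "strict_mono (r :: nat \<Rightarrow> nat)" "limitin weak_topology (s \<circ> r) \<rho> sequentially"
proof -
  have "1 / real (Suc m) > 0" for m by simp
  then have "\<exists>C. compact C \<and> (\<forall>\<mu>\<in>M. measure \<mu> (UNIV - C) \<le> 1 / real (Suc m))" for m
    using M(1) unfolding tight_measures_def by blast
  then obtain C where C: "\<And>m. compact (C m)" "\<And>m \<mu>. \<mu> \<in> M \<Longrightarrow> measure \<mu> (UNIV - C m) \<le> 1 / real (Suc m)" by metis
  have ge: "measure (s n) (C m) \<ge> 1 - 1 / real (Suc m)" for n m
  proof -
    have sP: "s n \<in> borel_probs" using s M by auto
    interpret prob_space "s n" using borel_probsD(3)[OF sP] .
    have "C m \<in> sets (s n)" using C(1) borel_probsD(1)[OF sP] borel_compact by auto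
    then show ?thesis using prob_compl[of "C m"] C(2)[of "s n" m] s borel_probsD(2)[OF sP]
      by (simp add: image_subset_iff)
  qed
  have z: "(\<lambda>n. 1 / real (Suc n)) \<longlonglongrightarrow> 0" using LIMSEQ_inverse_real_of_nat by (simp add: inverse_eq_divide)
  show ?thesis
    by (rule weak_convergent_subsequence[OF _ C(1) z ge]) (use s M that in auto)
qed

lemma tight_measures_sequential_closure:
  fixes M :: "'a::metric_space measure set"
  assumes M: "tight_measures M" "M \<subseteq> borel_probs"
  shows "tight_measures {\<rho>. \<exists>s. range s \<subseteq> M \<and> limitin weak_topology s \<rho> sequentially}"
  unfolding tight_measures_def
proof (intro allI impI)
  fix \<epsilon> :: real assume "\<epsilon> > 0"
  then have "\<exists>C. compact C \<and> (\<forall>\<mu>\<in>M. measure \<mu> (UNIV - C) \<le> \<epsilon>)"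
    using M(1) unfolding tight_measures_def by simp
  then obtain C where C: "compact C" "\<forall>\<mu>\<in>M. measure \<mu> (UNIV - C) \<le> \<epsilon>" by (elim exE conjE)
  have Ccl: "closed C" using C(1) compact_imp_closed by blast
  have compl: "measure \<mu> C = 1 - measure \<mu> (UNIV - C)" if "\<mu> \<in> borel_probs" for \<mu> :: "'a measure"
  proof -
    interpret prob_space \<mu> using borel_probsD(3)[OF that] .
    have "C \<in> sets \<mu>" using Ccl borel_probsD(1)[OF that] by auto
    then show ?thesis using prob_compl[of C] borel_probsD(2)[OF that] by auto
  qed
  have "measure \<rho> (UNIV - C) \<le> \<epsilon>"
    if s: "range s \<subseteq> M" and l: "limitin weak_topology s \<rho> sequentially" for s \<rho>
  proof -
    have \<rho>: "\<rho> \<in> borel_probs" and sP: "\<And>n. s n \<in> borel_probs"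
      using l s M(2) by (auto simp: limitin_weak_topology)
    have "measure \<rho> C \<ge> 1 - \<epsilon>"
    proof (rule measure_closed_ge_of_integrals[OF \<rho> sP _ Ccl])
      show "1 - \<epsilon> \<le> measure (s n) C" for n using C(2) s compl[OF sP, of n] by (force simp: image_subset_iff)
    qed (use l in \<open>auto simp: limitin_weak_topology\<close>)
    then show ?thesis using compl[OF \<rho>] by simp
  qed
  then show "\<exists>C. compact C \<and> (\<forall>\<mu>\<in>{\<rho>. \<exists>s. range s \<subseteq> M \<and> limitin weak_topology s \<rho> sequentially}. measure \<mu> (UNIV - C) \<le> \<epsilon>)"
    using C(1) by blast
qed

text \<open>A limit \<open>\<rho>\<close> of cluster points has to be a cluster point again.
  Closeness is measured after applying \<open>\<Phi>\<close>: increasing indices \<open>p i\<close>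
  make \<open>\<Phi> (s (p i))\<close> approach \<open>\<Phi> \<rho>\<close>; tightness provides a
  weak sublimit along \<open>p\<close>, and injectivity of \<open>\<Phi>\<close> identifies it with
  \<open>\<rho>\<close>.\<close>

lemma weak_seq_compact_cluster_points:
  fixes s :: "nat \<Rightarrow> 'a::polish_space measure"
  assumes s: "tight_measures (range s)" "range s \<subseteq> borel_probs"
  shows "weak_seq_compact (cluster_points weak_topology s)"
  unfolding weak_seq_compact_def
proof (intro conjI allI impI)
  let ?K = "cluster_points weak_topology s"
  show KP: "?K \<subseteq> borel_probs" unfolding cluster_points_def by (auto simp: limitin_weak_topology)
  let ?M = "{\<rho>. \<exists>t. range t \<subseteq> range s \<and> limitin weak_topology t \<rho> sequentially}"
  have tM: "tight_measures ?M" by (rule tight_measures_sequential_closure[OF s])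
  have MP: "?M \<subseteq> borel_probs" by (auto simp: limitin_weak_topology)
  have KM: "?K \<subseteq> ?M"
  proof
    fix \<rho> assume "\<rho> \<in> ?K"
    then obtain r where "limitin weak_topology (s \<circ> r) \<rho> sequentially" unfolding cluster_points_def by blast
    moreover have "range (s \<circ> r) \<subseteq> range s" by auto
    ultimately show "\<rho> \<in> ?M" by blast
  qed
  fix \<sigma> :: "nat \<Rightarrow> 'a measure" assume \<sigma>: "range \<sigma> \<subseteq> ?K"
  have "range \<sigma> \<subseteq> ?M" using \<sigma> KM by (rule order_trans)
  then obtain r \<rho> where r: "strict_mono (r :: nat \<Rightarrow> nat)" "limitin weak_topology (\<sigma> \<circ> r) \<rho> sequentially"
    by (rule tight_convergent_subsequence[OF tM MP])
  obtain \<Phi> :: "'a measure \<Rightarrow> nat \<Rightarrow> real" where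
    cont: "continuous_map weak_topology euclidean \<Phi>" and inj: "inj_on \<Phi> borel_probs"
    by (rule weak_topology_embedding)
  have lim: "(\<lambda>n. \<Phi> (\<sigma> n)) \<longlonglongrightarrow> \<Phi> \<rho>" if "limitin weak_topology \<sigma> \<rho> sequentially" for \<sigma> \<rho>
    using continuous_map_limit[OF cont that] by (simp add: o_def)
  have ex: "\<exists>n>m. dist (\<Phi> (s n)) (\<Phi> (\<sigma> i)) < 1 / real (Suc i)" for m i
  proof -
    have "\<sigma> i \<in> ?K" using \<sigma> by auto
    then obtain q where q: "strict_mono q" "limitin weak_topology (s \<circ> q) (\<sigma> i) sequentially"
      unfolding cluster_points_def by blast
    have "\<forall>\<^sub>F n in sequentially. dist (\<Phi> ((s \<circ> q) n)) (\<Phi> (\<sigma> i)) < 1 / real (Suc i)"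
      by (rule tendstoD[OF lim[OF q(2)]]) simp
    moreover have "\<forall>\<^sub>F n in sequentially. q n > m"
      by (rule eventually_compose_filterlim[OF eventually_gt_at_top filterlim_subseq[OF q(1)]])
    ultimately have "\<forall>\<^sub>F n in sequentially. dist (\<Phi> (s (q n))) (\<Phi> (\<sigma> i)) < 1 / real (Suc i) \<and> q n > m"
      by eventually_elim simp
    from eventually_happens'[OF sequentially_bot this] obtain n
      where "dist (\<Phi> (s (q n))) (\<Phi> (\<sigma> i)) < 1 / real (Suc i)" "q n > m" by blast
    then show ?thesis by (intro exI[of _ "q n"] conjI)
  qed
  have "\<exists>p. \<forall>i. dist (\<Phi> (s (p i))) (\<Phi> (\<sigma> (r i))) < 1 / real (Suc (r i)) \<and> p i < p (Suc i)"
  proof (rule dependent_nat_choice)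
    show "\<exists>n. dist (\<Phi> (s n)) (\<Phi> (\<sigma> (r 0))) < 1 / real (Suc (r 0))" using ex[of 0 "r 0"] by (elim exE conjE) (rule exI)
    show "\<exists>n. dist (\<Phi> (s n)) (\<Phi> (\<sigma> (r (Suc i)))) < 1 / real (Suc (r (Suc i))) \<and> m < n" for m i
      using ex[of m "r (Suc i)"] by (elim exE conjE) (intro exI conjI)
  qed
  then obtain p where p: "\<And>i. dist (\<Phi> (s (p i))) (\<Phi> (\<sigma> (r i))) < 1 / real (Suc (r i))" "strict_mono p"
    by (auto simp: strict_mono_Suc_iff)
  have "range (s \<circ> p) \<subseteq> range s" by auto
  then obtain q \<rho>' where q: "strict_mono (q :: nat \<Rightarrow> nat)" "limitin weak_topology (s \<circ> p \<circ> q) \<rho>' sequentially"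
    by (rule tight_convergent_subsequence[OF s])
  have z: "(\<lambda>n. 1 / real (Suc n)) \<longlonglongrightarrow> 0" using LIMSEQ_inverse_real_of_nat by (simp add: inverse_eq_divide)
  have d0: "(\<lambda>i. dist (\<Phi> (s (p i))) (\<Phi> (\<sigma> (r i)))) \<longlonglongrightarrow> 0"
  proof (rule tendsto_sandwich[OF _ _ tendsto_const])
    show "(\<lambda>i. 1 / real (Suc (r i))) \<longlonglongrightarrow> 0" using LIMSEQ_subseq_LIMSEQ[OF z r(1)] by (simp add: o_def)
  qed (use p(1) in \<open>auto intro!: always_eventually less_imp_le\<close>)
  have "(\<lambda>i. dist (\<Phi> (s (p i))) (\<Phi> \<rho>)) \<longlonglongrightarrow> 0"
  proof (rule tendsto_sandwich[OF _ _ tendsto_const])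
    show "(\<lambda>i. dist (\<Phi> (s (p i))) (\<Phi> (\<sigma> (r i))) + dist (\<Phi> (\<sigma> (r i))) (\<Phi> \<rho>)) \<longlonglongrightarrow> 0"
      using tendsto_add[OF d0, of "\<lambda>i. dist (\<Phi> (\<sigma> (r i))) (\<Phi> \<rho>)" 0] lim[OF r(2)]
      by (simp add: tendsto_dist_iff[symmetric])
    show "\<forall>\<^sub>F i in sequentially. dist (\<Phi> (s (p i))) (\<Phi> \<rho>)
        \<le> dist (\<Phi> (s (p i))) (\<Phi> (\<sigma> (r i))) + dist (\<Phi> (\<sigma> (r i))) (\<Phi> \<rho>)"
      by (auto intro!: always_eventually dist_triangle)
  qed auto
  then have "(\<lambda>i. \<Phi> (s (p i))) \<longlonglongrightarrow> \<Phi> \<rho>" by (simp add: tendsto_dist_iff[symmetric])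
  from LIMSEQ_subseq_LIMSEQ[OF this q(1)] have "(\<lambda>i. \<Phi> ((s \<circ> p \<circ> q) i)) \<longlonglongrightarrow> \<Phi> \<rho>" by (simp add: o_def)
  then have "\<Phi> \<rho> = \<Phi> \<rho>'" using lim[OF q(2)] LIMSEQ_unique by blast
  then have "\<rho> = \<rho>'" using inj r(2) q(2) by (auto simp: limitin_weak_topology dest: inj_onD)
  then have "\<rho> \<in> ?K" using q(2) strict_mono_o[OF p(2) q(1)] unfolding cluster_points_def
    by (intro CollectI exI[of _ "p \<circ> q"]) (simp add: o_assoc)
  then show "\<exists>r \<rho>. strict_mono r \<and> \<rho> \<in> ?K \<and> limitin weak_topology (\<sigma> \<circ> r) \<rho> sequentially"
    using r by blast
qed

section \<open>Integration against product measures\<close>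

lemma bounded_continuous_compose:
  assumes "bounded_continuous f" "continuous_on UNIV g"
  shows "bounded_continuous (\<lambda>x. f (g x))"
  using continuous_on_compose2[of UNIV f UNIV g] assms bounded_subset[of "range f" "range (\<lambda>x. f (g x))"] by auto

lemma sets_pair_borel:
  fixes \<alpha> :: "'a::second_countable_topology measure" and \<beta> :: "'b::second_countable_topology measure"
  assumes "sets \<alpha> = sets borel" "sets \<beta> = sets borel"
  shows "sets (\<alpha> \<Otimes>\<^sub>M \<beta>) = sets borel"
  unfolding borel_prod[symmetric] by (rule sets_pair_measure_cong[OF assms])

lemma borel_probs_pair:
  fixes \<alpha> :: "'a::second_countable_topology measure" and \<beta> :: "'b::second_countable_topology measure"
  assumes "\<alpha> \<in> borel_probs" "\<beta> \<in> borel_probs"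
  shows "\<alpha> \<Otimes>\<^sub>M \<beta> \<in> borel_probs"
proof -
  interpret A: prob_space \<alpha> using borel_probsD[OF assms(1)] by simp
  interpret B: prob_space \<beta> using borel_probsD[OF assms(2)] by simp
  interpret pair_prob_space \<alpha> \<beta> ..
  show ?thesis
    using sets_pair_borel[of \<alpha> \<beta>] borel_probsD[OF assms(1)] borel_probsD[OF assms(2)] prob_space_axioms
    by (simp add: borel_probs_def)
qed

lemma pair_integrals:
  fixes \<alpha> :: "'a::second_countable_topology measure" and \<beta> :: "'b::second_countable_topology measure"
    and h :: "'a \<times> 'b \<Rightarrow> real"
  assumes P: "\<alpha> \<in> borel_probs" "\<beta> \<in> borel_probs" and h: "h \<in> borel_measurable borel" "bounded (range h)"
  shows integral_pair_fst: "(\<integral>z. h z \<partial>(\<alpha> \<Otimes>\<^sub>M \<beta>)) = (\<integral>x. (\<integral>y. h (x, y) \<partial>\<beta>) \<partial>\<alpha>)"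
    and integral_pair_snd: "(\<integral>z. h z \<partial>(\<alpha> \<Otimes>\<^sub>M \<beta>)) = (\<integral>y. (\<integral>x. h (x, y) \<partial>\<alpha>) \<partial>\<beta>)"
proof -
  interpret A: prob_space \<alpha> using borel_probsD[OF P(1)] by simp
  interpret B: prob_space \<beta> using borel_probsD[OF P(2)] by simp
  interpret pair_prob_space \<alpha> \<beta> ..
  have i: "integrable (\<alpha> \<Otimes>\<^sub>M \<beta>) (case_prod (\<lambda>x y. h (x, y)))"
    using integrable_borel_probs[OF borel_probs_pair[OF P] h] by simp
  show "(\<integral>z. h z \<partial>(\<alpha> \<Otimes>\<^sub>M \<beta>)) = (\<integral>x. (\<integral>y. h (x, y) \<partial>\<beta>) \<partial>\<alpha>)"
    using integral_fst[OF i] by simp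
  show "(\<integral>z. h z \<partial>(\<alpha> \<Otimes>\<^sub>M \<beta>)) = (\<integral>y. (\<integral>x. h (x, y) \<partial>\<alpha>) \<partial>\<beta>)"
    using integral_snd[OF i] by simp
qed

lemma bounded_continuous_integral:
  fixes h :: "'a::metric_space \<times> 'b::topological_space \<Rightarrow> real"
  assumes \<beta>: "\<beta> \<in> borel_probs" and h: "bounded_continuous h"
  shows "bounded_continuous (\<lambda>x. \<integral>y. h (x, y) \<partial>\<beta>)"
proof -
  interpret B: prob_space \<beta> using borel_probsD[OF \<beta>] by simp
  obtain B where B: "\<And>z. \<bar>h z\<bar> \<le> B" using h by (auto simp: bounded_iff)
  have hx: "continuous_on UNIV (\<lambda>y. h (x, y))" for x
    using bounded_continuous_compose[OF h, of "\<lambda>y. (x, y)"] by (simp add: continuous_intros)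
  have hy: "continuous_on UNIV (\<lambda>x. h (x, y))" for y
    using bounded_continuous_compose[OF h, of "\<lambda>x. (x, y)"] by (simp add: continuous_intros)
  have "continuous_on UNIV (\<lambda>x. \<integral>y. h (x, y) \<partial>\<beta>)"
    unfolding continuous_on_sequentially
  proof (intro allI ballI impI, elim conjE)
    fix x and a :: 'a assume "x \<longlonglongrightarrow> a"
    then have "(\<lambda>n. h (x n, y)) \<longlonglongrightarrow> h (a, y)" for y
      using hy[of y] by (auto simp: continuous_on_sequentially o_def)
    then have "(\<lambda>n. \<integral>y. h (x n, y) \<partial>\<beta>) \<longlonglongrightarrow> (\<integral>y. h (a, y) \<partial>\<beta>)"
      using B hx by (intro integral_dominated_convergence[where w="\<lambda>_. B"])
        (auto simp: measurable_borel_probs[OF \<beta>] intro!: borel_measurable_continuous_onI)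
    then show "((\<lambda>x. \<integral>y. h (x, y) \<partial>\<beta>) \<circ> x) \<longlonglongrightarrow> (\<integral>y. h (a, y) \<partial>\<beta>)" by (simp add: o_def)
  qed
  moreover have "bounded (range (\<lambda>x. \<integral>y. h (x, y) \<partial>\<beta>))"
    by (intro boundedI[of _ B]) (auto intro!: abs_integral_le_borel_probs[OF \<beta>] B borel_measurable_continuous_onI hx)
  ultimately show ?thesis ..
qed

section \<open>Supports\<close>

lemma closed_supp: "closed (supp \<mu>)"
  unfolding closed_def open_subopen[of "- supp \<mu>"]
  by (auto simp: supp_def not_less)

lemma supp_positive: "x \<in> supp \<mu> \<Longrightarrow> open U \<Longrightarrow> x \<in> U \<Longrightarrow> emeasure \<mu> U > 0"
  by (auto simp: supp_def)

lemma emeasure_supp: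
  fixes \<mu> :: "'a::second_countable_topology measure"
  assumes \<mu>: "\<mu> \<in> borel_probs"
  shows "emeasure \<mu> (supp \<mu>) = 1"
proof -
  interpret prob_space \<mu> using borel_probsD[OF \<mu>] by simp
  obtain B :: "'a set set" where B: "countable B" "topological_basis B"
    using ex_countable_basis by blast
  have "\<exists>U\<in>B. x \<in> U \<and> emeasure \<mu> U = 0" if x: "x \<in> - supp \<mu>" for x
  proof -
    obtain V where "open V" "x \<in> V" "emeasure \<mu> V = 0" using x by (auto simp: supp_def not_less)
    moreover from this obtain U where "U \<in> B" "x \<in> U" "U \<subseteq> V" using topological_basisE[OF B(2)] by blast
    moreover have "emeasure \<mu> U \<le> emeasure \<mu> V"
      using \<open>open V\<close> \<open>U \<subseteq> V\<close> borel_probsD(1)[OF \<mu>] by (intro emeasure_mono) auto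
    ultimately show ?thesis by auto
  qed
  then have sub: "- supp \<mu> \<subseteq> (\<Union>U\<in>{U \<in> B. emeasure \<mu> U = 0}. U)" by blast
  have Bm: "U \<in> sets \<mu>" if "U \<in> B" for U
    using that topological_basis_open[OF B(2)] borel_probsD(1)[OF \<mu>] by auto
  have "(\<Union>U\<in>{U \<in> B. emeasure \<mu> U = 0}. U) \<in> null_sets \<mu>"
    by (rule null_sets_UN') (use B Bm in auto)
  then have "- supp \<mu> \<in> null_sets \<mu>"
    by (rule null_sets_subset[OF _ _ sub]) (use closed_supp[of \<mu>] borel_probsD(1)[OF \<mu>] in auto)
  then have "AE x in \<mu>. x \<in> supp \<mu>" by (rule AE_I') auto
  then show ?thesis using closed_supp[of \<mu>] borel_probsD(1)[OF \<mu>]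
    by (subst emeasure_eq_1_AE) auto
qed

lemma AE_supp:
  fixes \<mu> :: "'a::second_countable_topology measure"
  assumes \<mu>: "\<mu> \<in> borel_probs"
  shows "AE x in \<mu>. x \<in> supp \<mu>"
  using emeasure_supp[OF \<mu>] prob_space.AE_in_set_eq_1[OF borel_probsD(3)[OF \<mu>], of "supp \<mu>"] closed_supp[of \<mu>] borel_probsD(1)[OF \<mu>]
  by (simp add: measure_def)

lemma supp_subset_closed:
  assumes \<mu>: "\<mu> \<in> borel_probs" and A: "closed A" "AE x in \<mu>. x \<in> A"
  shows "supp \<mu> \<subseteq> A"
proof
  fix x assume x: "x \<in> supp \<mu>"
  show "x \<in> A"
  proof (rule ccontr)
    assume "x \<notin> A"
    then have "emeasure \<mu> (- A) > 0" using x A by (intro supp_positive) auto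
    moreover have "emeasure \<mu> (- A) = emeasure \<mu> {}"
      by (rule emeasure_eq_AE) (use A borel_probsD(1)[OF \<mu>] in auto)
    ultimately show False by simp
  qed
qed

lemma AE_emeasure_pos:
  assumes "emeasure \<mu> A > 0" "A \<in> sets \<mu>" "AE x in \<mu>. Q x"
  shows "\<exists>x\<in>A. Q x"
proof (rule ccontr)
  assume "\<not> (\<exists>x\<in>A. Q x)"
  with assms have "AE x in \<mu>. x \<in> A \<longleftrightarrow> x \<in> {}" by (auto elim!: eventually_mono)
  then have "emeasure \<mu> A = emeasure \<mu> {}" using assms by (intro emeasure_eq_AE) auto
  with assms show False by simp
qed

lemma supp_nonempty:
  fixes \<mu> :: "'a::second_countable_topology measure"
  assumes "\<mu> \<in> borel_probs"
  shows "supp \<mu> \<noteq> {}"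
  using emeasure_supp[OF assms] by auto

text \<open>Turns an identity valid almost everywhere into one valid at every point of the support,
  because the set of agreement is closed.\<close>

lemma continuous_eq_on_supp:
  fixes f g :: "'a::topological_space \<Rightarrow> 'b::t2_space"
  assumes "\<mu> \<in> borel_probs" "continuous_on UNIV f" "continuous_on UNIV g" "AE x in \<mu>. f x = g x" "x \<in> supp \<mu>"
  shows "f x = g x"
proof -
  have "supp \<mu> \<subseteq> {x. f x = g x}"
    using assms by (intro supp_subset_closed closed_Collect_eq) auto
  then show ?thesis using assms(5) by blast
qed

lemma supp_return: "supp (return borel x) = {x :: 'a::t1_space}"
proof
  show "supp (return borel x) \<subseteq> {x}"
    by (rule supp_subset_closed) (auto simp: prob_space_return_borel AE_return)
  show "{x} \<subseteq> supp (return borel x)" by (auto simp: supp_def)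
qed

section \<open>Convolution\<close>

lemma continuous_mult_pair:
  "continuous_on UNIV (\<lambda>(x, y). x * y :: 'a::{first_countable_topology, topological_semigroup_mult})"
  unfolding case_prod_beta by (intro continuous_intros)

lemma measurable_mult_pair:
  fixes \<alpha> \<beta> :: "'a::{polish_space, topological_semigroup_mult} measure"
  assumes "\<alpha> \<in> borel_probs" "\<beta> \<in> borel_probs"
  shows "(\<lambda>(x, y). x * y) \<in> measurable (\<alpha> \<Otimes>\<^sub>M \<beta>) borel"
  unfolding measurable_borel_probs[OF borel_probs_pair[OF assms]]
  by (rule borel_measurable_continuous_onI[OF continuous_mult_pair])

lemma conv_borel_probs:
  fixes \<alpha> \<beta> :: "'a::{polish_space, topological_semigroup_mult} measure"
  assumes "\<alpha> \<in> borel_probs" "\<beta> \<in> borel_probs"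
  shows "\<alpha> \<^bold>* \<beta> \<in> borel_probs"
  unfolding conv_def
  by (intro borel_probs_distr measurable_mult_pair assms borel_probsD(3) borel_probs_pair)

lemma bounded_borel_mult_pair:
  fixes f :: "'a::{polish_space, topological_semigroup_mult} \<Rightarrow> real"
  assumes "f \<in> borel_measurable borel" "bounded (range f)"
  shows "(\<lambda>z. f (fst z * snd z)) \<in> borel_measurable borel" "bounded (range (\<lambda>z. f (fst z * snd z)))"
proof -
  have "(\<lambda>z :: 'a \<times> 'a. fst z * snd z) \<in> borel_measurable borel"
    by (intro borel_measurable_continuous_onI continuous_intros)
  then show "(\<lambda>z. f (fst z * snd z)) \<in> borel_measurable borel" using assms(1) by measurable
  show "bounded (range (\<lambda>z. f (fst z * snd z)))" by (rule bounded_subset[OF assms(2)]) auto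
qed

lemma integral_conv:
  fixes f :: "'a::{polish_space, topological_semigroup_mult} \<Rightarrow> real"
  assumes P: "\<alpha> \<in> borel_probs" "\<beta> \<in> borel_probs" and f: "f \<in> borel_measurable borel" "bounded (range f)"
  shows "(\<integral>x. f x \<partial>(\<alpha> \<^bold>* \<beta>)) = (\<integral>x. (\<integral>y. f (x * y) \<partial>\<beta>) \<partial>\<alpha>)"
    and "(\<integral>x. f x \<partial>(\<alpha> \<^bold>* \<beta>)) = (\<integral>y. (\<integral>x. f (x * y) \<partial>\<alpha>) \<partial>\<beta>)"
proof -
  have "(\<integral>x. f x \<partial>(\<alpha> \<^bold>* \<beta>)) = (\<integral>z. f (fst z * snd z) \<partial>(\<alpha> \<Otimes>\<^sub>M \<beta>))"
    unfolding conv_def using integral_distr[OF measurable_mult_pair[OF P] f(1)] by (simp add: case_prod_beta)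
  then show "(\<integral>x. f x \<partial>(\<alpha> \<^bold>* \<beta>)) = (\<integral>x. (\<integral>y. f (x * y) \<partial>\<beta>) \<partial>\<alpha>)"
    "(\<integral>x. f x \<partial>(\<alpha> \<^bold>* \<beta>)) = (\<integral>y. (\<integral>x. f (x * y) \<partial>\<alpha>) \<partial>\<beta>)"
    using pair_integrals[OF P bounded_borel_mult_pair[OF f]] by simp_all
qed

lemma bounded_continuous_mult_pair:
  fixes f :: "'a::{polish_space, topological_semigroup_mult} \<Rightarrow> real"
  assumes "bounded_continuous f"
  shows "bounded_continuous (\<lambda>z. f (fst z * snd z))"
  by (rule bounded_continuous_compose[OF assms]) (intro continuous_intros)

lemma bounded_continuous_integral_mult:
  fixes f :: "'a::{polish_space, topological_semigroup_mult} \<Rightarrow> real"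
  assumes "\<beta> \<in> borel_probs" "bounded_continuous f"
  shows "bounded_continuous (\<lambda>x. \<integral>y. f (x * y) \<partial>\<beta>)" "bounded_continuous (\<lambda>y. \<integral>x. f (x * y) \<partial>\<beta>)"
proof -
  show "bounded_continuous (\<lambda>x. \<integral>y. f (x * y) \<partial>\<beta>)"
    using bounded_continuous_integral[OF assms(1) bounded_continuous_mult_pair[OF assms(2)]] by simp
  have "bounded_continuous (\<lambda>z. f (snd z * fst z))"
    by (rule bounded_continuous_compose[OF assms(2)]) (intro continuous_intros)
  then show "bounded_continuous (\<lambda>y. \<integral>x. f (x * y) \<partial>\<beta>)"
    using bounded_continuous_integral[OF assms(1), of "\<lambda>z. f (snd z * fst z)"] by simp
qed

lemma integral_conv_bounded_continuous:
  fixes f :: "'a::{polish_space, topological_semigroup_mult} \<Rightarrow> real"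
  assumes "\<alpha> \<in> borel_probs" "\<beta> \<in> borel_probs" "bounded_continuous f"
  shows "(\<integral>x. f x \<partial>(\<alpha> \<^bold>* \<beta>)) = (\<integral>x. (\<integral>y. f (x * y) \<partial>\<beta>) \<partial>\<alpha>)"
    and "(\<integral>x. f x \<partial>(\<alpha> \<^bold>* \<beta>)) = (\<integral>y. (\<integral>x. f (x * y) \<partial>\<alpha>) \<partial>\<beta>)"
  using integral_conv[OF assms(1,2) borel_measurable_continuous_onI] assms(3) by auto

lemma conv_assoc:
  fixes \<alpha> \<beta> \<gamma> :: "'a::{polish_space, topological_semigroup_mult} measure"
  assumes P: "\<alpha> \<in> borel_probs" "\<beta> \<in> borel_probs" "\<gamma> \<in> borel_probs"
  shows "\<alpha> \<^bold>* \<beta> \<^bold>* \<gamma> = \<alpha> \<^bold>* (\<beta> \<^bold>* \<gamma>)"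
proof (rule borel_probs_eqI)
  fix f :: "'a \<Rightarrow> real" assume f: "bounded_continuous f"
  have fx: "bounded_continuous (\<lambda>w. f (x * w))" for x
    by (rule bounded_continuous_compose[OF f]) (intro continuous_intros)
  have "(\<integral>x. f x \<partial>(\<alpha> \<^bold>* \<beta> \<^bold>* \<gamma>)) = (\<integral>x. (\<integral>y. (\<integral>z. f (x * y * z) \<partial>\<gamma>) \<partial>\<beta>) \<partial>\<alpha>)"
    using bounded_continuous_integral_mult(1)[OF P(3) f]
    by (simp add: integral_conv_bounded_continuous(1) P f conv_borel_probs)
  also have "\<dots> = (\<integral>x. (\<integral>w. f (x * w) \<partial>(\<beta> \<^bold>* \<gamma>)) \<partial>\<alpha>)"
    by (simp only: integral_conv_bounded_continuous(1)[OF P(2,3) fx] mult.assoc)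
  also have "\<dots> = (\<integral>x. f x \<partial>(\<alpha> \<^bold>* (\<beta> \<^bold>* \<gamma>)))"
    by (simp add: integral_conv_bounded_continuous(1) P f conv_borel_probs)
  finally show "(\<integral>x. f x \<partial>(\<alpha> \<^bold>* \<beta> \<^bold>* \<gamma>)) = (\<integral>x. f x \<partial>(\<alpha> \<^bold>* (\<beta> \<^bold>* \<gamma>)))" .
qed (auto intro!: conv_borel_probs P)

lemma integral_conv_return:
  fixes f :: "'a::{polish_space, topological_semigroup_mult} \<Rightarrow> real"
  assumes "\<beta> \<in> borel_probs" "bounded_continuous f"
  shows "(\<integral>x. f x \<partial>(return borel a \<^bold>* \<beta>)) = (\<integral>y. f (a * y) \<partial>\<beta>)"
    and "(\<integral>x. f x \<partial>(\<beta> \<^bold>* return borel a)) = (\<integral>y. f (y * a) \<partial>\<beta>)"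
  using bounded_continuous_integral_mult[OF assms] assms(2)
  by (auto simp: integral_conv_bounded_continuous(1)[OF prob_space_return_borel assms]
      integral_conv_bounded_continuous(2)[OF assms(1) prob_space_return_borel assms(2)]
      integral_return borel_measurable_continuous_onI)

lemma conv_return_distr:
  fixes \<beta> :: "'a::{polish_space, topological_semigroup_mult} measure"
  assumes \<beta>: "\<beta> \<in> borel_probs"
  shows "return borel a \<^bold>* \<beta> = distr \<beta> borel ((*) a)" and "\<beta> \<^bold>* return borel a = distr \<beta> borel (\<lambda>x. x * a)"
proof -
  have m: "(*) a \<in> measurable \<beta> borel" "(\<lambda>x. x * a) \<in> measurable \<beta> borel"
    unfolding measurable_borel_probs[OF \<beta>] by (intro borel_measurable_continuous_onI continuous_intros)+
  show "return borel a \<^bold>* \<beta> = distr \<beta> borel ((*) a)"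
  proof (rule borel_probs_eqI)
    fix f :: "'a \<Rightarrow> real" assume f: "bounded_continuous f"
    then show "(\<integral>x. f x \<partial>(return borel a \<^bold>* \<beta>)) = (\<integral>x. f x \<partial>distr \<beta> borel ((*) a))"
      by (simp add: integral_conv_return \<beta> integral_distr[OF m(1)] borel_measurable_continuous_onI)
  qed (auto intro!: conv_borel_probs \<beta> prob_space_return_borel borel_probs_distr m borel_probsD(3))
  show "\<beta> \<^bold>* return borel a = distr \<beta> borel (\<lambda>x. x * a)"
  proof (rule borel_probs_eqI)
    fix f :: "'a \<Rightarrow> real" assume f: "bounded_continuous f"
    then show "(\<integral>x. f x \<partial>(\<beta> \<^bold>* return borel a)) = (\<integral>x. f x \<partial>distr \<beta> borel (\<lambda>x. x * a))"
      by (simp add: integral_conv_return \<beta> integral_distr[OF m(2)] borel_measurable_continuous_onI)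
  qed (auto intro!: conv_borel_probs \<beta> prob_space_return_borel borel_probs_distr m borel_probsD(3))
qed

lemma conv_return_return:
  "return borel (a :: 'a::{polish_space, topological_semigroup_mult}) \<^bold>* return borel b = return borel (a * b)"
  by (simp add: conv_return_distr prob_space_return_borel distr_return borel_measurable_continuous_onI continuous_intros)

lemma conv_cong_left:
  fixes \<alpha> \<beta> \<gamma> :: "'a::{polish_space, topological_semigroup_mult} measure"
  assumes P: "\<alpha> \<in> borel_probs" "\<beta> \<in> borel_probs" "\<gamma> \<in> borel_probs"
    and eq: "AE x in \<alpha>. return borel x \<^bold>* \<beta> = return borel x \<^bold>* \<gamma>"
  shows "\<alpha> \<^bold>* \<beta> = \<alpha> \<^bold>* \<gamma>"
proof (rule borel_probs_eqI)
  fix f :: "'a \<Rightarrow> real" assume f: "bounded_continuous f"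
  have "(\<integral>x. (\<integral>y. f (x * y) \<partial>\<beta>) \<partial>\<alpha>) = (\<integral>x. (\<integral>y. f (x * y) \<partial>\<gamma>) \<partial>\<alpha>)"
  proof (rule integral_cong_AE)
    show "AE x in \<alpha>. (\<integral>y. f (x * y) \<partial>\<beta>) = (\<integral>y. f (x * y) \<partial>\<gamma>)"
      using eq by eventually_elim (simp add: integral_conv_return(1)[symmetric] P f)
  qed (use bounded_continuous_integral_mult[OF _ f] P in \<open>auto simp: measurable_borel_probs intro!: borel_measurable_continuous_onI\<close>)
  then show "(\<integral>x. f x \<partial>(\<alpha> \<^bold>* \<beta>)) = (\<integral>x. f x \<partial>(\<alpha> \<^bold>* \<gamma>))"
    by (simp add: integral_conv_bounded_continuous(1) P f)
qed (auto intro!: conv_borel_probs P)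

lemma emeasure_conv_ge:
  fixes \<alpha> \<beta> :: "'a::{polish_space, topological_semigroup_mult} measure"
  assumes P: "\<alpha> \<in> borel_probs" "\<beta> \<in> borel_probs"
    and "V \<in> sets borel" "W \<in> sets borel" "A \<in> sets borel" "V * W \<subseteq> A"
  shows "emeasure \<alpha> V * emeasure \<beta> W \<le> emeasure (\<alpha> \<^bold>* \<beta>) A"
proof -
  interpret B: prob_space \<beta> using borel_probsD[OF P(2)] by simp
  note s = borel_probsD(1,2)[OF P(1)] borel_probsD(1,2)[OF P(2)]
  have "emeasure \<alpha> V * emeasure \<beta> W = emeasure (\<alpha> \<Otimes>\<^sub>M \<beta>) (V \<times> W)"
    using assms s by (intro B.emeasure_pair_measure_Times[symmetric]) auto
  also have "\<dots> \<le> emeasure (\<alpha> \<Otimes>\<^sub>M \<beta>) ((\<lambda>(x, y). x * y) -` A \<inter> space (\<alpha> \<Otimes>\<^sub>M \<beta>))"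
  proof (rule emeasure_mono)
    show "V \<times> W \<subseteq> (\<lambda>(x, y). x * y) -` A \<inter> space (\<alpha> \<Otimes>\<^sub>M \<beta>)"
      using assms s by (auto simp: space_pair_measure intro: set_times_intro)
  qed (rule measurable_sets[OF measurable_mult_pair[OF P] assms(5)])
  also have "\<dots> = emeasure (\<alpha> \<^bold>* \<beta>) A"
    unfolding conv_def by (rule emeasure_distr[symmetric, OF measurable_mult_pair[OF P] assms(5)])
  finally show ?thesis .
qed

lemma AE_conv_closed:
  fixes \<alpha> \<beta> :: "'a::{polish_space, topological_semigroup_mult} measure"
  assumes P: "\<alpha> \<in> borel_probs" "\<beta> \<in> borel_probs" and A: "closed A" "supp \<alpha> * supp \<beta> \<subseteq> A"
  shows "AE x in \<alpha> \<^bold>* \<beta>. x \<in> A"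
proof -
  interpret prob_space "\<alpha> \<^bold>* \<beta>" using borel_probsD[OF conv_borel_probs[OF P]] by simp
  have "1 \<le> emeasure (\<alpha> \<^bold>* \<beta>) A"
    using emeasure_conv_ge[OF P, of "supp \<alpha>" "supp \<beta>" A] A closed_supp[of \<alpha>] closed_supp[of \<beta>]
    by (simp add: emeasure_supp P)
  then have "emeasure (\<alpha> \<^bold>* \<beta>) A = 1" by (rule antisym[OF measure_le_1])
  then show ?thesis
    using A(1) borel_probsD(1)[OF conv_borel_probs[OF P]] AE_in_set_eq_1[of A] by (simp add: measure_def)
qed

lemma supp_conv:
  fixes \<alpha> \<beta> :: "'a::{polish_space, topological_semigroup_mult} measure"
  assumes P: "\<alpha> \<in> borel_probs" "\<beta> \<in> borel_probs"
  shows "supp (\<alpha> \<^bold>* \<beta>) = closure (supp \<alpha> * supp \<beta>)"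
proof
  show "supp (\<alpha> \<^bold>* \<beta>) \<subseteq> closure (supp \<alpha> * supp \<beta>)"
    by (intro supp_subset_closed conv_borel_probs P closed_closure AE_conv_closed closure_subset)
  have "x * y \<in> supp (\<alpha> \<^bold>* \<beta>)" if x: "x \<in> supp \<alpha>" and y: "y \<in> supp \<beta>" for x y
    unfolding supp_def
  proof (intro CollectI allI impI, elim conjE)
    fix U :: "'a set" assume U: "open U" "x * y \<in> U"
    have "open ((\<lambda>z :: 'a \<times> 'a. fst z * snd z) -` U)"
      by (intro open_vimage U continuous_intros)
    moreover have "(x, y) \<in> (\<lambda>z. fst z * snd z) -` U" using U by simp
    ultimately obtain V W where VW: "open V" "open W" "x \<in> V" "y \<in> W" "V \<times> W \<subseteq> (\<lambda>z. fst z * snd z) -` U"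
      unfolding open_prod_def by (smt (verit) mem_Sigma_iff)
    have "0 < emeasure \<alpha> V * emeasure \<beta> W"
      using supp_positive[OF x VW(1,3)] supp_positive[OF y VW(2,4)] by (simp add: ennreal_zero_less_mult_iff)
    also have "\<dots> \<le> emeasure (\<alpha> \<^bold>* \<beta>) U"
      using VW U by (intro emeasure_conv_ge P) (auto simp: set_times_def)
    finally show "0 < emeasure (\<alpha> \<^bold>* \<beta>) U" .
  qed
  then have "supp \<alpha> * supp \<beta> \<subseteq> supp (\<alpha> \<^bold>* \<beta>)" by (auto simp: set_times_def)
  then show "closure (supp \<alpha> * supp \<beta>) \<subseteq> supp (\<alpha> \<^bold>* \<beta>)" by (rule closure_minimal[OF _ closed_supp])
qed

lemma supp_mult:
  fixes \<alpha> \<beta> :: "'a::{polish_space, topological_semigroup_mult} measure"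
  assumes "\<alpha> \<in> borel_probs" "\<beta> \<in> borel_probs" "x \<in> supp \<alpha>" "y \<in> supp \<beta>"
  shows "x * y \<in> supp (\<alpha> \<^bold>* \<beta>)"
  unfolding supp_conv[OF assms(1,2)] by (rule subsetD[OF closure_subset]) (intro set_times_intro assms)

section \<open>Continuity of convolution\<close>

text \<open>Integrating over the fixed factor leaves a bounded continuous function of the other
  variable, to which weak convergence of the moving factor applies directly.\<close>

lemma limitin_conv_const:
  fixes s :: "'i \<Rightarrow> 'a::{polish_space, topological_semigroup_mult} measure"
  assumes "limitin weak_topology s \<alpha> F" "\<beta> \<in> borel_probs"
  shows "limitin weak_topology (\<lambda>n. s n \<^bold>* \<beta>) (\<alpha> \<^bold>* \<beta>) F" "limitin weak_topology (\<lambda>n. \<beta> \<^bold>* s n) (\<beta> \<^bold>* \<alpha>) F"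
proof -
  have \<alpha>: "\<alpha> \<in> borel_probs" and ev: "\<forall>\<^sub>F n in F. s n \<in> borel_probs"
    and lim: "\<And>f. bounded_continuous f \<Longrightarrow> ((\<lambda>n. \<integral>x. f x \<partial>s n) \<longlongrightarrow> (\<integral>x. f x \<partial>\<alpha>)) F"
    using assms(1) by (auto simp: limitin_weak_topology)
  show "limitin weak_topology (\<lambda>n. s n \<^bold>* \<beta>) (\<alpha> \<^bold>* \<beta>) F"
    unfolding limitin_weak_topology
  proof (intro conjI allI impI conv_borel_probs \<alpha> assms(2))
    show "\<forall>\<^sub>F n in F. s n \<^bold>* \<beta> \<in> borel_probs" using ev by eventually_elim (intro conv_borel_probs assms(2))
    fix f :: "'a \<Rightarrow> real" assume f: "bounded_continuous f"
    show "((\<lambda>n. \<integral>x. f x \<partial>(s n \<^bold>* \<beta>)) \<longlongrightarrow> (\<integral>x. f x \<partial>(\<alpha> \<^bold>* \<beta>))) F"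
      unfolding integral_conv_bounded_continuous(1)[OF \<alpha> assms(2) f]
      by (rule Lim_transform_eventually[OF lim[OF bounded_continuous_integral_mult(1)[OF assms(2) f]]])
        (use ev in eventually_elim, simp add: integral_conv_bounded_continuous(1)[OF _ assms(2) f])
  qed
  show "limitin weak_topology (\<lambda>n. \<beta> \<^bold>* s n) (\<beta> \<^bold>* \<alpha>) F"
    unfolding limitin_weak_topology
  proof (intro conjI allI impI conv_borel_probs \<alpha> assms(2))
    show "\<forall>\<^sub>F n in F. \<beta> \<^bold>* s n \<in> borel_probs" using ev by eventually_elim (intro conv_borel_probs assms(2))
    fix f :: "'a \<Rightarrow> real" assume f: "bounded_continuous f"
    show "((\<lambda>n. \<integral>x. f x \<partial>(\<beta> \<^bold>* s n)) \<longlongrightarrow> (\<integral>x. f x \<partial>(\<beta> \<^bold>* \<alpha>))) F"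
      unfolding integral_conv_bounded_continuous(2)[OF assms(2) \<alpha> f]
      by (rule Lim_transform_eventually[OF lim[OF bounded_continuous_integral_mult(2)[OF assms(2) f]]])
        (use ev in eventually_elim, simp add: integral_conv_bounded_continuous(2)[OF assms(2) _ f])
  qed
qed

lemma abs_integral_le_off_set:
  fixes g :: "'a::topological_space \<Rightarrow> real"
  assumes \<rho>: "\<rho> \<in> borel_probs" and C: "C \<in> sets borel" "measure \<rho> (UNIV - C) \<le> \<delta>"
    and g: "g \<in> borel_measurable borel" "\<And>x. \<bar>g x\<bar> \<le> b" "\<And>x. x \<in> C \<Longrightarrow> \<bar>g x\<bar> \<le> c" and c: "0 \<le> c"
  shows "\<bar>\<integral>x. g x \<partial>\<rho>\<bar> \<le> c + b * \<delta>"
proof -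
  interpret prob_space \<rho> using borel_probsD[OF \<rho>] by simp
  have b: "b \<ge> 0" using g(2)[of undefined] by linarith
  have ig: "integrable \<rho> g"
    by (rule integrable_borel_probs[OF \<rho> g(1)]) (use g(2) in \<open>auto intro!: boundedI[of _ b]\<close>)
  have ii: "integrable \<rho> (\<lambda>x. b * indicator (UNIV - C) x)"
  proof (rule integrable_borel_probs[OF \<rho>])
    show "(\<lambda>x. b * indicator (UNIV - C) x) \<in> borel_measurable borel" using C(1) by measurable
    show "bounded (range (\<lambda>x. b * indicator (UNIV - C) x))"
      using b by (intro boundedI[of _ b]) (auto simp: indicator_def)
  qed
  have "\<bar>\<integral>x. g x \<partial>\<rho>\<bar> \<le> (\<integral>x. \<bar>g x\<bar> \<partial>\<rho>)" by (rule integral_abs_bound)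
  also have "\<dots> \<le> (\<integral>x. c + b * indicator (UNIV - C) x \<partial>\<rho>)"
    using ig ii g c by (intro integral_mono) (auto simp: indicator_def intro: add_increasing)
  also have "\<dots> = c + (\<integral>x. b * indicator (UNIV - C) x \<partial>\<rho>)" using ii by (simp add: prob_space)
  also have "(\<integral>x. b * indicator (UNIV - C) x \<partial>\<rho>) = b * measure \<rho> (UNIV - C)"
    using C(1) borel_probsD(1,2)[OF \<rho>] by simp
  also have "c + b * measure \<rho> (UNIV - C) \<le> c + b * \<delta>" using C(2) b by (simp add: mult_left_mono)
  finally show ?thesis .
qed

text \<open>The function \<open>F (t n)\<close> integrated against \<open>s n\<close> itself moves
  with \<open>n\<close>. Tightness confines both variables to a compact set, up to small mass, where
  \<open>f (x * y)\<close> is uniformly continuous; so the functions \<open>F \<rho>\<close> with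
  \<open>\<rho> \<in> M\<close> are equicontinuous there up to a small error, and pointwise
  convergence on a finite net becomes uniform.\<close>

theorem limitin_conv:
  fixes s t :: "nat \<Rightarrow> 'a::{polish_space, topological_semigroup_mult} measure"
  assumes M: "tight_measures M" "M \<subseteq> borel_probs" "range s \<subseteq> M" "range t \<subseteq> M" "\<beta> \<in> M"
    and s: "limitin weak_topology s \<alpha> sequentially" and t: "limitin weak_topology t \<beta> sequentially"
  shows "limitin weak_topology (\<lambda>n. s n \<^bold>* t n) (\<alpha> \<^bold>* \<beta>) sequentially"
proof -
  have sP: "s n \<in> borel_probs" and tP: "t n \<in> borel_probs" for n
    using M(2) subsetD[OF M(3) rangeI] subsetD[OF M(4) rangeI] by blast+
  have \<alpha>: "\<alpha> \<in> borel_probs" and \<beta>: "\<beta> \<in> borel_probs" using M s by (auto simp: limitin_weak_topology)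
  have lim: "(\<lambda>n. \<integral>x. f x \<partial>(s n \<^bold>* t n)) \<longlonglongrightarrow> (\<integral>x. f x \<partial>(\<alpha> \<^bold>* \<beta>))" if f: "bounded_continuous f" for f
  proof -
    obtain B where B: "\<And>x. \<bar>f x\<bar> \<le> B" using f by (auto simp: bounded_iff)
    have B0: "B \<ge> 0" using B[of undefined] by linarith
    define F where "F \<rho> x = (\<integral>y. f (x * y) \<partial>\<rho>)" for \<rho> x
    have fx: "bounded_continuous (\<lambda>y. f (x * y))" for x
      by (rule bounded_continuous_compose[OF f]) (intro continuous_intros)
    have Fb: "bounded_continuous (F \<rho>)" if "\<rho> \<in> borel_probs" for \<rho>
      using bounded_continuous_integral_mult(1)[OF that f] by (simp add: F_def[abs_def])
    have FB: "\<bar>F \<rho> x\<bar> \<le> B" if "\<rho> \<in> borel_probs" for \<rho> x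
      unfolding F_def using fx[of x] B by (intro abs_integral_le_borel_probs[OF that]) (auto intro: borel_measurable_continuous_onI)
    have lF: "(\<lambda>n. F (t n) x) \<longlonglongrightarrow> F \<beta> x" for x
      using t fx by (auto simp: limitin_weak_topology F_def)
    have diff: "(\<lambda>n. (\<integral>x. F (t n) x - F \<beta> x \<partial>s n)) \<longlonglongrightarrow> 0"
    proof (rule LIMSEQ_I)
      fix \<epsilon> :: real assume \<epsilon>: "\<epsilon> > 0"
      \<comment> \<open>The errors add up to \<open>(3 + 6 * B) * \<delta>\<close>: the two moves to
        the net cost \<open>\<delta> + 2 * B * \<delta>\<close> each, the net point costs
        \<open>\<delta>\<close>, and the mass of \<open>s n\<close> off \<open>C\<close> costs
        \<open>2 * B * \<delta>\<close>. The factor 2 makes the total strictly less than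
        \<open>\<epsilon>\<close>.\<close>
      define \<delta> where "\<delta> = \<epsilon> / (2 * (3 + 6 * B))"
      have pos: "3 + 6 * B > 0" using B0 by simp
      have D: "D * (\<epsilon> / (2 * D)) = \<epsilon> / 2" if "D > 0" for D :: real using that by (simp add: field_simps)
      have \<delta>: "\<delta> > 0" "(3 + 6 * B) * \<delta> < \<epsilon>"
        unfolding \<delta>_def D[OF pos] using \<epsilon> pos by simp_all
      have "\<exists>C. compact C \<and> (\<forall>\<mu>\<in>M. measure \<mu> (UNIV - C) \<le> \<delta>)"
        using M(1) \<delta>(1) unfolding tight_measures_def by simp
      then obtain C where C: "compact C" "\<forall>\<mu>\<in>M. measure \<mu> (UNIV - C) \<le> \<delta>" by (elim exE conjE)
      have Cb: "C \<in> sets borel" using C(1) by (rule borel_compact)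
      have "continuous_on (C \<times> C) (\<lambda>z. f (fst z * snd z))"
        using bounded_continuous_mult_pair[OF f] continuous_on_subset by blast
      then have "uniformly_continuous_on (C \<times> C) (\<lambda>z. f (fst z * snd z))"
        by (rule compact_uniformly_continuous) (intro compact_Times C(1))
      then obtain r where r: "r > 0" "\<And>z z'. z \<in> C \<times> C \<Longrightarrow> z' \<in> C \<times> C \<Longrightarrow> dist z' z < r \<Longrightarrow>
          dist (f (fst z' * snd z')) (f (fst z * snd z)) < \<delta>"
        using \<delta>(1) unfolding uniformly_continuous_on_def by metis
      have rr: "\<bar>f (x * y) - f (x' * y)\<bar> \<le> \<delta>" if "x \<in> C" "x' \<in> C" "y \<in> C" "dist x x' < r" for x x' y
        using r(2)[of "(x', y)" "(x, y)"] that by (simp add: dist_Pair_Pair dist_real_def)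
      have near: "\<bar>F \<rho> x - F \<rho> x'\<bar> \<le> \<delta> + 2 * B * \<delta>" if \<rho>: "\<rho> \<in> M" and x: "x \<in> C" "x' \<in> C" "dist x x' < r" for \<rho> x x'
      proof -
        have \<rho>P: "\<rho> \<in> borel_probs" using \<rho> M by blast
        have "F \<rho> x - F \<rho> x' = (\<integral>y. f (x * y) - f (x' * y) \<partial>\<rho>)"
          unfolding F_def by (rule Bochner_Integration.integral_diff[symmetric]; rule integrable_bounded_continuous[OF \<rho>P fx])
        also have "\<bar>\<dots>\<bar> \<le> \<delta> + 2 * B * \<delta>"
        proof (rule abs_integral_le_off_set[OF \<rho>P Cb])
          show "measure \<rho> (UNIV - C) \<le> \<delta>" using C(2) \<rho> by simp
          show "(\<lambda>y. f (x * y) - f (x' * y)) \<in> borel_measurable borel"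
            using fx by (intro borel_measurable_diff borel_measurable_continuous_onI) auto
          show "\<bar>f (x * y) - f (x' * y)\<bar> \<le> 2 * B" for y using B[of "x * y"] B[of "x' * y"] by linarith
        qed (use rr x \<delta> in auto)
        finally show ?thesis .
      qed
      have "\<exists>k. finite k \<and> k \<subseteq> C \<and> C \<subseteq> (\<Union>x\<in>k. ball x r)"
        using seq_compact_imp_totally_bounded[OF compact_imp_seq_compact[OF C(1)]] r(1) by blast
      then obtain k where k: "finite k" "k \<subseteq> C" "C \<subseteq> (\<Union>x\<in>k. ball x r)" by blast
      have "\<forall>\<^sub>F n in sequentially. \<forall>x\<in>k. dist (F (t n) x) (F \<beta> x) < \<delta>"
        unfolding eventually_ball_finite_distrib[OF k(1)] using tendstoD[OF lF \<delta>(1)] by blast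
      then obtain N where N: "\<And>n x. n \<ge> N \<Longrightarrow> x \<in> k \<Longrightarrow> \<bar>F (t n) x - F \<beta> x\<bar> < \<delta>"
        unfolding eventually_sequentially dist_real_def by blast
      have "\<bar>\<integral>x. F (t n) x - F \<beta> x \<partial>s n\<bar> < \<epsilon>" if n: "n \<ge> N" for n
      proof -
        have tM: "t n \<in> M" "s n \<in> M" using subsetD[OF M(3) rangeI] subsetD[OF M(4) rangeI] by blast+
        have "\<bar>\<integral>x. F (t n) x - F \<beta> x \<partial>s n\<bar> \<le> (3 * \<delta> + 4 * B * \<delta>) + 2 * B * \<delta>"
        proof (rule abs_integral_le_off_set[OF sP Cb])
          show "measure (s n) (UNIV - C) \<le> \<delta>" using C(2) tM by simp
          show "(\<lambda>x. F (t n) x - F \<beta> x) \<in> borel_measurable borel"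
            using Fb[OF tP] Fb[OF \<beta>] by (intro borel_measurable_diff borel_measurable_continuous_onI) auto
          show "\<bar>F (t n) x - F \<beta> x\<bar> \<le> 2 * B" for x using FB[OF tP, of n x] FB[OF \<beta>, of x] by linarith
          show "0 \<le> 3 * \<delta> + 4 * B * \<delta>" using \<delta> B0 by simp
          fix x assume x: "x \<in> C"
          then obtain x' where x': "x' \<in> k" "dist x x' < r" using k(3) by (auto simp: dist_commute)
          then have "x' \<in> C" using k(2) by blast
          then show "\<bar>F (t n) x - F \<beta> x\<bar> \<le> 3 * \<delta> + 4 * B * \<delta>"
            using near[OF tM(1) x _ x'(2)] near[OF M(5) x _ x'(2)] N[OF n x'(1)] by linarith
        qed
        also have "\<dots> = (3 + 6 * B) * \<delta>" by (simp add: algebra_simps)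
        finally show ?thesis using \<delta>(2) by simp
      qed
      then show "\<exists>N. \<forall>n\<ge>N. norm ((\<integral>x. F (t n) x - F \<beta> x \<partial>s n) - 0) < \<epsilon>" by auto
    qed
    have "(\<lambda>n. \<integral>x. F \<beta> x \<partial>s n) \<longlonglongrightarrow> (\<integral>x. F \<beta> x \<partial>\<alpha>)"
      using s Fb[OF \<beta>] by (simp add: limitin_weak_topology)
    from tendsto_add[OF diff this]
    have "(\<lambda>n. (\<integral>x. F (t n) x - F \<beta> x \<partial>s n) + (\<integral>x. F \<beta> x \<partial>s n)) \<longlonglongrightarrow> (\<integral>x. F \<beta> x \<partial>\<alpha>)" by simp
    moreover have "(\<integral>x. F (t n) x - F \<beta> x \<partial>s n) + (\<integral>x. F \<beta> x \<partial>s n) = (\<integral>x. f x \<partial>(s n \<^bold>* t n))" for n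
      using Bochner_Integration.integral_diff[OF integrable_bounded_continuous[OF sP Fb[OF tP]] integrable_bounded_continuous[OF sP Fb[OF \<beta>]], of n n]
      by (simp add: integral_conv_bounded_continuous(1)[OF sP tP f] F_def[abs_def])
    moreover have "(\<integral>x. f x \<partial>(\<alpha> \<^bold>* \<beta>)) = (\<integral>x. F \<beta> x \<partial>\<alpha>)"
      by (simp add: integral_conv_bounded_continuous(1)[OF \<alpha> \<beta> f] F_def[abs_def])
    ultimately show ?thesis by simp
  qed
  show ?thesis
    unfolding limitin_weak_topology using lim sP tP \<alpha> \<beta> by (auto intro!: conv_borel_probs always_eventually)
qed

section \<open>Translation by points of the support\<close>

lemma supp_pair:
  fixes \<alpha> :: "'a::second_countable_topology measure" and \<beta> :: "'b::second_countable_topology measure"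
  assumes P: "\<alpha> \<in> borel_probs" "\<beta> \<in> borel_probs" and xy: "x \<in> supp \<alpha>" "y \<in> supp \<beta>"
  shows "(x, y) \<in> supp (\<alpha> \<Otimes>\<^sub>M \<beta>)"
  unfolding supp_def
proof (intro CollectI allI impI, elim conjE)
  fix U :: "('a \<times> 'b) set" assume U: "open U" "(x, y) \<in> U"
  obtain V W where "open V" "open W" "(x, y) \<in> V \<times> W" "V \<times> W \<subseteq> U"
    by (rule open_prod_elim[OF U])
  then have VW: "open V" "open W" "x \<in> V" "y \<in> W" "V \<times> W \<subseteq> U" by auto
  interpret B: prob_space \<beta> using borel_probsD[OF P(2)] by simp
  note s = borel_probsD(1)[OF P(1)] borel_probsD(1)[OF P(2)]
  have "0 < emeasure \<alpha> V * emeasure \<beta> W"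
    using supp_positive[OF xy(1) VW(1,3)] supp_positive[OF xy(2) VW(2,4)] by (simp add: ennreal_zero_less_mult_iff)
  also have "\<dots> = emeasure (\<alpha> \<Otimes>\<^sub>M \<beta>) (V \<times> W)"
    using VW s by (intro B.emeasure_pair_measure_Times[symmetric]) auto
  also have "\<dots> \<le> emeasure (\<alpha> \<Otimes>\<^sub>M \<beta>) U"
    using VW(5) U(1) borel_probsD(1)[OF borel_probs_pair[OF P]] by (intro emeasure_mono) auto
  finally show "0 < emeasure (\<alpha> \<Otimes>\<^sub>M \<beta>) U" .
qed

text \<open>For a measure invariant under convolution with itself, the function
  \<open>g x = \<integral>z. f (p x z) \<partial>\<eta>\<close> satisfies \<open>\<integral>y. g (p x y) \<partial>\<eta> = g x\<close>, so the quadratic expression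
  \<open>\<integral>x. \<integral>y. (g (p x y) - g x)\<^sup>2 \<partial>\<eta> \<partial>\<eta>\<close> vanishes. The operation is a parameter so that the
  opposite multiplication is covered as well.\<close>

lemma idempotent_integral_translation:
  fixes \<eta> :: "'a::polish_space measure" and p :: "'a \<Rightarrow> 'a \<Rightarrow> 'a"
  assumes \<eta>: "\<eta> \<in> borel_probs" and cont: "continuous_on UNIV (\<lambda>z. p (fst z) (snd z))"
    and assoc: "\<And>x y z. p (p x y) z = p x (p y z)"
    and idem: "\<And>f. bounded_continuous f \<Longrightarrow> (\<integral>x. (\<integral>y. f (p x y) \<partial>\<eta>) \<partial>\<eta>) = (\<integral>x. f x \<partial>\<eta>)"
    and f: "bounded_continuous f" and xy: "x \<in> supp \<eta>" "y \<in> supp \<eta>"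
  shows "(\<integral>z. f (p (p x y) z) \<partial>\<eta>) = (\<integral>z. f (p x z) \<partial>\<eta>)"
proof -
  interpret prob_space \<eta> using borel_probsD[OF \<eta>] by simp
  let ?\<pi> = "\<eta> \<Otimes>\<^sub>M \<eta>"
  have \<pi>: "?\<pi> \<in> borel_probs" by (rule borel_probs_pair[OF \<eta> \<eta>])
  define g where "g x = (\<integral>z. f (p x z) \<partial>\<eta>)" for x
  have bc: "bounded_continuous (\<lambda>z. h (p (fst z) (snd z)))" if "bounded_continuous h" for h :: "'a \<Rightarrow> real"
    by (rule bounded_continuous_compose[OF that cont])
  have px: "continuous_on UNIV (p x)" for x
  proof -
    have "continuous_on UNIV (\<lambda>y :: 'a. (x, y))" by (intro continuous_intros)
    from continuous_on_compose2[OF cont this] show ?thesis by simp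
  qed
  have bx: "bounded_continuous (\<lambda>y. h (p x y))" if "bounded_continuous h" for h :: "'a \<Rightarrow> real" and x
    by (rule bounded_continuous_compose[OF that px])
  have g: "bounded_continuous g"
    using bounded_continuous_integral[OF \<eta> bc[OF f]] by (simp add: g_def[abs_def])
  have gavg: "(\<integral>y. g (p x y) \<partial>\<eta>) = g x" for x
    using idem[OF bx[OF f, of x]] by (simp add: g_def assoc)
  have mult: "bounded_continuous (\<lambda>z. u z * v z)" if uv: "bounded_continuous u" "bounded_continuous v" for u v :: "'b::topological_space \<Rightarrow> real"
  proof
    show "continuous_on UNIV (\<lambda>z. u z * v z)" using uv by (intro continuous_on_mult) auto
    obtain a b where ab: "\<And>z. \<bar>u z\<bar> \<le> a" "\<And>z. \<bar>v z\<bar> \<le> b" using uv unfolding bounded_iff by auto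
    have "\<bar>u z * v z\<bar> \<le> a * b" for z 
      unfolding abs_mult using ab(1)[of z] by (intro mult_mono ab order_trans[OF abs_ge_zero]) auto
    then show "bounded (range (\<lambda>z. u z * v z))" by (intro boundedI[of _ "a * b"]) auto
  qed
  define h where "h z = (g (p (fst z) (snd z)) - g (fst z))\<^sup>2" for z
  have g1: "bounded_continuous (\<lambda>z :: 'a \<times> 'a. g (fst z))"
    by (rule bounded_continuous_compose[OF g]) (intro continuous_intros)
  have iP: "integrable ?\<pi> u" if "bounded_continuous u" for u by (rule integrable_bounded_continuous[OF \<pi> that])
  have fub: "(\<integral>z. u z \<partial>?\<pi>) = (\<integral>x. (\<integral>y. u (x, y) \<partial>\<eta>) \<partial>\<eta>)" if "bounded_continuous u" for u
    using that by (intro integral_pair_fst[OF \<eta> \<eta>] borel_measurable_continuous_onI) auto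
  note m1 = mult[OF bc[OF g] bc[OF g]] and m2 = mult[OF bc[OF g] g1] and m3 = mult[OF g1 g1]
  have heq: "h z = g (p (fst z) (snd z)) * g (p (fst z) (snd z)) - 2 * (g (p (fst z) (snd z)) * g (fst z)) + g (fst z) * g (fst z)" for z
    by (simp add: h_def power2_eq_square algebra_simps)
  \<comment> \<open>All three integrals of the expanded square equal the integral of
    \<open>g x * g x\<close>: the first by idempotence of \<open>\<eta>\<close>, the mixed one
    because averaging \<open>g (p x y)\<close> over \<open>y\<close> gives back
    \<open>g x\<close>.\<close>
  have "(\<integral>z. h z \<partial>?\<pi>) = (\<integral>z. g (p (fst z) (snd z)) * g (p (fst z) (snd z)) \<partial>?\<pi>) - 2 * (\<integral>z. g (p (fst z) (snd z)) * g (fst z) \<partial>?\<pi>)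
      + (\<integral>z. g (fst z) * g (fst z) \<partial>?\<pi>)"
    unfolding heq using iP[OF m1] iP[OF m2] iP[OF m3] by simp
  also have "(\<integral>z. g (p (fst z) (snd z)) * g (p (fst z) (snd z)) \<partial>?\<pi>) = (\<integral>x. g x * g x \<partial>\<eta>)"
    using fub[OF m1] idem[OF mult[OF g g]] by simp
  also have "(\<integral>z. g (p (fst z) (snd z)) * g (fst z) \<partial>?\<pi>) = (\<integral>x. g x * g x \<partial>\<eta>)"
    using fub[OF m2] by (simp add: gavg)
  also have "(\<integral>z. g (fst z) * g (fst z) \<partial>?\<pi>) = (\<integral>x. g x * g x \<partial>\<eta>)"
    using fub[OF m3] by (simp add: prob_space)
  finally have h0: "(\<integral>z. h z \<partial>?\<pi>) = 0" by simp
  have ih: "integrable ?\<pi> h" unfolding heq[abs_def] using iP[OF m1] iP[OF m2] iP[OF m3] by simp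
  have AEh: "AE z in ?\<pi>. h z = 0"
    using integral_nonneg_eq_0_iff_AE[OF ih] h0 by (simp add: h_def)
  have ch: "continuous_on UNIV h"
    unfolding h_def using bc[OF g] g1 by (intro continuous_intros) auto
  have "h (x, y) = 0"
    by (rule continuous_eq_on_supp[OF \<pi> ch continuous_on_const AEh supp_pair[OF \<eta> \<eta> xy]])
  then show ?thesis by (simp add: h_def g_def)
qed

section \<open>Invariant measures on subsemigroups\<close>

text \<open>Let \<open>D\<close> be the union of the sets \<open>C n\<close>. By invariance, for
  each \<open>u\<close> in \<open>D\<close> almost every \<open>v\<close> lies in
  \<open>u D\<close>. Exchanging the quantifiers by Fubini gives one \<open>w\<close> that lies in
  \<open>u D\<close> for almost every \<open>u\<close>; replacing \<open>u\<close> by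
  \<open>w d\<close>, which has the same law, yields \<open>w = w d d'\<close>. An element fixing
  \<open>w\<close> on the right fixes every \<open>k w\<close>, hence almost every point, hence the
  whole support.\<close>

lemma invariant_measure_right_identity:
  fixes m :: "'a::polish_space measure" and p :: "'a \<Rightarrow> 'a \<Rightarrow> 'a"
  assumes m: "m \<in> borel_probs" and cont: "continuous_on UNIV (\<lambda>z. p (fst z) (snd z))"
    and assoc: "\<And>x y z. p (p x y) z = p x (p y z)"
    and inv: "\<And>u. u \<in> supp m \<Longrightarrow> distr m borel (p u) = m" "\<And>u. u \<in> supp m \<Longrightarrow> distr m borel (\<lambda>x. p x u) = m"
    and C: "\<And>n::nat. compact (C n)" "\<And>n. C n \<subseteq> supp m" "AE x in m. x \<in> (\<Union>n. C n)"
  shows "AE d in m. \<exists>d'\<in>(\<Union>n. C n). \<forall>w\<in>supp m. p w (p d d') = w"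
proof -
  interpret prob_space m using borel_probsD[OF m] by simp
  interpret pair_prob_space m m ..
  let ?D = "\<Union>n. C n"
  have pl: "continuous_on UNIV (p x)" for x
  proof -
    have "continuous_on UNIV (\<lambda>y :: 'a. (x, y))" by (intro continuous_intros)
    from continuous_on_compose2[OF cont this] show ?thesis by simp
  qed
  have pr: "continuous_on UNIV (\<lambda>x. p x y)" for y
  proof -
    have "continuous_on UNIV (\<lambda>x :: 'a. (x, y))" by (intro continuous_intros)
    from continuous_on_compose2[OF cont this] show ?thesis by simp
  qed
  have ml: "p x \<in> measurable m borel" and mr: "(\<lambda>z. p z x) \<in> measurable m borel" for x
    unfolding measurable_borel_probs[OF m] by (intro borel_measurable_continuous_onI pl pr)+
  \<comment> \<open>The pairs whose second entry is a multiple of the first by an element of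
    \<open>?D\<close>. As a countable union of compact images this set is Borel, so that the
    quantifiers can be exchanged.\<close>
  define W where "W = (\<Union>i j. (\<lambda>z. (fst z, p (fst z) (snd z))) ` (C i \<times> C j))"
  have "compact ((\<lambda>z. (fst z, p (fst z) (snd z))) ` (C i \<times> C j))" for i j
    by (intro compact_continuous_image compact_Times C continuous_on_Pair continuous_on_fst continuous_on_id continuous_on_subset[OF cont]) auto
  then have Wb: "W \<in> sets (borel :: ('a \<times> 'a) measure)"
    unfolding W_def by (intro sets.countable_UN' countableI_type) (auto intro: borel_compact)
  have W: "(u, v) \<in> W \<longleftrightarrow> u \<in> ?D \<and> (\<exists>d\<in>?D. v = p u d)" for u v
    unfolding W_def by force
  have "AE v in m. (u, v) \<in> W" if u: "u \<in> ?D" for u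
  proof -
    have us: "u \<in> supp m" using u C(2) by blast
    have "AE d in m. (u, p u d) \<in> W" using C(3) by eventually_elim (use W u in blast)
    moreover have "{x \<in> space borel. (u, x) \<in> W} \<in> sets borel"
    proof -
      have "(\<lambda>x :: 'a. (u, x)) \<in> borel_measurable borel" by (intro borel_measurable_continuous_onI continuous_intros)
      from measurable_sets[OF this Wb] show ?thesis by (simp add: vimage_def)
    qed
    ultimately have "AE v in distr m borel (p u). (u, v) \<in> W" by (subst AE_distr_iff[OF ml])
    then show ?thesis by (simp only: inv(1)[OF us])
  qed
  with C(3) have "AE u in m. AE v in m. (u, v) \<in> W" by (auto elim: eventually_mono)
  moreover have "{z \<in> space (m \<Otimes>\<^sub>M m). (fst z, snd z) \<in> W} \<in> sets (m \<Otimes>\<^sub>M m)"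
    using Wb borel_probsD(1,2)[OF borel_probs_pair[OF m m]] by simp
  ultimately have "AE v in m. AE u in m. (u, v) \<in> W" by (subst (asm) AE_commute) auto
  with AE_supp[OF m] have "AE v in m. v \<in> supp m \<and> (AE u in m. (u, v) \<in> W)" by eventually_elim simp
  from AE_emeasure_pos[OF _ sets.top this] obtain w where w: "w \<in> supp m" "AE u in m. (u, w) \<in> W"
    by (auto simp: prob_space.emeasure_space_1[OF borel_probsD(3)[OF m]])
  have rid: "\<forall>x\<in>supp m. p x f = x" if wf: "p w f = w" for f
  proof -
    have cl: "closed {x. p x f = x}" by (intro closed_Collect_eq pr continuous_on_id)
    have "AE k in m. p k w \<in> {x. p x f = x}" using wf by (simp add: assoc)
    then have "AE x in distr m borel (\<lambda>k. p k w). x \<in> {x. p x f = x}"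
      using cl by (subst AE_distr_iff[OF mr]) auto
    then have "AE x in m. x \<in> {x. p x f = x}" by (simp only: inv(2)[OF w(1)])
    from supp_subset_closed[OF m cl this] show ?thesis by blast
  qed
  have "AE u in distr m borel (p w). (u, w) \<in> W" by (simp only: inv(1)[OF w(1)] w(2))
  from AE_distrD[OF ml this] have "AE d in m. (p w d, w) \<in> W" .
  then show ?thesis
  proof eventually_elim
    case (elim d)
    then obtain d' where d': "d' \<in> ?D" "w = p (p w d) d'" using W by blast
    with rid[of "p d d'"] show ?case by (auto simp: assoc)
  qed
qed

lemma compact_approximation:
  fixes m :: "'a::polish_space measure"
  assumes m: "m \<in> borel_probs"
  obtains C :: "nat \<Rightarrow> 'a set" where "incseq C" "\<And>n. compact (C n)" "\<And>n. C n \<subseteq> supp m" "AE x in m. x \<in> (\<Union>n. C n)"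
proof -
  interpret prob_space m using borel_probsD[OF m] by simp
  have Sb: "supp m \<in> sets borel" using closed_supp[of m] by auto
  have sup: "(SUP K\<in>{K. K \<subseteq> supp m \<and> compact K}. emeasure m K) = 1"
    using inner_regular[of m "supp m"] borel_probsD(1)[OF m] emeasure_supp[OF m] Sb by simp
  have "\<exists>K. K \<subseteq> supp m \<and> compact K \<and> ennreal (1 - 1 / real (Suc n)) < emeasure m K" for n
  proof -
    have "ennreal (1 - 1 / real (Suc n)) < ennreal 1" by (rule ennreal_lessI) auto
    then have "ennreal (1 - 1 / real (Suc n)) < (SUP K\<in>{K. K \<subseteq> supp m \<and> compact K}. emeasure m K)"
      unfolding sup by simp
    then show ?thesis unfolding less_SUP_iff by blast
  qed
  then obtain K where K: "\<And>n. K n \<subseteq> supp m" "\<And>n. compact (K n)"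
    "\<And>n. ennreal (1 - 1 / real (Suc n)) < emeasure m (K n)" by metis
  have Ks: "K n \<in> sets m" for n using K(2) borel_probsD(1)[OF m] borel_compact by auto
  show ?thesis
  proof (rule that[of "\<lambda>n. \<Union>i\<le>n. K i"])
    show "incseq (\<lambda>n. \<Union>i\<le>n. K i)" unfolding incseq_def by (intro allI impI UN_mono) auto
    show "compact (\<Union>i\<le>n. K i)" for n using K(2) by (intro compact_UN) auto
    show "(\<Union>i\<le>n. K i) \<subseteq> supp m" for n using K(1) by blast
    have Us: "(\<Union>n. K n) \<in> sets m" using Ks by auto
    have "1 - 1 / real (Suc n) \<le> prob (\<Union>n. K n)" for n
    proof -
      have "1 - 1 / real (Suc n) \<le> prob (K n)"
        using K(3)[of n] by (simp add: emeasure_eq_measure ennreal_less_iff)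
      also have "\<dots> \<le> prob (\<Union>n. K n)" using Us by (intro finite_measure_mono) auto
      finally show ?thesis .
    qed
    moreover have "(\<lambda>n. 1 - 1 / real (Suc n)) \<longlonglongrightarrow> 1 - 0"
      by (intro tendsto_diff tendsto_const) (use LIMSEQ_inverse_real_of_nat in \<open>simp add: inverse_eq_divide\<close>)
    ultimately have "1 \<le> prob (\<Union>n. K n)" by (intro LIMSEQ_le_const2) auto
    then have "prob (\<Union>n. K n) = 1" using prob_le_1 by (rule antisym[rotated])
    then have "AE x in m. x \<in> (\<Union>n. K n)" using Us by (subst AE_in_set_eq_1) auto
    then show "AE x in m. x \<in> (\<Union>n. \<Union>i\<le>n. K i)" by eventually_elim blast
  qed
qed

text \<open>The right and the left identity coincide, and almost every point has an inverse. Some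
  compact set \<open>A j\<close> of points with inverse in \<open>C j\<close> has mass above one
  half; its preimage under translation by \<open>u\<close> has the same mass, so the two meet, and
  \<open>u = (u * a) * a'\<close> lies in the compact set of products of two elements of
  \<open>C j\<close>.\<close>

lemma invariant_measure_compact_group:
  fixes m :: "'a::{polish_space, topological_semigroup_mult} measure"
  assumes m: "m \<in> borel_probs"
    and inv: "\<And>u. u \<in> supp m \<Longrightarrow> return borel u \<^bold>* m = m" "\<And>u. u \<in> supp m \<Longrightarrow> m \<^bold>* return borel u = m"
  obtains e where "compact (supp m)" "e \<in> supp m" "\<forall>x\<in>supp m. \<forall>y\<in>supp m. x * y \<in> supp m"
    "\<forall>x\<in>supp m. e * x = x \<and> x * e = x" "\<forall>x\<in>supp m. \<exists>y\<in>supp m. x * y = e"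
proof -
  interpret prob_space m using borel_probsD[OF m] by simp
  let ?N = "supp m"
  have mul: "x * y \<in> ?N" if "x \<in> ?N" "y \<in> ?N" for x y
    using supp_mult[OF prob_space_return_borel m, of x x y] that inv(1) by (simp add: supp_return)
  have dl: "distr m borel ((*) u) = m" and dr: "distr m borel (\<lambda>x. x * u) = m" if "u \<in> ?N" for u
    using inv[OF that] by (simp_all add: conv_return_distr[OF m])
  obtain C :: "nat \<Rightarrow> 'a set" where C: "incseq C" "\<And>n. compact (C n)" "\<And>n. C n \<subseteq> ?N" "AE x in m. x \<in> (\<Union>n. C n)"
    by (rule compact_approximation[OF m]) blast
  have R: "AE d in m. \<exists>d'\<in>(\<Union>n. C n). \<forall>w\<in>?N. w * (d * d') = w"
    by (rule invariant_measure_right_identity[OF m _ _ dl dr C(2-4)]) (auto simp: mult.assoc intro!: continuous_intros)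
  have L: "AE d in m. \<exists>d'\<in>(\<Union>n. C n). \<forall>w\<in>?N. d' * d * w = w"
    by (rule invariant_measure_right_identity[OF m, of "\<lambda>x y. y * x", OF _ _ dr dl C(2-4)])
      (auto simp: mult.assoc intro!: continuous_intros)
  have ex: "\<exists>x\<in>?N. Q x" if "AE x in m. Q x" for Q
    using AE_emeasure_pos[OF _ _ that, of ?N] emeasure_supp[OF m] closed_supp[of m] borel_probsD(1)[OF m] by auto
  obtain e where e: "e \<in> ?N" "\<And>w. w \<in> ?N \<Longrightarrow> w * e = w" using ex[OF R] C(3) mul by blast
  obtain e' where e': "e' \<in> ?N" "\<And>w. w \<in> ?N \<Longrightarrow> e' * w = w" using ex[OF L] C(3) mul by blast
  have ee: "e' = e" using e(2)[OF e'(1)] e'(2)[OF e(1)] by simp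
  define A where "A j = fst ` (C j \<times> C j \<inter> {z. fst z * snd z = e})" for j
  have cle: "closed {z :: 'a \<times> 'a. fst z * snd z = e}" by (intro closed_Collect_eq continuous_intros)
  have Ac: "compact (A j)" for j
    unfolding A_def by (intro compact_continuous_image compact_Int_closed compact_Times C cle continuous_on_fst continuous_on_id)
  have Aiff: "a \<in> A j \<longleftrightarrow> a \<in> C j \<and> (\<exists>a'\<in>C j. a * a' = e)" for a j unfolding A_def by force
  have As: "A j \<in> sets m" for j using Ac borel_compact borel_probsD(1)[OF m] by auto
  have "AE d in m. d \<in> (\<Union>j. A j)"
    using R C(4)
  proof eventually_elim
    case (elim d)
    then obtain d' i k where d: "d \<in> C i" "d' \<in> C k" "\<forall>w\<in>?N. w * (d * d') = w" by blast
    have "d * d' = e" using d(3) e(1) ee e'(2)[of "d * d'"] mul C(3) d(1,2) by (metis subsetD)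
    moreover have "d \<in> C (max i k)" "d' \<in> C (max i k)" 
      using d incseqD[OF C(1), of i "max i k"] incseqD[OF C(1), of k "max i k"] by auto
    ultimately show ?case using Aiff by blast
  qed
  then have p1: "prob (\<Union>j. A j) = 1" using As by (subst (asm) AE_in_set_eq_1) auto
  have "(\<lambda>j. prob (A j)) \<longlonglongrightarrow> prob (\<Union>j. A j)"
  proof (rule finite_Lim_measure_incseq)
    show "incseq A" unfolding incseq_def using Aiff C(1) by (auto simp: incseq_def subset_iff)
  qed (use As in auto)
  then have "\<forall>\<^sub>F j in sequentially. 1/2 < prob (A j)" unfolding p1 by (intro order_tendstoD) auto
  from eventually_happens'[OF sequentially_bot this] obtain j where j: "1/2 < prob (A j)" by blast
  have N: "?N \<subseteq> (\<lambda>z. fst z * snd z) ` (C j \<times> C j)"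
  proof
    fix u assume u: "u \<in> ?N"
    have mu: "(*) u \<in> measurable m borel"
      unfolding measurable_borel_probs[OF m] by (intro borel_measurable_continuous_onI continuous_intros)
    let ?B = "(*) u -` A j \<inter> space m"
    have "prob (A j) = measure (distr m borel ((*) u)) (A j)" by (simp add: dl[OF u])
    also have "\<dots> = prob ?B"
      using As[of j] borel_probsD(1)[OF m] by (intro measure_distr mu) auto
    finally have B: "1/2 < prob ?B" using j by simp
    have Bs: "?B \<in> sets m" using measurable_sets[OF mu, of "A j"] As borel_probsD(1)[OF m] by auto
    have "A j \<inter> ?B \<noteq> {}"
    proof
      assume "A j \<inter> ?B = {}"
      then have "prob (A j \<union> ?B) = prob (A j) + prob ?B" by (intro finite_measure_Union As Bs)
      then show False using B j prob_le_1[of "A j \<union> ?B"] by linarith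
    qed
    then obtain a where a: "a \<in> A j" "u * a \<in> A j" by blast
    then obtain a' where a': "a' \<in> C j" "a * a' = e" using Aiff by blast
    have "u = (u * a) * a'" using e(2)[OF u] a'(2) by (simp add: mult.assoc)
    moreover have "u * a \<in> C j" using a Aiff by blast
    ultimately show "u \<in> (\<lambda>z. fst z * snd z) ` (C j \<times> C j)" using a' by (intro image_eqI[of _ _ "(u * a, a')"]) auto
  qed
  have comp: "compact ?N"
  proof -
    have "compact ((\<lambda>z. fst z * snd z) ` (C j \<times> C j))"
      by (intro compact_continuous_image compact_Times C continuous_intros)
    from compact_Int_closed[OF this closed_supp[of m]] show ?thesis using N by (simp add: Int_absorb1)
  qed
  \<comment> \<open>The points with an inverse form a projection of a compact set, hence a closed
    set; having full measure, it contains the support.\<close>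
  define I where "I = fst ` (?N \<times> ?N \<inter> {z. fst z * snd z = e})"
  have "compact I"
    unfolding I_def by (intro compact_continuous_image compact_Int_closed compact_Times comp cle continuous_on_fst continuous_on_id)
  then have "closed I" by (rule compact_imp_closed)
  moreover have "AE d in m. d \<in> I"
    using \<open>AE d in m. d \<in> (\<Union>j. A j)\<close>
  proof eventually_elim
    case (elim d)
    then obtain i d' where "d \<in> C i" "d' \<in> C i" "d * d' = e" using Aiff by blast
    then show ?case unfolding I_def using C(3) by (intro image_eqI[of _ _ "(d, d')"]) auto
  qed
  ultimately have "?N \<subseteq> I" by (rule supp_subset_closed[OF m])
  then have "\<exists>y\<in>?N. x * y = e" if "x \<in> ?N" for x using that unfolding I_def by force
  then show ?thesis using that[of e] comp e e' ee mul by blast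
qed

section \<open>Compact groups and Haar measure\<close>

text \<open>Continuity of the inverse comes from the closed graph \<open>{(x, y). x \<otimes> y = \<one>}\<close>.\<close>

lemma compact_groupI:
  fixes G (structure)
  assumes G: "group G" and top: "topspace X = carrier G" and X: "compact_space X" "Hausdorff_space X"
    and cont: "continuous_map (prod_topology X X) X (\<lambda>(x, y). x \<otimes> y)"
  shows "compact_group X G"
proof -
  interpret group G by fact
  have "continuous_map X X (\<lambda>x. inv x)"
    unfolding continuous_map_closedin
  proof (intro conjI allI impI)
    show "(\<lambda>x. inv x) \<in> topspace X \<rightarrow> topspace X" using top by auto
  next
    fix C assume C: "closedin X C"
    let ?S = "{z \<in> topspace (prod_topology X X). (\<lambda>(x, y). x \<otimes> y) z \<in> {\<one>}} \<inter> (topspace X \<times> C)"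
    have "closedin X {\<one>}" using X top by (intro closedin_Hausdorff_singleton) auto
    then have "closedin (prod_topology X X) ?S"
      using C by (intro closedin_Int closedin_continuous_map_preimage[OF cont]) (auto simp: closedin_prod_Times_iff)
    then have cl: "closedin X (fst ` ?S)"
      using Abstract_Topological_Spaces.closed_map_fst[OF X(1), of X] unfolding closed_map_def by blast
    have "{x \<in> topspace X. inv x \<in> C} = fst ` ?S"
    proof (intro equalityI subsetI)
      fix x assume "x \<in> {x \<in> topspace X. inv x \<in> C}"
      then show "x \<in> fst ` ?S" using top by (intro image_eqI[of _ _ "(x, inv x)"]) auto
    next
      fix x assume "x \<in> fst ` ?S"
      then obtain y where y: "x \<in> carrier G" "y \<in> carrier G" "y \<in> C" "x \<otimes> y = \<one>" using top by auto
      then have "inv x = y" using inv_comm inv_equality by blast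
      then show "x \<in> {x \<in> topspace X. inv x \<in> C}" using y top by simp
    qed
    then show "closedin X {x \<in> topspace X. inv x \<in> C}" using cl by simp
  qed
  then show ?thesis using assms by (simp add: compact_group_def topological_group_def)
qed

lemma monoid_on_simps [simp]:
  "carrier (monoid_on f A u) = A" "mult (monoid_on f A u) = f" "one (monoid_on f A u) = u"
  by (simp_all add: monoid_on_def)

lemma compact_group_monoid_on:
  fixes N :: "'a::{polish_space, topological_semigroup_mult} set"
  assumes N: "compact N" "e \<in> N" "\<And>x y. x \<in> N \<Longrightarrow> y \<in> N \<Longrightarrow> x * y \<in> N"
    "\<And>x. x \<in> N \<Longrightarrow> e * x = x \<and> x * e = x" "\<And>x. x \<in> N \<Longrightarrow> \<exists>y\<in>N. x * y = e"
  shows "compact_group (top_of_set N) (monoid_on (*) N e)"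
proof (rule compact_groupI)
  show "group (monoid_on (*) N e)"
  proof (rule groupI)
    fix x assume "x \<in> carrier (monoid_on (*) N e)"
    then have x: "x \<in> N" by simp
    obtain y where y: "y \<in> N" "x * y = e" using N(5)[OF x] by blast
    obtain z where z: "z \<in> N" "y * z = e" using N(5)[OF y(1)] by blast
    have "z = x * y * z" using N(4)[OF z(1)] y by simp
    also have "\<dots> = x" using z N(4)[OF x] by (simp add: mult.assoc)
    finally show "\<exists>y\<in>carrier (monoid_on (*) N e). y \<otimes>\<^bsub>monoid_on (*) N e\<^esub> x = \<one>\<^bsub>monoid_on (*) N e\<^esub>"
      using y z by auto
  qed (use N in \<open>auto simp: mult.assoc\<close>)
  have "continuous_on (N \<times> N) (\<lambda>z. fst z * snd z)" by (intro continuous_intros)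
  then show "continuous_map (prod_topology (top_of_set N) (top_of_set N)) (top_of_set N)
      (\<lambda>(x, y). x \<otimes>\<^bsub>monoid_on (*) N e\<^esub> y)"
    using N(3) by (auto simp: continuous_map_in_subtopology case_prod_beta prod_topology_subtopology_eu)
qed (use N(1) in \<open>auto simp: compact_space_subtopology Hausdorff_space_subtopology Hausdorff_space_euclidean\<close>)

lemma conv_absorb_left:
  fixes \<alpha> \<beta> \<gamma> :: "'a::{polish_space, topological_semigroup_mult} measure"
  assumes P: "\<alpha> \<in> borel_probs" "\<beta> \<in> borel_probs" "\<gamma> \<in> borel_probs"
    and eq: "AE x in \<alpha>. return borel x \<^bold>* \<beta> = \<gamma>"
  shows "\<alpha> \<^bold>* \<beta> = \<gamma>"
proof (rule borel_probs_eqI)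
  interpret prob_space \<alpha> using borel_probsD[OF P(1)] by simp
  fix f :: "'a \<Rightarrow> real" assume f: "bounded_continuous f"
  have "(\<integral>x. (\<integral>y. f (x * y) \<partial>\<beta>) \<partial>\<alpha>) = (\<integral>x. (\<integral>y. f y \<partial>\<gamma>) \<partial>\<alpha>)"
  proof (rule integral_cong_AE)
    show "AE x in \<alpha>. (\<integral>y. f (x * y) \<partial>\<beta>) = (\<integral>y. f y \<partial>\<gamma>)"
      using eq by eventually_elim (simp add: integral_conv_return(1)[symmetric] P f)
  qed (use bounded_continuous_integral_mult[OF _ f] P in \<open>auto simp: measurable_borel_probs intro!: borel_measurable_continuous_onI\<close>)
  then show "(\<integral>x. f x \<partial>(\<alpha> \<^bold>* \<beta>)) = (\<integral>x. f x \<partial>\<gamma>)"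
    by (simp add: integral_conv_bounded_continuous(1) P f prob_space)
qed (auto intro!: conv_borel_probs P)

lemma conv_absorb_right:
  fixes \<alpha> \<beta> \<gamma> :: "'a::{polish_space, topological_semigroup_mult} measure"
  assumes P: "\<alpha> \<in> borel_probs" "\<beta> \<in> borel_probs" "\<gamma> \<in> borel_probs"
    and eq: "AE x in \<alpha>. \<beta> \<^bold>* return borel x = \<gamma>"
  shows "\<beta> \<^bold>* \<alpha> = \<gamma>"
proof (rule borel_probs_eqI)
  interpret prob_space \<alpha> using borel_probsD[OF P(1)] by simp
  fix f :: "'a \<Rightarrow> real" assume f: "bounded_continuous f"
  have "(\<integral>y. (\<integral>x. f (x * y) \<partial>\<beta>) \<partial>\<alpha>) = (\<integral>x. (\<integral>y. f y \<partial>\<gamma>) \<partial>\<alpha>)"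
  proof (rule integral_cong_AE)
    show "AE y in \<alpha>. (\<integral>x. f (x * y) \<partial>\<beta>) = (\<integral>y. f y \<partial>\<gamma>)"
      using eq by eventually_elim (simp add: integral_conv_return(2)[symmetric] P f)
  qed (use bounded_continuous_integral_mult[OF _ f] P in \<open>auto simp: measurable_borel_probs intro!: borel_measurable_continuous_onI\<close>)
  then show "(\<integral>x. f x \<partial>(\<beta> \<^bold>* \<alpha>)) = (\<integral>x. f x \<partial>\<gamma>)"
    by (simp add: integral_conv_bounded_continuous(2) P f prob_space)
qed (auto intro!: conv_borel_probs P)

text \<open>For a left invariant \<open>\<omega>\<close> carried by \<open>K\<close>, the
  convolution of \<open>m\<close> with \<open>\<omega>\<close> is \<open>\<omega>\<close> by left
  invariance of \<open>\<omega>\<close>, and it is \<open>m\<close> by right invariance of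
  \<open>m\<close>. The definition of \<open>haar\<close> speaks of images of subsets of
  \<open>K\<close>, convolution of preimages; group inverses translate between the two.\<close>

lemma haar_eqI:
  fixes K :: "'a::{polish_space, topological_semigroup_mult} set"
  assumes K: "closed K" and G: "group (monoid_on (*) K e)"
    and m: "m \<in> borel_probs" "AE x in m. x \<in> K"
    and inv: "\<And>u. u \<in> K \<Longrightarrow> return borel u \<^bold>* m = m" "\<And>u. u \<in> K \<Longrightarrow> m \<^bold>* return borel u = m"
  shows "haar K = m"
proof -
  interpret group "monoid_on (*) K e" by fact
  have transl: "\<exists>h\<in>K. (\<forall>x\<in>K. h * (g * x) = x \<and> g * (h * x) = x)" if "g \<in> K" for g
    using that inv_closed[of g] l_inv[of g] r_inv[of g] l_one by (intro bexI[of _ "inv\<^bsub>monoid_on (*) K e\<^esub> g"]) (auto simp: mult.assoc[symmetric])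
  have mulK: "g * x \<in> K" if "g \<in> K" "x \<in> K" for g x using m_closed[of g x] that by simp
  have Kb: "K \<in> sets borel" using K by simp
  have meas: "(*) g \<in> borel_measurable borel" for g :: 'a
    by (intro borel_measurable_continuous_onI continuous_intros)
  have K1: "emeasure \<omega> K = 1 \<longleftrightarrow> (AE x in \<omega>. x \<in> K)" if "\<omega> \<in> borel_probs" for \<omega> :: "'a measure"
    using prob_space.AE_in_set_eq_1[OF borel_probsD(3)[OF that], of K] Kb borel_probsD(1)[OF that]
      finite_measure.emeasure_eq_measure[OF prob_space.finite_measure[OF borel_probsD(3)[OF that]], of K] by simp
  have restr: "emeasure \<omega> B = emeasure \<omega> (B \<inter> K)" if \<omega>: "\<omega> \<in> borel_probs" "AE x in \<omega>. x \<in> K" and B: "B \<in> sets borel"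
    for \<omega> :: "'a measure" and B
    by (rule emeasure_eq_AE) (use \<omega>(2) B Kb borel_probsD(1)[OF \<omega>(1)] in auto)
  have distr: "emeasure (return borel g \<^bold>* \<omega>) B = emeasure \<omega> ((*) g -` B)" if \<omega>: "\<omega> \<in> borel_probs" and B: "B \<in> sets borel"
    for g :: 'a and \<omega> :: "'a measure" and B
    using emeasure_distr[of "(*) g" \<omega> borel B] meas B borel_probsD(2)[OF \<omega>]
    by (simp add: conv_return_distr(1)[OF \<omega>] measurable_borel_probs[OF \<omega>])
  have vb: "(*) g -` B \<in> sets borel" if "B \<in> sets borel" for g :: 'a and B
    using measurable_sets[OF meas that] by simp
  show ?thesis
    unfolding haar_def
  proof (rule the_equality, intro conjI ballI impI)
    show "m \<in> borel_probs_on K" using m K1 by (simp add: borel_probs_on_def)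
    fix g B assume g: "g \<in> K" and B: "B \<in> sets borel" "B \<subseteq> K"
    obtain h where h: "h \<in> K" "\<And>x. x \<in> K \<Longrightarrow> h * (g * x) = x \<and> g * (h * x) = x" using transl[OF g] by blast
    have "(*) g ` B = (*) h -` B \<inter> K"
    proof (intro equalityI subsetI)
      fix x assume "x \<in> (*) h -` B \<inter> K" then show "x \<in> (*) g ` B" using h(2)[of x] by (intro image_eqI[of _ _ "h * x"]) auto
    next
      fix x assume "x \<in> (*) g ` B" then show "x \<in> (*) h -` B \<inter> K" using h(2) B(2) mulK[OF g] by fastforce
    qed
    then show "emeasure m ((*) g ` B) = emeasure m B"
      using distr[OF m(1) B(1), of h] restr[OF m vb[OF B(1)], of h] inv(1)[OF h(1)] by simp
  next
    fix \<omega> assume \<omega>': "\<omega> \<in> borel_probs_on K \<and> (\<forall>g\<in>K. \<forall>B\<in>sets borel. B \<subseteq> K \<longrightarrow> emeasure \<omega> ((*) g ` B) = emeasure \<omega> B)"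
    then have \<omega>: "\<omega> \<in> borel_probs" and \<omega>K: "AE x in \<omega>. x \<in> K" using K1 by (auto simp: borel_probs_on_def)
    have "return borel g \<^bold>* \<omega> = \<omega>" if g: "g \<in> K" for g
    proof (rule measure_eqI)
      show "sets (return borel g \<^bold>* \<omega>) = sets \<omega>"
        using borel_probsD(1)[OF \<omega>] borel_probsD(1)[OF conv_borel_probs[OF prob_space_return_borel \<omega>]] by simp
      fix B assume "B \<in> sets (return borel g \<^bold>* \<omega>)"
      then have B: "B \<in> sets borel" using borel_probsD(1)[OF conv_borel_probs[OF prob_space_return_borel \<omega>]] by simp
      obtain h where h: "h \<in> K" "\<And>x. x \<in> K \<Longrightarrow> h * (g * x) = x \<and> g * (h * x) = x" using transl[OF g] by blast
      have img: "(*) g ` ((*) g -` B \<inter> K) = B \<inter> K"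
      proof (intro equalityI subsetI)
        fix x assume "x \<in> B \<inter> K" then show "x \<in> (*) g ` ((*) g -` B \<inter> K)"
          using h mulK[OF h(1)] by (intro image_eqI[of _ _ "h * x"]) auto
      qed (use mulK[OF g] in auto)
      have "emeasure (return borel g \<^bold>* \<omega>) B = emeasure \<omega> ((*) g -` B \<inter> K)"
        using distr[OF \<omega> B] restr[OF \<omega> \<omega>K vb[OF B]] by simp
      also have "\<dots> = emeasure \<omega> ((*) g ` ((*) g -` B \<inter> K))" using \<omega>' g vb[OF B] Kb by simp
      also have "\<dots> = emeasure \<omega> B" using img restr[OF \<omega> \<omega>K B] by simp
      finally show "emeasure (return borel g \<^bold>* \<omega>) B = emeasure \<omega> B" .
    qed
    then have "m \<^bold>* \<omega> = \<omega>" using m(2) by (intro conv_absorb_left m(1) \<omega>) (auto elim: eventually_mono)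
    moreover have "m \<^bold>* \<omega> = m" using inv(2) \<omega>K by (intro conv_absorb_right m(1) \<omega>) (auto elim: eventually_mono)
    ultimately show "\<omega> = m" by simp
  qed
qed

text \<open>Lets the invariance of \<open>corner x\<close> be verified only at the products
  \<open>x * t * x\<close>, which are dense in its support.\<close>

lemma closed_translation_invariant:
  fixes \<alpha> \<beta> :: "'a::{polish_space, topological_semigroup_mult} measure"
  assumes P: "\<alpha> \<in> borel_probs" "\<beta> \<in> borel_probs"
  shows "closed {u. return borel u \<^bold>* \<alpha> = \<beta>}" "closed {u. \<alpha> \<^bold>* return borel u = \<beta>}"
proof -
  have "{u. return borel u \<^bold>* \<alpha> = \<beta>} = (\<Inter>f\<in>{f. bounded_continuous f}. {u. (\<integral>y. f (u * y) \<partial>\<alpha>) = (\<integral>y. f y \<partial>\<beta>)})"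
  proof (intro equalityI subsetI)
    fix u assume "u \<in> (\<Inter>f\<in>{f. bounded_continuous f}. {u. (\<integral>y. f (u * y) \<partial>\<alpha>) = (\<integral>y. f y \<partial>\<beta>)})"
    then show "u \<in> {u. return borel u \<^bold>* \<alpha> = \<beta>}"
      by (auto intro!: borel_probs_eqI conv_borel_probs prob_space_return_borel P simp: integral_conv_return P)
  qed (auto simp: integral_conv_return[symmetric] P)
  also have "closed \<dots>"
    using bounded_continuous_integral_mult[OF P(1)] by (intro closed_INT ballI closed_Collect_eq continuous_on_const) auto
  finally show "closed {u. return borel u \<^bold>* \<alpha> = \<beta>}" .
  have "{u. \<alpha> \<^bold>* return borel u = \<beta>} = (\<Inter>f\<in>{f. bounded_continuous f}. {u. (\<integral>y. f (y * u) \<partial>\<alpha>) = (\<integral>y. f y \<partial>\<beta>)})"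
  proof (intro equalityI subsetI)
    fix u assume "u \<in> (\<Inter>f\<in>{f. bounded_continuous f}. {u. (\<integral>y. f (y * u) \<partial>\<alpha>) = (\<integral>y. f y \<partial>\<beta>)})"
    then show "u \<in> {u. \<alpha> \<^bold>* return borel u = \<beta>}"
      by (auto intro!: borel_probs_eqI conv_borel_probs prob_space_return_borel P simp: integral_conv_return P)
  qed (auto simp: integral_conv_return[symmetric] P)
  also have "closed \<dots>"
    using bounded_continuous_integral_mult[OF P(1)] by (intro closed_INT ballI closed_Collect_eq continuous_on_const) auto
  finally show "closed {u. \<alpha> \<^bold>* return borel u = \<beta>}" .
qed

section \<open>Idempotent measures\<close>

abbreviation dirac :: "'a::topological_space \<Rightarrow> 'a measure" where
  "dirac \<equiv> return borel"

lemmas conv_simps = conv_assoc conv_borel_probs prob_space_return_borel conv_return_return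

lemma dirac_dirac_conv:
  fixes \<alpha> :: "'a::{polish_space, topological_semigroup_mult} measure"
  shows "\<alpha> \<in> borel_probs \<Longrightarrow> dirac x \<^bold>* (dirac y \<^bold>* \<alpha>) = dirac (x * y) \<^bold>* \<alpha>"
  by (simp add: conv_assoc[symmetric] prob_space_return_borel conv_return_return)

lemma supp_conv_subset:
  fixes \<alpha> \<beta> :: "'a::{polish_space, topological_semigroup_mult} measure"
  assumes P: "\<alpha> \<in> borel_probs" "\<beta> \<in> borel_probs" and A: "closed A"
    and "\<And>x y. x \<in> supp \<alpha> \<Longrightarrow> y \<in> supp \<beta> \<Longrightarrow> x * y \<in> A"
  shows "supp (\<alpha> \<^bold>* \<beta>) \<subseteq> A"
  by (rule supp_subset_closed[OF conv_borel_probs[OF P] A], rule AE_conv_closed[OF P A])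
    (use assms(4) in \<open>auto simp: set_times_def\<close>)

lemma supp_conv3_subset:
  fixes \<alpha> \<beta> \<gamma> :: "'a::{polish_space, topological_semigroup_mult} measure"
  assumes P: "\<alpha> \<in> borel_probs" "\<beta> \<in> borel_probs" "\<gamma> \<in> borel_probs" and A: "closed A"
    and sub: "\<And>x y z. x \<in> supp \<alpha> \<Longrightarrow> y \<in> supp \<beta> \<Longrightarrow> z \<in> supp \<gamma> \<Longrightarrow> x * y * z \<in> A"
  shows "supp (\<alpha> \<^bold>* \<beta> \<^bold>* \<gamma>) \<subseteq> A"
proof (rule supp_conv_subset[OF conv_borel_probs[OF P(1,2)] P(3) A])
  fix u z assume u: "u \<in> supp (\<alpha> \<^bold>* \<beta>)" and z: "z \<in> supp \<gamma>"
  have "closed ((\<lambda>u. u * z) -` A)" by (intro continuous_closed_vimage A) (auto intro!: continuous_intros simp: continuous_on_eq_continuous_at[symmetric])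
  then have "supp (\<alpha> \<^bold>* \<beta>) \<subseteq> (\<lambda>u. u * z) -` A" by (rule supp_conv_subset[OF P(1,2)]) (use sub z in auto)
  then show "u * z \<in> A" using u by blast
qed

locale idempotent_measure =
  fixes \<eta> :: "'a::{polish_space, topological_semigroup_mult} measure"
  assumes prob: "\<eta> \<in> borel_probs" and idem: "\<eta> \<^bold>* \<eta> = \<eta>"
begin

abbreviation "T \<equiv> supp \<eta>"

lemma mult_closed: "x \<in> T \<Longrightarrow> y \<in> T \<Longrightarrow> x * y \<in> T"
  using supp_mult[OF prob prob, of x y] idem by simp

text \<open>The second identity is the first one for the opposite product, which accounts for the
  reversed factor \<open>y * x\<close>.\<close>

lemma dirac_absorb:
  assumes "x \<in> T" "y \<in> T"
  shows "dirac (x * y) \<^bold>* \<eta> = dirac x \<^bold>* \<eta>" "\<eta> \<^bold>* dirac (y * x) = \<eta> \<^bold>* dirac x"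
proof -
  have c: "continuous_on UNIV (\<lambda>z :: 'a \<times> 'a. fst z * snd z)" "continuous_on UNIV (\<lambda>z :: 'a \<times> 'a. snd z * fst z)"
    by (intro continuous_intros)+
  show "dirac (x * y) \<^bold>* \<eta> = dirac x \<^bold>* \<eta>"
  proof (rule borel_probs_eqI)
    fix f :: "'a \<Rightarrow> real" assume f: "bounded_continuous f"
    have "(\<integral>z. f (x * y * z) \<partial>\<eta>) = (\<integral>z. f (x * z) \<partial>\<eta>)"
      by (rule idempotent_integral_translation[OF prob c(1) _ _ f assms])
        (auto simp: mult.assoc idem integral_conv_bounded_continuous(1)[OF prob prob, symmetric])
    then show "(\<integral>z. f z \<partial>(dirac (x * y) \<^bold>* \<eta>)) = (\<integral>z. f z \<partial>(dirac x \<^bold>* \<eta>))"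
      by (simp add: integral_conv_return prob f)
  qed (auto intro!: conv_borel_probs prob_space_return_borel prob)
  show "\<eta> \<^bold>* dirac (y * x) = \<eta> \<^bold>* dirac x"
  proof (rule borel_probs_eqI)
    fix f :: "'a \<Rightarrow> real" assume f: "bounded_continuous f"
    have "(\<integral>z. f (z * (y * x)) \<partial>\<eta>) = (\<integral>z. f (z * x) \<partial>\<eta>)"
      by (rule idempotent_integral_translation[where p="\<lambda>x y. y * x", OF prob c(2) _ _ f assms])
        (auto simp: mult.assoc idem integral_conv_bounded_continuous(2)[OF prob prob, symmetric])
    then show "(\<integral>z. f z \<partial>(\<eta> \<^bold>* dirac (y * x))) = (\<integral>z. f z \<partial>(\<eta> \<^bold>* dirac x))"
      by (simp add: integral_conv_return prob f)
  qed (auto intro!: conv_borel_probs prob_space_return_borel prob)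
qed

lemma conv_dirac_conv:
  assumes a: "a \<in> T"
  shows "\<eta> \<^bold>* (dirac a \<^bold>* \<eta>) = \<eta>"
proof -
  have "AE x in \<eta>. dirac x \<^bold>* (dirac a \<^bold>* \<eta>) = dirac x \<^bold>* \<eta>"
    using AE_supp[OF prob] by eventually_elim (simp add: dirac_dirac_conv prob dirac_absorb a)
  then have "\<eta> \<^bold>* (dirac a \<^bold>* \<eta>) = \<eta> \<^bold>* \<eta>"
    by (intro conv_cong_left conv_borel_probs prob prob_space_return_borel)
  then show ?thesis by (simp add: idem)
qed

text \<open>\<open>x\<close> may be any point of \<open>T\<close>: an arbitrary one yields the first
  idempotent, and an idempotent then yields the Haar measure of its group.\<close>

definition corner :: "'a \<Rightarrow> 'a measure" where
  "corner x = dirac x \<^bold>* \<eta> \<^bold>* dirac x"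

lemma corner_prob: "corner x \<in> borel_probs"
  by (simp add: corner_def conv_borel_probs prob_space_return_borel prob)

lemma supp_corner_subset:
  "closed A \<Longrightarrow> (\<And>t. t \<in> T \<Longrightarrow> x * t * x \<in> A) \<Longrightarrow> supp (corner x) \<subseteq> A"
  unfolding corner_def
  by (rule supp_conv3_subset) (auto simp: prob_space_return_borel prob supp_return)

lemma corner_mem: "t \<in> T \<Longrightarrow> x * t * x \<in> supp (corner x)"
  unfolding corner_def
  by (intro supp_mult conv_borel_probs prob_space_return_borel prob) (auto simp: supp_return)

lemma corner_invariant:
  assumes x: "x \<in> T" and u: "u \<in> supp (corner x)"
  shows "dirac u \<^bold>* corner x = corner x" "corner x \<^bold>* dirac u = corner x"
proof -
  have "supp (corner x) \<subseteq> {u. dirac u \<^bold>* corner x = corner x}"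
  proof (rule supp_corner_subset[OF closed_translation_invariant(1)[OF corner_prob corner_prob]])
    fix t assume t: "t \<in> T"
    have "dirac (x * t * x) \<^bold>* corner x = dirac (x * (t * x * x)) \<^bold>* \<eta> \<^bold>* dirac x"
      by (simp add: corner_def conv_simps prob dirac_dirac_conv mult.assoc)
    also have "dirac (x * (t * x * x)) \<^bold>* \<eta> = dirac x \<^bold>* \<eta>" using x t by (intro dirac_absorb mult_closed)
    finally show "x * t * x \<in> {u. dirac u \<^bold>* corner x = corner x}" by (simp add: corner_def)
  qed
  with u show "dirac u \<^bold>* corner x = corner x" by blast
  have "supp (corner x) \<subseteq> {u. corner x \<^bold>* dirac u = corner x}"
  proof (rule supp_corner_subset[OF closed_translation_invariant(2)[OF corner_prob corner_prob]])
    fix t assume t: "t \<in> T"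
    have "corner x \<^bold>* dirac (x * t * x) = dirac x \<^bold>* (\<eta> \<^bold>* dirac ((x * x * t) * x))"
      by (simp add: corner_def conv_simps prob mult.assoc)
    also have "\<eta> \<^bold>* dirac ((x * x * t) * x) = \<eta> \<^bold>* dirac x" using x t by (intro dirac_absorb mult_closed)
    finally show "x * t * x \<in> {u. corner x \<^bold>* dirac u = corner x}" by (simp add: corner_def conv_simps prob)
  qed
  with u show "corner x \<^bold>* dirac u = corner x" by blast
qed

text \<open>The support of \<open>corner x\<close> is a compact group inside \<open>T\<close>, and
  the identity of this group is idempotent.\<close>

lemma ex_idempotent: "\<exists>e. e \<in> idempotents T"
proof -
  obtain x where x: "x \<in> T" using supp_nonempty[OF prob] by blast
  obtain e where e: "e \<in> supp (corner x)" "\<forall>y\<in>supp (corner x). e * y = y \<and> y * e = y"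
    by (rule invariant_measure_compact_group[OF corner_prob corner_invariant[OF x]]) blast
  have "supp (corner x) \<subseteq> T" using x by (intro supp_corner_subset closed_supp mult_closed)
  then show ?thesis using e by (auto simp: idempotents_def)
qed

end

locale idempotent_measure_at = idempotent_measure +
  fixes e
  assumes e_idempotent: "e \<in> idempotents T"
begin

abbreviation "H \<equiv> rees_G T e"
abbreviation "HG \<equiv> monoid_on (*) H e"

lemma e_mem: "e \<in> T" and ee: "e * e = e"
  using e_idempotent by (auto simp: idempotents_def)

lemma ee_left: "e * (e * x) = e * x" and ee_right: "x * e * e = x * e"
  by (simp_all add: ee mult.assoc[symmetric]) (simp add: ee mult.assoc)

lemma rees_G_eq: "H = {z \<in> T. e * z = z \<and> z * e = z}"
proof (intro equalityI subsetI)
  fix z assume "z \<in> H" then show "z \<in> {z \<in> T. e * z = z \<and> z * e = z}"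
    using e_mem mult_closed by (auto simp: rees_G_def set_times_def ee ee_left mult.assoc)
next
  fix z assume "z \<in> {z \<in> T. e * z = z \<and> z * e = z}"
  then have "e * z * e = z" "z \<in> T" by auto
  then show "z \<in> H" unfolding rees_G_def by (metis set_times_intro singletonI)
qed

text \<open>For an idempotent \<open>e\<close> the set \<open>H\<close> is cut out of
  \<open>T\<close> by closed conditions, so passing to the support adds no limit points.\<close>

lemma supp_corner: "supp (corner e) = H"
proof
  have "closed {z \<in> T. e * z = z \<and> z * e = z}"
    unfolding Collect_conj_eq Collect_mem_eq
    by (intro closed_Int closed_supp closed_Collect_eq continuous_intros)
  then show "supp (corner e) \<subseteq> H"
    unfolding rees_G_eq using e_mem mult_closed by (intro supp_corner_subset) (auto simp: mult.assoc ee ee_left)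
  show "H \<subseteq> supp (corner e)" using corner_mem[of _ e] rees_G_eq by force
qed

lemma rees_G_facts:
  shows compact_rees_G: "compact H" and e_mem_rees_G: "e \<in> H"
    and mult_rees_G: "x \<in> H \<Longrightarrow> y \<in> H \<Longrightarrow> x * y \<in> H"
    and right_inverse_rees_G: "x \<in> H \<Longrightarrow> \<exists>y\<in>H. x * y = e"
proof -
  have eH: "e \<in> H" using e_mem ee by (simp add: rees_G_eq)
  obtain e' where e': "compact H" "e' \<in> H" "\<forall>x\<in>H. \<forall>y\<in>H. x * y \<in> H"
    "\<forall>x\<in>H. e' * x = x \<and> x * e' = x" "\<forall>x\<in>H. \<exists>y\<in>H. x * y = e'"
    by (rule invariant_measure_compact_group[OF corner_prob corner_invariant[OF e_mem], unfolded supp_corner])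
  have "e' * e = e" using e'(4) eH by blast
  moreover have "e' * e = e'" using e'(2) unfolding rees_G_eq by blast
  ultimately have "e' = e" by simp
  with e' show "compact H" "e \<in> H" "x \<in> H \<Longrightarrow> y \<in> H \<Longrightarrow> x * y \<in> H" "x \<in> H \<Longrightarrow> \<exists>y\<in>H. x * y = e"
    by simp_all
qed

lemma rees_G_compact_group: "compact_group (top_of_set H) HG"
  using rees_G_facts by (intro compact_group_monoid_on) (auto simp: rees_G_eq)

lemma rees_G_group: "group HG"
  using rees_G_compact_group by (simp add: compact_group_def topological_group_def)

lemma haar_rees_G: "haar H = dirac e \<^bold>* \<eta> \<^bold>* dirac e"
proof -
  have "haar H = corner e"
  proof (rule haar_eqI[OF compact_imp_closed[OF compact_rees_G] rees_G_group corner_prob])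
    show "AE x in corner e. x \<in> H" using AE_supp[OF corner_prob, of e] by (simp add: supp_corner)
  qed (use corner_invariant[OF e_mem] supp_corner in auto)
  then show ?thesis by (simp add: corner_def)
qed

lemma sandwich_mem: "z \<in> T \<Longrightarrow> e * z * e \<in> H"
  using e_mem mult_closed by (simp add: rees_G_eq ee ee_left mult.assoc)

lemma rees_inverse_facts:
  assumes "g \<in> H"
  shows rees_inverse_mem: "rees_inverse T e g \<in> H" and rees_inverse_right: "g * rees_inverse T e g = e"
    and rees_inverse_left: "rees_inverse T e g * g = e"
proof -
  interpret group HG by (rule rees_G_group)
  show "rees_inverse T e g \<in> H" "g * rees_inverse T e g = e" "rees_inverse T e g * g = e"
    using inv_closed[of g] r_inv[of g] l_inv[of g] assms by (simp_all add: rees_inverse_def)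
qed

lemma rees_inverse_eqI:
  assumes "g \<in> H" "h \<in> H" "h * g = e"
  shows "rees_inverse T e g = h"
proof -
  interpret group HG by (rule rees_G_group)
  show ?thesis using inv_equality[of h g] assms by (simp add: rees_inverse_def)
qed

lemma rees_inverse_mult:
  assumes "g \<in> H" "h \<in> H"
  shows "rees_inverse T e (g * h) = rees_inverse T e h * rees_inverse T e g"
proof -
  interpret group HG by (rule rees_G_group)
  show ?thesis using inv_mult_group[of g h] assms by (simp add: rees_inverse_def)
qed

lemma continuous_rees_inverse: "continuous_on H (rees_inverse T e)"
proof -
  have "continuous_map (top_of_set H) (top_of_set H) (rees_inverse T e)"
    using rees_G_compact_group by (simp add: compact_group_def topological_group_def rees_inverse_def[abs_def])
  then show ?thesis by (simp add: continuous_map_in_subtopology)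
qed

definition sinv :: "'a \<Rightarrow> 'a" where
  "sinv z = rees_inverse T e (e * z * e)"

lemma sinv_facts:
  assumes "z \<in> T"
  shows sinv_mem: "sinv z \<in> H" and sinv_right: "e * z * e * sinv z = e" and sinv_left: "sinv z * (e * z * e) = e"
  using rees_inverse_facts[OF sandwich_mem[OF assms]] by (simp_all add: sinv_def)

lemma continuous_sinv: "continuous_on T sinv"
  unfolding sinv_def
  by (rule continuous_on_compose2[OF continuous_rees_inverse]) (auto intro!: continuous_intros sandwich_mem)

lemma rees_left_eq: "rees_left T e z = z * e * sinv z" and rees_right_eq: "rees_right T e z = sinv z * e * z"
  by (simp_all add: rees_left_def rees_right_def sinv_def)

lemma continuous_rees: "continuous_on T (rees_left T e)" "continuous_on T (rees_right T e)"
  unfolding rees_left_eq rees_right_eq by (intro continuous_intros continuous_sinv)+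

lemma sinv_e: "z \<in> T \<Longrightarrow> e * sinv z = sinv z" "z \<in> T \<Longrightarrow> sinv z * e = sinv z"
  using sinv_mem rees_G_eq by auto

text \<open>Both sides depend continuously on \<open>z\<close>, so the identity has only to hold on
  a dense set, namely at the products \<open>c * b\<close> with \<open>c * e = c\<close>. There
  \<open>e * (c * b) * e\<close> splits into two elements of the group \<open>H\<close>, and the
  inverse of the product can be computed.\<close>

lemma rees_factorization:
  assumes z: "z \<in> T"
  shows "z * e * sinv z * (e * z) = z"
proof -
  let ?A = "{z. z \<in> T \<and> z * e * sinv z * (e * z) = z}"
  have c: "continuous_on T (\<lambda>z. (z * e * sinv z * (e * z), z))" by (intro continuous_intros continuous_sinv)
  have "closed (T \<inter> (\<lambda>z. (z * e * sinv z * (e * z), z)) -` {p. fst p = snd p})"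
    by (rule continuous_closed_preimage[OF c closed_supp]) (intro closed_Collect_eq continuous_intros)
  moreover have "T \<inter> (\<lambda>z. (z * e * sinv z * (e * z), z)) -` {p. fst p = snd p} = ?A" by auto
  ultimately have A: "closed ?A" by simp
  have TeT: "c * b \<in> ?A" if c: "c \<in> T" "c * e = c" and b: "b \<in> T" for c b
  proof -
    have cb: "c * b \<in> T" using c b mult_closed by blast
    have ce: "c * (e * x) = c * x" for x using c(2) by (simp add: mult.assoc[symmetric])
    have "e * (c * b) * e = (e * c * e) * (e * b * e)" by (simp add: mult.assoc ee_left ce)
    then have s: "sinv (c * b) = sinv b * sinv c"
      using rees_inverse_mult[OF sandwich_mem[OF c(1)] sandwich_mem[OF b]] by (simp add: sinv_def)
    have "c * (e * b * e * sinv b) = c" using sinv_right[OF b] c(2) by simp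
    then have 1: "c * b * e * sinv b = c" by (simp add: mult.assoc ce)
    have 2: "sinv c * (e * c) = e" using sinv_left[OF c(1)] c(2) by (simp add: mult.assoc)
    have "c * b * e * sinv (c * b) * (e * (c * b)) = (c * b * e * sinv b) * (sinv c * (e * c)) * b"
      unfolding s by (simp only: mult.assoc)
    also have "\<dots> = c * b" unfolding 1 2 c(2) ..
    finally show ?thesis using cb by simp
  qed
  \<comment> \<open>Density: \<open>\<eta>\<close>, \<open>dirac e\<close> and \<open>\<eta>\<close>
    convolve to \<open>\<eta>\<close>, and the support of the product of the first two consists of
    points fixed by \<open>e\<close> on the right.\<close>
  have "supp (\<eta> \<^bold>* dirac e \<^bold>* \<eta>) \<subseteq> ?A"
  proof (rule supp_conv_subset[OF _ prob A])
    show "\<eta> \<^bold>* dirac e \<in> borel_probs" by (intro conv_borel_probs prob prob_space_return_borel)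
    fix c b assume c: "c \<in> supp (\<eta> \<^bold>* dirac e)" and b: "b \<in> T"
    have "supp (\<eta> \<^bold>* dirac e) \<subseteq> T \<inter> {c. c * e = c}"
      by (rule supp_conv_subset[OF prob prob_space_return_borel])
        (auto intro!: closed_Int closed_supp closed_Collect_eq continuous_intros mult_closed e_mem simp: supp_return ee ee_right)
    then show "c * b \<in> ?A" using TeT b c by blast
  qed
  then have "T \<subseteq> ?A" using conv_dirac_conv[OF e_mem] by (simp add: conv_assoc prob prob_space_return_borel)
  then show ?thesis using z by blast
qed

lemma rees_left_sandwich: "z \<in> T \<Longrightarrow> rees_left T e z * (e * z) = z"
  and rees_right_sandwich: "z \<in> T \<Longrightarrow> z * e * rees_right T e z = z"
  using rees_factorization[of z] by (simp_all only: rees_left_eq rees_right_eq mult.assoc)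

end

section \<open>Rees coordinates of the support and of the measure\<close>

context idempotent_measure_at
begin

lemma rees_G_idempotent: "x \<in> H \<Longrightarrow> x * x = x \<Longrightarrow> x = e"
proof -
  assume x: "x \<in> H" "x * x = x"
  have "x = x * (x * rees_inverse T e x)" using rees_inverse_right[OF x(1)] x(1) by (simp add: rees_G_eq)
  also have "\<dots> = x * x * rees_inverse T e x" by (simp only: mult.assoc)
  also have "\<dots> = e" using rees_inverse_right[OF x(1)] x(2) by simp
  finally show "x = e" .
qed

text \<open>Left multiplication by \<open>e\<close> turns an idempotent of \<open>T * {e}\<close>
  into an idempotent of the group \<open>H\<close>, that is, into \<open>e\<close>.\<close>

lemma rees_L_eq: "rees_L T e = {l \<in> T. l * e = l \<and> e * l = e}"
proof (intro equalityI subsetI)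
  fix l assume "l \<in> rees_L T e"
  then obtain t where t: "t \<in> T" "l = t * e" and ll: "l * l = l"
    by (auto simp: rees_L_def idempotents_def set_times_def)
  have l: "l \<in> T" "l * e = l" using t mult_closed e_mem by (simp_all add: ee_right)
  have "e * l \<in> H" using sandwich_mem[OF l(1)] l(2) by (simp add: mult.assoc)
  moreover have "e * l * (e * l) = e * (l * e) * l" by (simp only: mult.assoc)
  then have "e * l * (e * l) = e * l" using l(2) ll by (simp add: mult.assoc)
  ultimately show "l \<in> {l \<in> T. l * e = l \<and> e * l = e}" using rees_G_idempotent l by blast
next
  fix l assume "l \<in> {l \<in> T. l * e = l \<and> e * l = e}"
  then have l: "l \<in> T" "l * e = l" "e * l = e" by auto
  have "l * l = l * e * l" using l(2) by simp
  also have "\<dots> = l * (e * l)" by (simp only: mult.assoc)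
  also have "\<dots> = l" using l by simp
  finally have "l * l = l" .
  moreover have "l * e \<in> T * {e}" using l by (intro set_times_intro) auto
  ultimately show "l \<in> rees_L T e" using l(2) by (simp add: rees_L_def idempotents_def)
qed

lemma rees_R_eq: "rees_R T e = {r \<in> T. e * r = r \<and> r * e = e}"
proof (intro equalityI subsetI)
  fix r assume "r \<in> rees_R T e"
  then obtain t where t: "t \<in> T" "r = e * t" and rr: "r * r = r"
    by (auto simp: rees_R_def idempotents_def set_times_def)
  have r: "r \<in> T" "e * r = r" using t mult_closed e_mem by (simp_all add: ee_left)
  have "r * e \<in> H" using sandwich_mem[OF r(1)] r(2) by simp
  moreover have "r * e * (r * e) = r * (e * r) * e" by (simp only: mult.assoc)
  then have "r * e * (r * e) = r * e" using r(2) rr by simp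
  ultimately show "r \<in> {r \<in> T. e * r = r \<and> r * e = e}" using rees_G_idempotent r by blast
next
  fix r assume "r \<in> {r \<in> T. e * r = r \<and> r * e = e}"
  then have r: "r \<in> T" "e * r = r" "r * e = e" by auto
  have "r * r = r * (e * r)" using r(2) by simp
  also have "\<dots> = r * e * r" by (simp only: mult.assoc)
  also have "\<dots> = r" using r by simp
  finally have "r * r = r" .
  moreover have "e * r \<in> {e} * T" using r by (intro set_times_intro) auto
  ultimately show "r \<in> rees_R T e" using r(2) by (simp add: rees_R_def idempotents_def)
qed

lemma rees_left_mem: "z \<in> T \<Longrightarrow> rees_left T e z \<in> rees_L T e"
proof -
  assume z: "z \<in> T"
  have s: "sinv z \<in> T" using sinv_mem[OF z] by (simp add: rees_G_eq)
  show ?thesis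
    using z s e_mem mult_closed sinv_right[OF z] sinv_e[OF z]
    by (simp add: rees_L_eq rees_left_eq mult.assoc)
qed

lemma rees_right_mem: "z \<in> T \<Longrightarrow> rees_right T e z \<in> rees_R T e"
proof -
  assume z: "z \<in> T"
  have s: "sinv z \<in> T" using sinv_mem[OF z] by (simp add: rees_G_eq)
  have "e * (sinv z * e * z) = sinv z * e * z" using sinv_e[OF z] by (simp add: mult.assoc[symmetric])
  moreover have "sinv z * e * z * e = e" using sinv_left[OF z] by (simp add: mult.assoc)
  ultimately show ?thesis using z s e_mem mult_closed by (simp add: rees_R_eq rees_right_eq)
qed

lemma rees_product: "T = rees_L T e * H * rees_R T e"
proof (intro equalityI subsetI)
  fix z assume z: "z \<in> T"
  have "rees_left T e z * (e * z * e) * rees_right T e z = (rees_left T e z * (e * z)) * e * rees_right T e z"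
    by (simp only: mult.assoc)
  also have "\<dots> = z" by (simp only: rees_left_sandwich[OF z] rees_right_sandwich[OF z])
  finally have "z = rees_left T e z * (e * z * e) * rees_right T e z" by simp
  then show "z \<in> rees_L T e * H * rees_R T e"
    using set_times_intro[OF set_times_intro[OF rees_left_mem[OF z] sandwich_mem[OF z]] rees_right_mem[OF z]] by simp
next
  fix z assume "z \<in> rees_L T e * H * rees_R T e"
  then show "z \<in> T" by (auto simp: set_times_def rees_L_eq rees_R_eq rees_G_eq intro!: mult_closed)
qed

text \<open>An ideal contains some \<open>e * i * e\<close> in the group \<open>H\<close>, hence
  contains \<open>e\<close>, and then every \<open>z\<close> through its factorization
  \<open>rees_left T e z * (e * z)\<close>.\<close>

lemma completely_simple_supp: "completely_simple T"
  unfolding completely_simple_def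
proof (intro conjI exI)
  show "T * T \<subseteq> T" by (auto simp: set_times_def mult_closed)
  show "simple_semigroup T"
    unfolding simple_semigroup_def
  proof (intro allI impI)
    fix I assume "semigroup_ideal T I"
    then have I: "I \<noteq> {}" "I \<subseteq> T" and TI: "\<And>x y. x \<in> T \<Longrightarrow> y \<in> I \<Longrightarrow> x * y \<in> I" and IT: "\<And>x y. x \<in> I \<Longrightarrow> y \<in> T \<Longrightarrow> x * y \<in> I"
      unfolding semigroup_ideal_def by (auto simp: subset_iff intro: set_times_intro)
    obtain i where i: "i \<in> I" using I by blast
    have iT: "i \<in> T" using i I by blast
    have "e * i * e * sinv i \<in> I"
      by (rule IT[OF IT[OF TI[OF e_mem i] e_mem]]) (use sinv_mem[OF iT] in \<open>simp add: rees_G_eq\<close>)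
    then have eI: "e \<in> I" using sinv_right[OF iT] by simp
    have "z \<in> I" if z: "z \<in> T" for z
    proof -
      have "rees_left T e z * (e * z) \<in> I"
        by (rule TI[OF _ IT[OF eI z]]) (use rees_left_mem[OF z] in \<open>simp add: rees_L_eq\<close>)
      then show ?thesis by (simp only: rees_left_sandwich[OF z])
    qed
    then show "I = T" using I by blast
  qed
  show "primitive_idempotent T e"
    unfolding primitive_idempotent_def
    using e_idempotent rees_G_idempotent by (auto simp: idempotents_def rees_G_eq)
qed

lemma corner_unit: "dirac e \<^bold>* corner e = corner e" "corner e \<^bold>* dirac e = corner e"
  using corner_invariant[OF e_mem] e_mem_rees_G supp_corner by auto

lemma restricted_law_prob:
  assumes "continuous_on T \<phi>"
  shows "distr (restrict_space \<eta> T) borel \<phi> \<in> borel_probs"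
proof (rule borel_probs_distr)
  interpret prob_space \<eta> using borel_probsD[OF prob] by simp
  show "prob_space (restrict_space \<eta> T)"
    using emeasure_supp[OF prob] closed_supp[of \<eta>] borel_probsD(1,2)[OF prob]
    by (intro prob_space_restrict_space) auto
  have "sets (restrict_space \<eta> T) = sets (restrict_space borel T)"
    by (rule sets_restrict_space_cong[OF borel_probsD(1)[OF prob]])
  then show "\<phi> \<in> borel_measurable (restrict_space \<eta> T)"
    using borel_measurable_continuous_on_restrict[OF assms] by (simp cong: measurable_cong_sets)
qed

text \<open>Only the values of the coordinate \<open>\<phi>\<close> on \<open>T\<close> are
  controlled, so \<open>g \<circ> \<phi>\<close> is replaced by a function \<open>h\<close> that is
  continuous everywhere and agrees with it on \<open>T\<close>.\<close>

lemma integral_restricted_law: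
  fixes g h :: "'a \<Rightarrow> real"
  assumes \<phi>: "continuous_on T \<phi>" and g: "bounded_continuous g" and h: "bounded_continuous h"
    and eq: "\<And>z. z \<in> T \<Longrightarrow> g (\<phi> z) = h z"
  shows "(\<integral>x. g x \<partial>distr (restrict_space \<eta> T) borel \<phi>) = (\<integral>x. h x \<partial>\<eta>)"
proof -
  have Ts: "T \<inter> space \<eta> \<in> sets \<eta>" using closed_supp[of \<eta>] borel_probsD(1,2)[OF prob] by auto
  have "sets (restrict_space \<eta> T) = sets (restrict_space borel T)"
    by (rule sets_restrict_space_cong[OF borel_probsD(1)[OF prob]])
  then have m: "\<phi> \<in> measurable (restrict_space \<eta> T) borel"
    using borel_measurable_continuous_on_restrict[OF \<phi>] by (simp cong: measurable_cong_sets)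
  have "(\<integral>x. g x \<partial>distr (restrict_space \<eta> T) borel \<phi>) = (\<integral>z. g (\<phi> z) \<partial>restrict_space \<eta> T)"
    using g by (intro integral_distr[OF m] borel_measurable_continuous_onI) auto
  also have "\<dots> = (\<integral>z. h z \<partial>restrict_space \<eta> T)"
    using eq by (intro Bochner_Integration.integral_cong) (auto simp: space_restrict_space)
  also have "\<dots> = (\<integral>z. indicator T z *\<^sub>R h z \<partial>\<eta>)" by (rule integral_restrict_space[OF Ts])
  also have "\<dots> = (\<integral>z. h z \<partial>\<eta>)"
  proof (rule integral_cong_AE)
    show "AE z in \<eta>. indicator T z *\<^sub>R h z = h z" using AE_supp[OF prob] by eventually_elim simp
    have hm: "h \<in> borel_measurable borel" using h by (simp add: borel_measurable_continuous_onI)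
    then show "h \<in> borel_measurable \<eta>" by (simp add: measurable_borel_probs[OF prob])
    show "(\<lambda>z. indicator T z *\<^sub>R h z) \<in> borel_measurable \<eta>"
      using hm closed_supp[of \<eta>] by (simp add: measurable_borel_probs[OF prob])
  qed
  finally show ?thesis .
qed

lemma left_law_prob: "left_law \<eta> e \<in> borel_probs" and right_law_prob: "right_law \<eta> e \<in> borel_probs"
  unfolding left_law_def right_law_def by (intro restricted_law_prob continuous_rees)+

text \<open>The point \<open>z * e\<close> is the left coordinate of \<open>z\<close> times the
  element \<open>e * z * e\<close> of \<open>H\<close>, and the Haar measure of \<open>H\<close>
  absorbs this element.\<close>

lemma left_law_conv_corner: "left_law \<eta> e \<^bold>* corner e = \<eta> \<^bold>* corner e"
proof (rule borel_probs_eqI)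
  fix f :: "'a \<Rightarrow> real" assume f: "bounded_continuous f"
  have eq: "(\<integral>y. f (rees_left T e z * y) \<partial>corner e) = (\<integral>y. f (z * y) \<partial>corner e)" if z: "z \<in> T" for z
  proof -
    have "dirac z \<^bold>* corner e = dirac (z * e) \<^bold>* corner e"
      using dirac_dirac_conv[OF corner_prob, of z e e] by (simp add: corner_unit)
    also have "z * e = rees_left T e z * (e * z * e)"
      using rees_left_sandwich[OF z] by (simp add: mult.assoc[symmetric])
    also have "dirac (rees_left T e z * (e * z * e)) \<^bold>* corner e = dirac (rees_left T e z) \<^bold>* corner e"
      using dirac_dirac_conv[OF corner_prob, of "rees_left T e z" "e * z * e" e]
        corner_invariant(1)[OF e_mem, of "e * z * e"] sandwich_mem[OF z] by (simp add: supp_corner)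
    finally show ?thesis
      using integral_conv_return(1)[OF corner_prob f, of z e] integral_conv_return(1)[OF corner_prob f, of "rees_left T e z" e] by simp
  qed
  have b: "bounded_continuous (\<lambda>x. \<integral>y. f (x * y) \<partial>corner e)"
    by (rule bounded_continuous_integral_mult(1)[OF corner_prob f])
  show "(\<integral>x. f x \<partial>(left_law \<eta> e \<^bold>* corner e)) = (\<integral>x. f x \<partial>(\<eta> \<^bold>* corner e))"
    unfolding integral_conv_bounded_continuous(1)[OF left_law_prob corner_prob f]
      integral_conv_bounded_continuous(1)[OF prob corner_prob f]
    unfolding left_law_def
    by (rule integral_restricted_law[OF continuous_rees(1) b b eq])
qed (auto intro!: conv_borel_probs left_law_prob corner_prob prob)

lemma corner_conv_right_law: "corner e \<^bold>* right_law \<eta> e = corner e \<^bold>* \<eta>"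
proof (rule borel_probs_eqI)
  fix f :: "'a \<Rightarrow> real" assume f: "bounded_continuous f"
  have eq: "(\<integral>y. f (y * rees_right T e z) \<partial>corner e) = (\<integral>y. f (y * z) \<partial>corner e)" if z: "z \<in> T" for z
  proof -
    have "corner e \<^bold>* dirac z = corner e \<^bold>* dirac e \<^bold>* dirac z" by (simp add: corner_unit)
    also have "\<dots> = corner e \<^bold>* dirac (e * z)" by (simp add: conv_simps corner_prob)
    also have "e * z = e * z * e * rees_right T e z"
      using rees_right_sandwich[OF z] by (simp add: mult.assoc)
    also have "corner e \<^bold>* dirac (e * z * e * rees_right T e z) = corner e \<^bold>* dirac (e * z * e) \<^bold>* dirac (rees_right T e z)"
      by (simp add: conv_simps corner_prob)
    also have "corner e \<^bold>* dirac (e * z * e) = corner e"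
      using corner_invariant(2)[OF e_mem, of "e * z * e"] sandwich_mem[OF z] by (simp add: supp_corner)
    finally show ?thesis
      using integral_conv_return(2)[OF corner_prob f, of e z] integral_conv_return(2)[OF corner_prob f, of e "rees_right T e z"] by simp
  qed
  have b: "bounded_continuous (\<lambda>x. \<integral>y. f (y * x) \<partial>corner e)"
    by (rule bounded_continuous_integral_mult(2)[OF corner_prob f])
  show "(\<integral>x. f x \<partial>(corner e \<^bold>* right_law \<eta> e)) = (\<integral>x. f x \<partial>(corner e \<^bold>* \<eta>))"
    unfolding integral_conv_bounded_continuous(2)[OF corner_prob right_law_prob f]
      integral_conv_bounded_continuous(2)[OF corner_prob prob f]
    unfolding right_law_def
    by (rule integral_restricted_law[OF continuous_rees(2) b b eq])
qed (auto intro!: conv_borel_probs right_law_prob corner_prob prob)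

text \<open>Since \<open>\<eta>\<close>, \<open>dirac e\<close> and \<open>\<eta>\<close> convolve
  to \<open>\<eta>\<close>, a factor \<open>dirac e\<close> may be inserted between
  \<open>\<eta>\<close> and a measure that absorbs \<open>\<eta>\<close>.\<close>

lemma conv_dirac_absorb:
  assumes \<rho>: "\<rho> \<in> borel_probs"
  shows "\<eta> \<^bold>* \<rho> = \<rho> \<Longrightarrow> \<eta> \<^bold>* (dirac e \<^bold>* \<rho>) = \<rho>" "\<rho> \<^bold>* \<eta> = \<rho> \<Longrightarrow> \<rho> \<^bold>* (dirac e \<^bold>* \<eta>) = \<rho>"
proof -
  assume a: "\<eta> \<^bold>* \<rho> = \<rho>"
  have "\<eta> \<^bold>* (dirac e \<^bold>* (\<eta> \<^bold>* \<rho>)) = \<eta> \<^bold>* (dirac e \<^bold>* \<eta>) \<^bold>* \<rho>" by (simp add: conv_simps prob \<rho>)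
  then show "\<eta> \<^bold>* (dirac e \<^bold>* \<rho>) = \<rho>" by (simp add: conv_dirac_conv[OF e_mem] a)
next
  assume a: "\<rho> \<^bold>* \<eta> = \<rho>"
  have "\<rho> \<^bold>* \<eta> \<^bold>* (dirac e \<^bold>* \<eta>) = \<rho> \<^bold>* (\<eta> \<^bold>* (dirac e \<^bold>* \<eta>))" by (simp add: conv_simps prob \<rho>)
  then show "\<rho> \<^bold>* (dirac e \<^bold>* \<eta>) = \<rho>" by (simp add: conv_dirac_conv[OF e_mem] a)
qed

lemma corner_conv_absorb:
  assumes \<rho>: "\<rho> \<in> borel_probs" "\<eta> \<^bold>* \<rho> = \<rho>" "\<rho> \<^bold>* \<eta> = \<rho>"
  shows "corner e \<^bold>* (dirac e \<^bold>* \<rho> \<^bold>* dirac e) = dirac e \<^bold>* \<rho> \<^bold>* dirac e"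
    and "dirac e \<^bold>* \<rho> \<^bold>* dirac e \<^bold>* corner e = dirac e \<^bold>* \<rho> \<^bold>* dirac e"
proof -
  have "corner e \<^bold>* (dirac e \<^bold>* \<rho> \<^bold>* dirac e) = dirac e \<^bold>* (\<eta> \<^bold>* (dirac e \<^bold>* \<rho>)) \<^bold>* dirac e"
    by (simp add: corner_def conv_simps dirac_dirac_conv prob \<rho> ee)
  then show "corner e \<^bold>* (dirac e \<^bold>* \<rho> \<^bold>* dirac e) = dirac e \<^bold>* \<rho> \<^bold>* dirac e"
    by (simp add: conv_dirac_absorb(1)[OF \<rho>(1,2)])
  have "dirac e \<^bold>* \<rho> \<^bold>* dirac e \<^bold>* corner e = dirac e \<^bold>* (\<rho> \<^bold>* (dirac e \<^bold>* \<eta>)) \<^bold>* dirac e"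
    by (simp add: corner_def conv_simps dirac_dirac_conv prob \<rho> ee)
  then show "dirac e \<^bold>* \<rho> \<^bold>* dirac e \<^bold>* corner e = dirac e \<^bold>* \<rho> \<^bold>* dirac e"
    by (simp add: conv_dirac_absorb(2)[OF \<rho>(1,3)])
qed

text \<open>The middle factor absorbs \<open>corner e\<close> on both sides. Inserted there,
  \<open>corner e\<close> lets the two outer laws be exchanged for \<open>\<eta>\<close>, and the
  resulting product collapses to \<open>\<rho>\<close>. The measure \<open>\<rho>\<close> will be
  \<open>\<eta>\<close>, \<open>\<nu>\<close> or any cluster point.\<close>

theorem decomposition:
  assumes \<rho>: "\<rho> \<in> borel_probs" "\<eta> \<^bold>* \<rho> = \<rho>" "\<rho> \<^bold>* \<eta> = \<rho>"
  shows "\<rho> = left_law \<eta> e \<^bold>* (dirac e \<^bold>* \<rho> \<^bold>* dirac e) \<^bold>* right_law \<eta> e"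
proof -
  let ?D = "dirac e \<^bold>* \<rho> \<^bold>* dirac e"
  have D: "?D \<in> borel_probs" by (intro conv_borel_probs prob_space_return_borel \<rho>)
  have DD: "?D = corner e \<^bold>* ?D \<^bold>* corner e"
    by (simp only: corner_conv_absorb[OF \<rho>])
  have "left_law \<eta> e \<^bold>* ?D \<^bold>* right_law \<eta> e = (left_law \<eta> e \<^bold>* corner e) \<^bold>* ?D \<^bold>* (corner e \<^bold>* right_law \<eta> e)"
    by (subst DD) (simp only: conv_assoc left_law_prob right_law_prob corner_prob D conv_borel_probs)
  also have "\<dots> = \<eta> \<^bold>* (corner e \<^bold>* ?D \<^bold>* corner e) \<^bold>* \<eta>"
    unfolding left_law_conv_corner corner_conv_right_law
    by (simp only: conv_assoc prob corner_prob D conv_borel_probs)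
  also have "\<dots> = \<eta> \<^bold>* ?D \<^bold>* \<eta>" by (simp only: DD[symmetric])
  also have "\<dots> = \<eta> \<^bold>* (dirac e \<^bold>* (\<rho> \<^bold>* (dirac e \<^bold>* \<eta>)))" by (simp add: conv_simps prob \<rho>)
  also have "\<dots> = \<rho>" by (simp add: conv_dirac_absorb \<rho>)
  finally show ?thesis by simp
qed

end

section \<open>Cluster points of convolution powers\<close>

text \<open>The indices need only satisfy \<open>k i \<ge> i\<close>, not be monotone: iterating
  \<open>k\<close> and successor selects a strictly increasing subsequence. This suits exponents
  that arise as sums and differences.\<close>

lemma cluster_pointI:
  fixes k :: "nat \<Rightarrow> nat"
  assumes k: "\<And>i. k i \<ge> i" and lim: "limitin X (s \<circ> k) l sequentially"
  shows "l \<in> cluster_points X s"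
proof -
  define r where "r = rec_nat 0 (\<lambda>_ n. Suc (k n))"
  have r: "r (Suc i) = Suc (k (r i))" for i by (simp add: r_def)
  have "strict_mono r" unfolding strict_mono_Suc_iff r using k by (simp add: less_Suc_eq_le)
  then have "limitin X (s \<circ> (k \<circ> r)) l sequentially"
    using limitin_subsequence[OF _ lim] by (simp add: o_assoc)
  moreover have "k (r i) < k (r (Suc i))" for i
    using k[of "r (Suc i)"] by (simp add: r)
  then have "strict_mono (k \<circ> r)" by (simp add: strict_mono_Suc_iff)
  ultimately show ?thesis unfolding cluster_points_def by blast
qed

lemma weak_limit_const:
  fixes c :: "'a::{metric_space, second_countable_topology} measure"
  assumes "limitin weak_topology (\<lambda>_ :: nat. c) l sequentially" "c \<in> borel_probs"
  shows "l = c"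
  by (rule limitin_weak_unique[OF assms(1) _ sequentially_bot]) (simp add: topspace_weak_topology assms(2))

lemma limitin_dirac:
  fixes a :: "nat \<Rightarrow> 'a::metric_space"
  assumes "a \<longlonglongrightarrow> x"
  shows "limitin weak_topology (\<lambda>n. dirac (a n)) (dirac x) sequentially"
  unfolding limitin_weak_topology
proof (intro conjI allI impI prob_space_return_borel always_eventually)
  fix f :: "'a \<Rightarrow> real" assume f: "bounded_continuous f"
  then have "(\<lambda>n. f (a n)) \<longlonglongrightarrow> f x"
    using assms by (auto simp: continuous_on_sequentially o_def)
  then show "(\<lambda>n. \<integral>y. f y \<partial>dirac (a n)) \<longlonglongrightarrow> (\<integral>y. f y \<partial>dirac x)"
    using f by (simp add: integral_return borel_measurable_continuous_onI)
qed

lemma supp_limit_subset: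
  fixes \<rho> :: "'a::polish_space measure"
  assumes lim: "limitin weak_topology s \<rho> sequentially" and P: "\<And>n. s n \<in> borel_probs"
    and A: "closed A" "\<And>n. supp (s n) \<subseteq> A"
  shows "supp \<rho> \<subseteq> A"
proof -
  have \<rho>: "\<rho> \<in> borel_probs" using lim by (simp add: limitin_weak_topology)
  interpret prob_space \<rho> using borel_probsD[OF \<rho>] by simp
  have "1 \<le> measure (s n) A" for n
  proof -
    interpret s: prob_space "s n" using borel_probsD[OF P] by simp
    have "AE x in s n. x \<in> A" using AE_supp[OF P] by eventually_elim (use A in blast)
    then show ?thesis using s.AE_in_set_eq_1[of A] A borel_probsD(1)[OF P] by auto
  qed
  then have "1 \<le> measure \<rho> A"
    using lim by (intro measure_closed_ge_of_integrals[OF \<rho> P _ A(1)]) (auto simp: limitin_weak_topology)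
  then have "prob A = 1" by (rule antisym[OF prob_le_1])
  then have "AE x in \<rho>. x \<in> A" using A borel_probsD(1)[OF \<rho>] by (subst (asm) AE_in_set_eq_1[symmetric]) auto
  then show ?thesis by (rule supp_subset_closed[OF \<rho> A(1)])
qed

locale tight_powers =
  fixes \<mu> :: "'a::{polish_space, topological_semigroup_mult} measure"
  assumes prob: "\<mu> \<in> borel_probs" and tight: "tight_measures {conv_power \<mu> n | n. n \<ge> 1}"
begin

text \<open>The exponents are shifted by one because the power with exponent 0 is unspecified.\<close>

definition pw :: "nat \<Rightarrow> 'a measure" where
  "pw n = conv_power \<mu> (Suc n)"

lemma pw_0: "pw 0 = \<mu>" and pw_Suc: "pw (Suc n) = pw n \<^bold>* \<mu>"
  by (simp_all add: pw_def)

lemma pw_prob: "pw n \<in> borel_probs"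
  by (induction n) (simp_all add: pw_0 pw_Suc prob conv_borel_probs)

lemma pw_add: "pw m \<^bold>* pw n = pw (Suc (m + n))"
proof (induction n)
  case (Suc n)
  have "pw m \<^bold>* pw (Suc n) = pw m \<^bold>* pw n \<^bold>* \<mu>" by (simp add: pw_Suc conv_assoc pw_prob prob)
  then show ?case using Suc by (simp add: pw_Suc)
qed (simp add: pw_0 pw_Suc)

lemma range_pw: "range pw = {conv_power \<mu> n | n. n \<ge> 1}"
proof (intro equalityI subsetI)
  fix x assume "x \<in> {conv_power \<mu> n | n. n \<ge> 1}"
  then obtain n where "n \<ge> 1" "x = conv_power \<mu> n" by blast
  then show "x \<in> range pw" by (intro image_eqI[of _ _ "n - 1"]) (auto simp: pw_def)
qed (auto simp: pw_def)

lemma tight_pw: "tight_measures (range pw)" and range_pw_prob: "range pw \<subseteq> borel_probs"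
  using tight pw_prob by (simp_all only: range_pw[symmetric]) blast

text \<open>One tight family that contains the powers as well as their cluster points, so that joint
  continuity of convolution applies to mixed products of both.\<close>

definition limits :: "'a measure set" where
  "limits = {\<rho>. \<exists>s. range s \<subseteq> range pw \<and> limitin weak_topology s \<rho> sequentially}"

abbreviation "\<K> \<equiv> conv_clusters \<mu>"

lemma clusters_eq: "\<K> = cluster_points weak_topology pw"
  by (simp add: conv_clusters_def pw_def[abs_def])

lemma tight_limits: "tight_measures limits"
  unfolding limits_def by (rule tight_measures_sequential_closure[OF tight_pw range_pw_prob])

lemma limits_prob: "limits \<subseteq> borel_probs"
  by (auto simp: limits_def limitin_weak_topology)

lemma pw_limits: "pw n \<in> limits"
  unfolding limits_def using pw_prob[of n]
  by (intro CollectI exI[of _ "\<lambda>_. pw n"]) (auto simp: topspace_weak_topology)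

lemma cluster_sequence:
  assumes "\<rho> \<in> \<K>"
  obtains r where "strict_mono r" "limitin weak_topology (\<lambda>i. pw (r i)) \<rho> sequentially"
  using assms unfolding clusters_eq cluster_points_def by (auto simp: o_def)

lemma clusters_limits: "\<K> \<subseteq> limits"
proof
  fix \<rho> assume "\<rho> \<in> \<K>"
  then obtain r where "limitin weak_topology (\<lambda>i. pw (r i)) \<rho> sequentially" by (rule cluster_sequence)
  moreover have "range (\<lambda>i. pw (r i)) \<subseteq> range pw" by auto
  ultimately show "\<rho> \<in> limits" unfolding limits_def by blast
qed

lemma cluster_prob: "\<rho> \<in> \<K> \<Longrightarrow> \<rho> \<in> borel_probs"
  using clusters_limits limits_prob by blast

lemma seq_compact_clusters: "weak_seq_compact \<K>"
  unfolding clusters_eq by (rule weak_seq_compact_cluster_points[OF tight_pw range_pw_prob])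

lemma clusters_convergent_subsequence:
  fixes s :: "nat \<Rightarrow> 'a measure"
  assumes "\<And>n. s n \<in> \<K>"
  obtains r \<rho> where "strict_mono (r :: nat \<Rightarrow> nat)" "\<rho> \<in> \<K>" "limitin weak_topology (s \<circ> r) \<rho> sequentially"
proof -
  have "range s \<subseteq> \<K>" using assms by auto
  then have "\<exists>r \<rho>. strict_mono r \<and> \<rho> \<in> \<K> \<and> limitin weak_topology (s \<circ> r) \<rho> sequentially"
    using seq_compact_clusters unfolding weak_seq_compact_def by simp
  then show ?thesis using that by blast
qed

lemma limitin_conv_limits:
  assumes "\<And>n. s n \<in> limits" "\<And>n. t n \<in> limits" "\<beta> \<in> limits"
    "limitin weak_topology s \<alpha> sequentially" "limitin weak_topology t \<beta> sequentially"
  shows "limitin weak_topology (\<lambda>n. s n \<^bold>* t n) (\<alpha> \<^bold>* \<beta>) sequentially"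
  by (rule limitin_conv[OF tight_limits limits_prob]) (use assms in auto)

lemma clusters_nonempty: "\<K> \<noteq> {}"
proof -
  obtain r \<rho> where "strict_mono (r :: nat \<Rightarrow> nat)" "limitin weak_topology (pw \<circ> r) \<rho> sequentially"
    by (rule tight_convergent_subsequence[OF tight_pw range_pw_prob order_refl])
  then show ?thesis unfolding clusters_eq cluster_points_def by blast
qed

lemma conv_clusters_closed:
  assumes "\<rho> \<in> \<K>" "\<sigma> \<in> \<K>"
  shows "\<rho> \<^bold>* \<sigma> \<in> \<K>" and "\<rho> \<^bold>* \<sigma> = \<sigma> \<^bold>* \<rho>"
proof -
  obtain r where r: "strict_mono r" "limitin weak_topology (\<lambda>i. pw (r i)) \<rho> sequentially"
    using assms(1) by (rule cluster_sequence)
  obtain q where q: "strict_mono q" "limitin weak_topology (\<lambda>i. pw (q i)) \<sigma> sequentially"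
    using assms(2) by (rule cluster_sequence)
  have h: "\<rho> \<in> limits" "\<sigma> \<in> limits" using assms clusters_limits by auto
  have 1: "limitin weak_topology (\<lambda>i. pw (r i) \<^bold>* pw (q i)) (\<rho> \<^bold>* \<sigma>) sequentially"
    by (rule limitin_conv_limits[OF pw_limits pw_limits h(2) r(2) q(2)])
  have 2: "limitin weak_topology (\<lambda>i. pw (q i) \<^bold>* pw (r i)) (\<sigma> \<^bold>* \<rho>) sequentially"
    by (rule limitin_conv_limits[OF pw_limits pw_limits h(1) q(2) r(2)])
  show "\<rho> \<^bold>* \<sigma> = \<sigma> \<^bold>* \<rho>"
    by (rule limitin_weak_unique[OF 1 _ sequentially_bot]) (use 2 in \<open>simp add: pw_add add.commute\<close>)
  show "\<rho> \<^bold>* \<sigma> \<in> \<K>"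
    unfolding clusters_eq
  proof (rule cluster_pointI[where k="\<lambda>i. Suc (r i + q i)"])
    show "i \<le> Suc (r i + q i)" for i using strict_mono_imp_increasing[OF r(1), of i] by simp
    show "limitin weak_topology (pw \<circ> (\<lambda>i. Suc (r i + q i))) (\<rho> \<^bold>* \<sigma>) sequentially"
      using 1 by (simp add: pw_add o_def)
  qed
qed

lemma pw_conv_cluster:
  assumes "\<rho> \<in> \<K>"
  shows "pw n \<^bold>* \<rho> \<in> \<K>" and "pw n \<^bold>* \<rho> = \<rho> \<^bold>* pw n"
proof -
  obtain r where r: "strict_mono r" "limitin weak_topology (\<lambda>i. pw (r i)) \<rho> sequentially"
    using assms by (rule cluster_sequence)
  note l = limitin_conv_const[OF r(2) pw_prob[of n]]
  show "pw n \<^bold>* \<rho> = \<rho> \<^bold>* pw n"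
    by (rule limitin_weak_unique[OF l(2) _ sequentially_bot]) (use l(1) in \<open>simp add: pw_add add.commute\<close>)
  show "pw n \<^bold>* \<rho> \<in> \<K>"
    unfolding clusters_eq
  proof (rule cluster_pointI[where k="\<lambda>i. Suc (n + r i)"])
    show "i \<le> Suc (n + r i)" for i using strict_mono_imp_increasing[OF r(1), of i] by simp
    show "limitin weak_topology (pw \<circ> (\<lambda>i. Suc (n + r i))) (pw n \<^bold>* \<rho>) sequentially"
      using l(2) by (simp add: pw_add o_def)
  qed
qed

text \<open>If \<open>\<mu>\<close> to the power \<open>r i\<close> tends to \<open>\<rho>\<close> and \<open>\<mu>\<close> to the power \<open>q j\<close> tends to \<open>\<sigma>\<close>, then a
  quotient is a cluster point of the powers with exponents \<open>q j - r i\<close>, \<open>j\<close> much larger than \<open>i\<close>.\<close>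

lemma clusters_divide:
  assumes "\<rho> \<in> \<K>" "\<sigma> \<in> \<K>"
  obtains \<tau> where "\<tau> \<in> \<K>" "\<rho> \<^bold>* \<tau> = \<sigma>"
proof -
  obtain r where r: "strict_mono r" "limitin weak_topology (\<lambda>i. pw (r i)) \<rho> sequentially"
    using assms(1) by (rule cluster_sequence)
  obtain q where q: "strict_mono q" "limitin weak_topology (\<lambda>i. pw (q i)) \<sigma> sequentially"
    using assms(2) by (rule cluster_sequence)
  \<comment> \<open>This choice makes \<open>q (j i) \<ge> Suc (r i + i)\<close>, so the truncated
    subtraction defining \<open>k\<close> is exact and \<open>k i \<ge> i\<close>. Subtracting
    \<open>Suc (r i)\<close> instead of \<open>r i\<close> matches the shift of exponents in
    \<open>pw_add\<close>.\<close>
  define j where "j i = Suc (r i + i)" for i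
  have j: "strict_mono j" using r(1) by (auto simp: strict_mono_def j_def intro: add_strict_mono)
  define k where "k i = q (j i) - Suc (r i)" for i
  have kq: "q (j i) = Suc (r i + k i)" "k i \<ge> i" for i
    using strict_mono_imp_increasing[OF q(1), of "j i"] by (simp_all add: k_def j_def)
  have "range (\<lambda>i. pw (k i)) \<subseteq> range pw" by auto
  then obtain p \<tau> where p: "strict_mono (p :: nat \<Rightarrow> nat)" "limitin weak_topology ((\<lambda>i. pw (k i)) \<circ> p) \<tau> sequentially"
    by (rule tight_convergent_subsequence[OF tight_pw range_pw_prob])
  have \<tau>: "\<tau> \<in> \<K>"
    unfolding clusters_eq
  proof (rule cluster_pointI[where k="k \<circ> p"])
    show "i \<le> (k \<circ> p) i" for i
      using kq(2)[of "p i"] strict_mono_imp_increasing[OF p(1), of i] by simp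
  qed (use p(2) in \<open>simp add: o_def\<close>)
  have "limitin weak_topology (\<lambda>i. pw (r (p i)) \<^bold>* pw (k (p i))) (\<rho> \<^bold>* \<tau>) sequentially"
    using limitin_subsequence[OF p(1) r(2)] p(2) \<tau> clusters_limits
    by (intro limitin_conv_limits pw_limits) (auto simp: o_def)
  moreover have "limitin weak_topology (\<lambda>i. pw (q (j (p i)))) \<sigma> sequentially"
    using limitin_subsequence[OF strict_mono_o[OF j p(1)] q(2)] by (simp add: o_def)
  ultimately have "\<rho> \<^bold>* \<tau> = \<sigma>"
    by (intro limitin_weak_unique[OF _ _ sequentially_bot]) (simp_all add: pw_add kq(1))
  then show ?thesis using that \<tau> by blast
qed

text \<open>A unit for one cluster point is a unit for all, since by \<open>clusters_divide\<close>
  every other one is a multiple of it.\<close>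

lemma ex_identity: "\<exists>\<eta>\<in>\<K>. \<forall>\<rho>\<in>\<K>. \<eta> \<^bold>* \<rho> = \<rho>"
proof -
  obtain \<rho> where \<rho>: "\<rho> \<in> \<K>" using clusters_nonempty by blast
  obtain \<eta> where \<eta>: "\<eta> \<in> \<K>" "\<rho> \<^bold>* \<eta> = \<rho>" using clusters_divide[OF \<rho> \<rho>] .
  have "\<eta> \<^bold>* \<sigma> = \<sigma>" if \<sigma>: "\<sigma> \<in> \<K>" for \<sigma>
  proof -
    obtain \<tau> where \<tau>: "\<tau> \<in> \<K>" "\<rho> \<^bold>* \<tau> = \<sigma>" using clusters_divide[OF \<rho> \<sigma>] .
    have "\<eta> \<^bold>* \<sigma> = \<rho> \<^bold>* \<eta> \<^bold>* \<tau>"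
      using \<tau> conv_clusters_closed(2)[OF \<eta>(1) \<rho>] by (simp add: conv_assoc[symmetric] cluster_prob \<eta> \<rho> flip: \<tau>(2))
    then show ?thesis using \<eta> \<tau> by simp
  qed
  then show ?thesis using \<eta> by blast
qed

lemma clusters_comm_group:
  assumes \<eta>: "\<eta> \<in> \<K>" "\<forall>\<rho>\<in>\<K>. \<eta> \<^bold>* \<rho> = \<rho>"
  shows "comm_group (monoid_on (\<^bold>*) \<K> \<eta>)"
proof (rule comm_groupI)
  fix \<rho> assume "\<rho> \<in> carrier (monoid_on (\<^bold>*) \<K> \<eta>)"
  then have \<rho>: "\<rho> \<in> \<K>" by simp
  obtain \<tau> where \<tau>: "\<tau> \<in> \<K>" "\<rho> \<^bold>* \<tau> = \<eta>" using clusters_divide[OF \<rho> \<eta>(1)] .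
  then show "\<exists>\<tau>\<in>carrier (monoid_on (\<^bold>*) \<K> \<eta>). \<tau> \<otimes>\<^bsub>monoid_on (\<^bold>*) \<K> \<eta>\<^esub> \<rho> = \<one>\<^bsub>monoid_on (\<^bold>*) \<K> \<eta>\<^esub>"
    using conv_clusters_closed(2)[OF \<rho> \<tau>(1)] by auto
qed (use \<eta> in \<open>auto simp: conv_assoc cluster_prob intro: conv_clusters_closed\<close>)

lemma clusters_topspace: "topspace (subtopology weak_topology \<K>) = \<K>"
  using cluster_prob by (auto simp: topspace_weak_topology)

lemma clusters_compact_group:
  assumes \<eta>: "\<eta> \<in> \<K>" "\<forall>\<rho>\<in>\<K>. \<eta> \<^bold>* \<rho> = \<rho>"
  shows "compact_group (subtopology weak_topology \<K>) (monoid_on (\<^bold>*) \<K> \<eta>)"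
proof (rule compact_groupI)
  let ?X = "subtopology weak_topology \<K>"
  show "group (monoid_on (\<^bold>*) \<K> \<eta>)" using clusters_comm_group[OF \<eta>] by (simp add: comm_group_def)
  have "continuous_map (prod_topology ?X ?X) ?X (\<lambda>(x, y). x \<^bold>* y)"
  proof (rule continuous_map_sequentiallyI)
    show "metrizable_space (prod_topology ?X ?X)"
      using completely_metrizable_imp_metrizable_space[OF weak_seq_compact_topology(3)[OF seq_compact_clusters]]
      by (simp add: metrizable_space_prod_topology)
    show "(\<lambda>(x, y). x \<^bold>* y) \<in> topspace (prod_topology ?X ?X) \<rightarrow> topspace ?X"
      using conv_clusters_closed(1) unfolding topspace_prod_topology clusters_topspace by auto
    fix s and z assume s: "range s \<subseteq> topspace (prod_topology ?X ?X)" and l: "limitin (prod_topology ?X ?X) s z sequentially"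
    have sK: "fst (s n) \<in> \<K>" "snd (s n) \<in> \<K>" for n
      using subsetD[OF s rangeI, of n] by (auto simp: clusters_topspace)
    have l2: "limitin ?X (fst \<circ> s) (fst z) sequentially" "limitin ?X (snd \<circ> s) (snd z) sequentially"
      using l unfolding limitin_pairwise by auto
    then have z: "fst z \<in> \<K>" "snd z \<in> \<K>" and l3: "limitin weak_topology (fst \<circ> s) (fst z) sequentially" "limitin weak_topology (snd \<circ> s) (snd z) sequentially"
      by (auto simp: limitin_subtopology)
    have "limitin weak_topology (\<lambda>n. (fst \<circ> s) n \<^bold>* (snd \<circ> s) n) (fst z \<^bold>* snd z) sequentially"
      by (rule limitin_conv_limits[OF _ _ _ l3]) (use sK z clusters_limits in auto)
    then show "limitin ?X ((\<lambda>(x, y). x \<^bold>* y) \<circ> s) ((\<lambda>(x, y). x \<^bold>* y) z) sequentially"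
      using sK z conv_clusters_closed(1) by (simp add: limitin_subtopology o_def case_prod_beta)
  qed
  then show "continuous_map (prod_topology ?X ?X) ?X (\<lambda>(x, y). x \<otimes>\<^bsub>monoid_on (\<^bold>*) \<K> \<eta>\<^esub> y)" by simp
qed (use weak_seq_compact_topology[OF seq_compact_clusters] clusters_topspace in auto)

section \<open>Averages of convolution powers\<close>

text \<open>Shifted like \<open>pw\<close>: the mean runs over the \<open>n + 1\<close> powers
  \<open>pw 0\<close> to \<open>pw n\<close>, which avoids the degenerate mean over no
  powers.\<close>

definition avg :: "nat \<Rightarrow> 'a measure" where
  "avg n = cesaro_mean \<mu> (Suc n)"

text \<open>Drawing the exponent uniformly and then a point from the corresponding power realizes
  the mean as a \<open>bind\<close>. This shows that the prescribed set function is a measure and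
  gives the formula for integrals.\<close>

lemma avg_facts:
  shows avg_prob: "avg n \<in> borel_probs"
    and emeasure_avg: "B \<in> sets borel \<Longrightarrow> emeasure (avg n) B = (\<Sum>k\<le>n. emeasure (pw k) B) / of_nat (Suc n)"
    and integral_avg: "bounded_continuous f \<Longrightarrow> (\<integral>x. f x \<partial>avg n) = (\<Sum>k\<le>n. \<integral>x. f x \<partial>pw k) / real (Suc n)"
proof -
  let ?p = "measure_pmf (pmf_of_set {..n})"
  define N where "N = ?p \<bind> pw"
  have pwm: "pw \<in> measurable ?p (subprob_algebra borel)"
    using borel_probsD[OF pw_prob] by (auto simp: space_subprob_algebra prob_space_imp_subprob_space)
  have sN: "sets N = sets borel" unfolding N_def by (rule sets_bind) (use borel_probsD[OF pw_prob] in auto)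
  have eN: "emeasure N B = (\<Sum>k\<le>n. emeasure (pw k) B) / of_nat (Suc n)" if "B \<in> sets borel" for B
    unfolding N_def using that by (subst emeasure_bind[OF _ pwm]) (simp_all add: nn_integral_pmf_of_set)
  have sh: "(\<Sum>k=1..Suc n. emeasure (conv_power \<mu> k) B) = (\<Sum>k\<le>n. emeasure (pw k) B)" for B
    unfolding pw_def One_nat_def by (subst sum.atLeast_Suc_atMost_Suc_shift) (simp add: atMost_atLeast0)
  have "avg n = measure_of UNIV (sets borel) (emeasure N)"
    unfolding avg_def cesaro_mean_def
  proof (rule measure_of_eq)
    fix B :: "'a set" assume "B \<in> sigma_sets UNIV (sets borel)"
    then have B: "B \<in> sets borel" using sets.sigma_sets_eq[of "borel :: 'a measure"] by simp
    then show "(\<Sum>k=1..Suc n. emeasure (conv_power \<mu> k) B) / of_nat (Suc n) = emeasure N B"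
      by (simp only: sh eN[OF B])
  qed simp
  also have "\<dots> = N" using measure_of_of_measure[of N] sN sets_eq_imp_space_eq[OF sN] by simp
  finally have aN: "avg n = N" .
  then show e: "emeasure (avg n) B = (\<Sum>k\<le>n. emeasure (pw k) B) / of_nat (Suc n)" if "B \<in> sets borel" for B
    using eN that by simp
  have "prob_space (avg n)"
  proof (rule prob_spaceI)
    have "emeasure (pw k) UNIV = 1" for k
      using prob_space.emeasure_space_1[OF borel_probsD(3)[OF pw_prob]] borel_probsD(2)[OF pw_prob] by simp
    moreover have "(of_nat (Suc n) :: ennreal) / of_nat (Suc n) = 1"
      by (rule ennreal_divide_self) (simp_all add: of_nat_less_top del: of_nat_Suc)
    ultimately show "emeasure (avg n) (space (avg n)) = 1"
      using sets_eq_imp_space_eq[OF sN] e[of UNIV] by (simp add: aN del: of_nat_Suc)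
  qed
  then show "avg n \<in> borel_probs" using sN by (simp add: borel_probs_def aN)
  show "(\<integral>x. f x \<partial>avg n) = (\<Sum>k\<le>n. \<integral>x. f x \<partial>pw k) / real (Suc n)" if f: "bounded_continuous f" for f
  proof -
    obtain b where b: "\<And>x. \<bar>f x\<bar> \<le> b" using f unfolding bounded_iff by auto
    have "(\<integral>x. f x \<partial>N) = (\<integral>k. \<integral>x. f x \<partial>pw k \<partial>?p)"
      unfolding N_def
    proof (rule integral_bind[where B'=1 and B=b, OF _ _ pwm])
      show "f \<in> borel_measurable borel" using f by (simp add: borel_measurable_continuous_onI)
      show "AE k in ?p. emeasure (pw k) (space (pw k)) \<le> ennreal 1"
        using prob_space.emeasure_space_1[OF borel_probsD(3)[OF pw_prob]] by simp
    qed (use b measure_pmf.finite_measure_axioms in auto)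
    also have "\<dots> = (\<Sum>k\<le>n. \<integral>x. f x \<partial>pw k) / real (Suc n)" by (simp add: integral_pmf_of_set)
    finally show ?thesis by (simp add: aN)
  qed
qed

lemma tight_avg: "tight_measures (range avg)"
  unfolding tight_measures_def
proof (intro allI impI)
  fix \<epsilon> :: real assume \<epsilon>: "\<epsilon> > 0"
  then have "\<exists>C. compact C \<and> (\<forall>\<mu>\<in>range pw. measure \<mu> (UNIV - C) \<le> \<epsilon>)"
    using tight_pw unfolding tight_measures_def by simp
  then obtain C where C: "compact C" "\<And>k. measure (pw k) (UNIV - C) \<le> \<epsilon>" by auto
  have Cb: "UNIV - C \<in> sets borel" using borel_compact[OF C(1)] by auto
  have "measure (avg n) (UNIV - C) \<le> \<epsilon>" for n
  proof -
    have "emeasure (pw k) (UNIV - C) \<le> ennreal \<epsilon>" for k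
      using C(2)[of k] finite_measure.emeasure_eq_measure[OF prob_space.finite_measure[OF borel_probsD(3)[OF pw_prob]]]
      by (simp add: ennreal_leI)
    then have "(\<Sum>k\<le>n. emeasure (pw k) (UNIV - C)) \<le> (\<Sum>k\<le>n. ennreal \<epsilon>)" by (intro sum_mono)
    also have "\<dots> = ennreal \<epsilon> * of_nat (Suc n)" by (simp add: mult.commute)
    finally have "emeasure (avg n) (UNIV - C) \<le> ennreal \<epsilon> * of_nat (Suc n) / of_nat (Suc n)"
      unfolding emeasure_avg[OF Cb] by (rule divide_right_mono_ennreal)
    also have "\<dots> = ennreal \<epsilon>" by (rule ennreal_mult_divide_eq) (simp_all add: of_nat_less_top del: of_nat_Suc)
    finally show ?thesis using \<epsilon>
      by (simp add: finite_measure.emeasure_eq_measure[OF prob_space.finite_measure[OF borel_probsD(3)[OF avg_prob]]])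
  qed
  then show "\<exists>C. compact C \<and> (\<forall>\<mu>\<in>range avg. measure \<mu> (UNIV - C) \<le> \<epsilon>)" using C(1) by auto
qed

lemma integral_avg_conv:
  assumes \<alpha>: "\<alpha> \<in> borel_probs" and f: "bounded_continuous f"
  shows "(\<integral>x. f x \<partial>(avg n \<^bold>* \<alpha>)) = (\<Sum>k\<le>n. \<integral>x. f x \<partial>(pw k \<^bold>* \<alpha>)) / real (Suc n)"
    and "(\<integral>x. f x \<partial>(\<alpha> \<^bold>* avg n)) = (\<Sum>k\<le>n. \<integral>x. f x \<partial>(\<alpha> \<^bold>* pw k)) / real (Suc n)"
  unfolding integral_conv_bounded_continuous(1)[OF avg_prob \<alpha> f] integral_conv_bounded_continuous(1)[OF pw_prob \<alpha> f]
    integral_conv_bounded_continuous(2)[OF \<alpha> avg_prob f] integral_conv_bounded_continuous(2)[OF \<alpha> pw_prob f]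
  by (rule integral_avg[OF bounded_continuous_integral_mult(1)[OF \<alpha> f]])
    (rule integral_avg[OF bounded_continuous_integral_mult(2)[OF \<alpha> f]])

lemma avg_conv_const:
  assumes P: "\<alpha> \<in> borel_probs" "\<beta> \<in> borel_probs"
  shows "(\<And>k. pw k \<^bold>* \<alpha> = \<beta>) \<Longrightarrow> avg n \<^bold>* \<alpha> = \<beta>" "(\<And>k. \<alpha> \<^bold>* pw k = \<beta>) \<Longrightarrow> \<alpha> \<^bold>* avg n = \<beta>"
  by (rule borel_probs_eqI; simp add: integral_avg_conv P conv_borel_probs avg_prob)+

lemma integral_avg_shift:
  assumes f: "bounded_continuous f"
  shows "(\<integral>x. f x \<partial>(avg n \<^bold>* \<mu>)) - (\<integral>x. f x \<partial>avg n) = ((\<integral>x. f x \<partial>pw (Suc n)) - (\<integral>x. f x \<partial>pw 0)) / real (Suc n)"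
    and "(\<integral>x. f x \<partial>(\<mu> \<^bold>* avg n)) - (\<integral>x. f x \<partial>avg n) = ((\<integral>x. f x \<partial>pw (Suc n)) - (\<integral>x. f x \<partial>pw 0)) / real (Suc n)"
proof -
  have comm: "\<mu> \<^bold>* pw k = pw (Suc k)" for k using pw_add[of 0 k] by (simp add: pw_0)
  have "(\<Sum>k\<le>n. \<integral>x. f x \<partial>pw (Suc k)) - (\<Sum>k\<le>n. \<integral>x. f x \<partial>pw k) = (\<integral>x. f x \<partial>pw (Suc n)) - (\<integral>x. f x \<partial>pw 0)"
    by (induction n) simp_all
  then show "(\<integral>x. f x \<partial>(avg n \<^bold>* \<mu>)) - (\<integral>x. f x \<partial>avg n) = ((\<integral>x. f x \<partial>pw (Suc n)) - (\<integral>x. f x \<partial>pw 0)) / real (Suc n)"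
    "(\<integral>x. f x \<partial>(\<mu> \<^bold>* avg n)) - (\<integral>x. f x \<partial>avg n) = ((\<integral>x. f x \<partial>pw (Suc n)) - (\<integral>x. f x \<partial>pw 0)) / real (Suc n)"
    unfolding integral_avg_conv[OF prob f] integral_avg[OF f] comm pw_Suc[symmetric] diff_divide_distrib[symmetric] by simp_all
qed

text \<open>Convolving the average with \<open>\<mu>\<close> shifts the sum by one place; the
  difference telescopes to two bounded boundary terms divided by \<open>n + 1\<close>. Hence every
  sublimit is fixed by \<open>\<mu>\<close>, and then by all its powers.\<close>

lemma avg_limit_invariant:
  assumes r: "strict_mono r" and lim: "limitin weak_topology (avg \<circ> r) \<nu> sequentially"
  shows "pw k \<^bold>* \<nu> = \<nu>" "\<nu> \<^bold>* pw k = \<nu>"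
proof -
  have \<nu>: "\<nu> \<in> borel_probs" using lim by (simp add: limitin_weak_topology)
  have z: "(\<lambda>n. ((\<integral>x. f x \<partial>pw (Suc n)) - (\<integral>x. f x \<partial>pw 0)) / real (Suc n)) \<longlonglongrightarrow> 0" if f: "bounded_continuous f" for f
  proof -
    obtain b where b: "\<And>x. \<bar>f x\<bar> \<le> b" using f unfolding bounded_iff by auto
    have le: "\<bar>\<integral>x. f x \<partial>pw n\<bar> \<le> b" for n
      using f b by (intro abs_integral_le_borel_probs[OF pw_prob]) (auto intro: borel_measurable_continuous_onI)
    have "(\<lambda>n. 2 * b * inverse (real (Suc n))) \<longlonglongrightarrow> 2 * b * 0" by (intro tendsto_mult tendsto_const LIMSEQ_inverse_real_of_nat)
    then have l: "(\<lambda>n. 2 * b * inverse (real (Suc n))) \<longlonglongrightarrow> 0" by simp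
    show ?thesis
    proof (rule tendsto_rabs_zero_cancel, rule tendsto_sandwich[OF _ _ tendsto_const l])
      show "\<forall>\<^sub>F n in sequentially. \<bar>((\<integral>x. f x \<partial>pw (Suc n)) - (\<integral>x. f x \<partial>pw 0)) / real (Suc n)\<bar> \<le> 2 * b * inverse (real (Suc n))"
      proof (intro always_eventually allI)
        fix n
        have "\<bar>(\<integral>x. f x \<partial>pw (Suc n)) - (\<integral>x. f x \<partial>pw 0)\<bar> \<le> 2 * b" using le[of "Suc n"] le[of 0] by linarith
        then show "\<bar>((\<integral>x. f x \<partial>pw (Suc n)) - (\<integral>x. f x \<partial>pw 0)) / real (Suc n)\<bar> \<le> 2 * b * inverse (real (Suc n))"
          unfolding divide_inverse abs_mult by (intro mult_mono) auto
      qed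
    qed auto
  qed
  have lf: "(\<lambda>n. \<integral>x. f x \<partial>avg (r n)) \<longlonglongrightarrow> (\<integral>x. f x \<partial>\<nu>)" if "bounded_continuous f" for f
    using lim that by (auto simp: limitin_weak_topology)
  have c1: "limitin weak_topology (\<lambda>n. avg (r n) \<^bold>* \<mu>) \<nu> sequentially"
    unfolding limitin_weak_topology
  proof (intro conjI allI impI \<nu> always_eventually conv_borel_probs avg_prob prob)
    fix f :: "'a \<Rightarrow> real" assume f: "bounded_continuous f"
    have e: "(\<integral>x. f x \<partial>(avg n \<^bold>* \<mu>)) = (\<integral>x. f x \<partial>avg n) + ((\<integral>x. f x \<partial>pw (Suc n)) - (\<integral>x. f x \<partial>pw 0)) / real (Suc n)" for n
      using integral_avg_shift(1)[OF f, of n] by simp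
    show "(\<lambda>n. \<integral>x. f x \<partial>(avg (r n) \<^bold>* \<mu>)) \<longlonglongrightarrow> (\<integral>x. f x \<partial>\<nu>)"
      unfolding e using tendsto_add[OF lf[OF f] LIMSEQ_subseq_LIMSEQ[OF z[OF f] r]] by (simp add: o_def)
  qed
  have c2: "limitin weak_topology (\<lambda>n. \<mu> \<^bold>* avg (r n)) \<nu> sequentially"
    unfolding limitin_weak_topology
  proof (intro conjI allI impI \<nu> always_eventually conv_borel_probs avg_prob prob)
    fix f :: "'a \<Rightarrow> real" assume f: "bounded_continuous f"
    have e: "(\<integral>x. f x \<partial>(\<mu> \<^bold>* avg n)) = (\<integral>x. f x \<partial>avg n) + ((\<integral>x. f x \<partial>pw (Suc n)) - (\<integral>x. f x \<partial>pw 0)) / real (Suc n)" for n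
      using integral_avg_shift(2)[OF f, of n] by simp
    show "(\<lambda>n. \<integral>x. f x \<partial>(\<mu> \<^bold>* avg (r n))) \<longlonglongrightarrow> (\<integral>x. f x \<partial>\<nu>)"
      unfolding e using tendsto_add[OF lf[OF f] LIMSEQ_subseq_LIMSEQ[OF z[OF f] r]] by (simp add: o_def)
  qed
  have inv: "\<nu> \<^bold>* \<mu> = \<nu>" "\<mu> \<^bold>* \<nu> = \<nu>"
    using limitin_weak_unique[OF limitin_conv_const(1)[OF lim prob] _ sequentially_bot]
      limitin_weak_unique[OF limitin_conv_const(2)[OF lim prob] _ sequentially_bot] c1 c2 by simp_all
  show "pw k \<^bold>* \<nu> = \<nu>" by (induction k) (simp_all add: pw_0 pw_Suc inv conv_assoc pw_prob prob \<nu>)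
  have "\<nu> \<^bold>* (pw k \<^bold>* \<mu>) = \<nu> \<^bold>* pw k \<^bold>* \<mu>" for k by (simp add: conv_assoc pw_prob prob \<nu>)
  then show "\<nu> \<^bold>* pw k = \<nu>" by (induction k) (simp_all add: pw_0 pw_Suc inv)
qed

lemma ex_avg_limit:
  obtains \<nu> where "limitin weak_topology avg \<nu> sequentially" "\<And>k. pw k \<^bold>* \<nu> = \<nu>" "\<And>k. \<nu> \<^bold>* pw k = \<nu>" "\<nu> \<^bold>* \<nu> = \<nu>"
proof -
  have aP: "range avg \<subseteq> borel_probs" using avg_prob by auto
  \<comment> \<open>The averages fix each sublimit on either side. In the product of
    \<open>\<nu>'\<close> and \<open>\<nu>\<close>, viewing the left factor as a limit of averages
    gives \<open>\<nu>\<close>, viewing the right factor so gives \<open>\<nu>'\<close>; hence any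
    two sublimits agree.\<close>
  have absorb: "\<nu>' \<^bold>* \<nu> = \<nu>" "\<nu>' \<^bold>* \<nu> = \<nu>'"
    if r: "strict_mono r" "limitin weak_topology (avg \<circ> r) \<nu> sequentially"
      and q: "strict_mono q" "limitin weak_topology (avg \<circ> q) \<nu>' sequentially" for r q :: "nat \<Rightarrow> nat" and \<nu> \<nu>'
  proof -
    have P: "\<nu> \<in> borel_probs" "\<nu>' \<in> borel_probs" using r q by (auto simp: limitin_weak_topology)
    have "avg n \<^bold>* \<nu> = \<nu>" for n by (rule avg_conv_const(1)[OF P(1) P(1) avg_limit_invariant(1)[OF r]])
    then show "\<nu>' \<^bold>* \<nu> = \<nu>"
      using limitin_conv_const(1)[OF q(2) P(1)] by (intro weak_limit_const P) (simp add: o_def)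
    have "\<nu>' \<^bold>* avg n = \<nu>'" for n by (rule avg_conv_const(2)[OF P(2) P(2) avg_limit_invariant(2)[OF q]])
    then show "\<nu>' \<^bold>* \<nu> = \<nu>'"
      using limitin_conv_const(2)[OF r(2) P(2)] by (intro weak_limit_const P) (simp add: o_def)
  qed
  obtain r \<nu> where r: "strict_mono (r :: nat \<Rightarrow> nat)" "limitin weak_topology (avg \<circ> r) \<nu> sequentially"
    by (rule tight_convergent_subsequence[OF tight_avg aP order_refl])
  have "limitin weak_topology avg \<nu> sequentially"
  proof (rule limitin_subsubsequence)
    fix p :: "nat \<Rightarrow> nat" assume p: "strict_mono p"
    have "range (avg \<circ> p) \<subseteq> range avg" by auto
    then obtain q \<nu>' where q: "strict_mono (q :: nat \<Rightarrow> nat)" "limitin weak_topology (avg \<circ> p \<circ> q) \<nu>' sequentially"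
      by (rule tight_convergent_subsequence[OF tight_avg aP])
    have "\<nu>' = \<nu>" using absorb[OF r strict_mono_o[OF p q(1)], of \<nu>'] q(2) by (simp add: o_assoc)
    then show "\<exists>q. strict_mono q \<and> limitin weak_topology (avg \<circ> p \<circ> q) \<nu> sequentially" using q by blast
  qed
  then show ?thesis
    by (rule that) (use avg_limit_invariant[OF r] absorb(1)[OF r r] in auto)
qed

end

section \<open>The support of the limit of the averages\<close>

context tight_powers
begin

abbreviation "S \<equiv> support_semigroup \<mu>"

lemma closed_S: "closed S"
  by (simp add: support_semigroup_def)

lemma closed_mult_vimage:
  fixes A :: "'a set"
  assumes "closed A"
  shows "closed {x. x * y \<in> A}" "closed {x. y * x \<in> A}"
proof -
  have "closed ((\<lambda>x. x * y) -` A)" "closed ((\<lambda>x. y * x) -` A)"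
    by (intro closed_vimage assms continuous_intros)+
  then show "closed {x. x * y \<in> A}" "closed {x. y * x \<in> A}" by (simp_all add: vimage_def)
qed

lemma supp_pw_subset: "supp (pw n) \<subseteq> S"
proof -
  let ?P = "\<lambda>n. semigroup_power (*) (supp \<mu>) (Suc n)"
  have "supp (pw n) \<subseteq> closure (?P n)"
  proof (induction n)
    case 0
    then show ?case using closure_subset by (simp add: pw_0)
  next
    case (Suc n)
    show ?case
      unfolding pw_Suc
    proof (rule supp_conv_subset[OF pw_prob prob closed_closure])
      fix x y assume x: "x \<in> supp (pw n)" and y: "y \<in> supp \<mu>"
      have "?P n \<subseteq> {x. x * y \<in> closure (?P (Suc n))}"
        using y closure_subset[of "?P (Suc n)"] set_times_intro[of _ "?P n" y "supp \<mu>"] by auto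
      then have "closure (?P n) \<subseteq> {x. x * y \<in> closure (?P (Suc n))}"
        by (rule closure_minimal[OF _ closed_mult_vimage(1)[OF closed_closure]])
      then show "x * y \<in> closure (?P (Suc n))" using x Suc by blast
    qed
  qed
  also have "\<dots> \<subseteq> S" unfolding support_semigroup_def by (intro closure_mono) auto
  finally show ?thesis .
qed

lemma supp_cluster_subset: "\<rho> \<in> \<K> \<Longrightarrow> supp \<rho> \<subseteq> S"
  by (erule cluster_sequence, erule supp_limit_subset) (use supp_pw_subset pw_prob closed_S in auto)

lemma supp_avg_subset: "supp (avg n) \<subseteq> (\<Union>k\<le>n. supp (pw k))"
proof -
  let ?A = "\<Union>k\<le>n. supp (pw k)"
  have A: "closed ?A" by (intro closed_UN closed_supp ballI) auto
  then have Ab: "?A \<in> sets borel" by simp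
  interpret prob_space "avg n" using borel_probsD[OF avg_prob] by simp
  have "emeasure (pw k) ?A = 1" if "k \<le> n" for k
  proof (rule antisym)
    interpret k: prob_space "pw k" using borel_probsD[OF pw_prob] by simp
    show "emeasure (pw k) ?A \<le> 1" by (rule k.measure_le_1)
    have "emeasure (pw k) (supp (pw k)) \<le> emeasure (pw k) ?A"
      using that Ab borel_probsD(1)[OF pw_prob] by (intro emeasure_mono) auto
    then show "1 \<le> emeasure (pw k) ?A" by (simp add: emeasure_supp[OF pw_prob])
  qed
  moreover have "(of_nat (Suc n) :: ennreal) / of_nat (Suc n) = 1"
    by (rule ennreal_divide_self) (simp_all add: of_nat_less_top del: of_nat_Suc)
  ultimately have "emeasure (avg n) ?A = 1" by (simp add: emeasure_avg[OF Ab] del: of_nat_Suc)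
  then have "AE x in avg n. x \<in> ?A"
    using Ab AE_in_set_eq_1[of ?A] borel_probsD(1)[OF avg_prob] by (simp add: emeasure_eq_measure)
  then show ?thesis by (rule supp_subset_closed[OF avg_prob A])
qed

end

locale tight_powers_limit = tight_powers +
  fixes \<nu> \<eta>
  assumes avg_lim: "limitin weak_topology avg \<nu> sequentially"
    and pw_nu: "\<And>k. pw k \<^bold>* \<nu> = \<nu>" "\<And>k. \<nu> \<^bold>* pw k = \<nu>" and nu_idem: "\<nu> \<^bold>* \<nu> = \<nu>"
    and eta: "\<eta> \<in> \<K>" and eta_unit: "\<forall>\<rho>\<in>\<K>. \<eta> \<^bold>* \<rho> = \<rho>"
begin

lemma nu_prob: "\<nu> \<in> borel_probs"
  using avg_lim by (simp add: limitin_weak_topology)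

lemma eta_prob: "\<eta> \<in> borel_probs"
  by (rule cluster_prob[OF eta])

lemma unit: "\<rho> \<in> \<K> \<Longrightarrow> \<eta> \<^bold>* \<rho> = \<rho>" "\<rho> \<in> \<K> \<Longrightarrow> \<rho> \<^bold>* \<eta> = \<rho>"
  using eta_unit conv_clusters_closed(2)[OF eta] by auto

lemma cluster_nu:
  assumes "\<rho> \<in> \<K>"
  shows "\<rho> \<^bold>* \<nu> = \<nu>" "\<nu> \<^bold>* \<rho> = \<nu>"
proof -
  obtain r where r: "strict_mono r" "limitin weak_topology (\<lambda>i. pw (r i)) \<rho> sequentially"
    using assms by (rule cluster_sequence)
  show "\<rho> \<^bold>* \<nu> = \<nu>" "\<nu> \<^bold>* \<rho> = \<nu>"
    using limitin_conv_const[OF r(2) nu_prob] by (auto intro!: weak_limit_const nu_prob simp: pw_nu)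
qed

text \<open>Points of \<open>supp \<mu>\<close> preserve \<open>supp \<nu>\<close> because
  \<open>\<nu>\<close> absorbs \<open>\<mu>\<close> on both sides; words follow by induction, and
  limits of words because the support is closed.\<close>

lemma S_mult_supp_nu:
  assumes "x \<in> S" "y \<in> supp \<nu>"
  shows "x * y \<in> supp \<nu>" "y * x \<in> supp \<nu>"
proof -
  have 1: "x * y \<in> supp \<nu>" "y * x \<in> supp \<nu>" if "x \<in> supp \<mu>" "y \<in> supp \<nu>" for x y
    using supp_mult[OF prob nu_prob that] supp_mult[OF nu_prob prob that(2,1)] pw_nu[of 0] by (simp_all add: pw_0)
  have p: "x * y \<in> supp \<nu> \<and> y * x \<in> supp \<nu>" if "x \<in> semigroup_power (*) (supp \<mu>) (Suc n)" "y \<in> supp \<nu>" for n x y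
    using that
  proof (induction n arbitrary: x y)
    case 0 then show ?case using 1 by simp
  next
    case (Suc n)
    from Suc.prems(1) have "x \<in> semigroup_power (*) (supp \<mu>) (Suc n) * supp \<mu>" by simp
    then obtain u v where uv: "x = u * v" "u \<in> semigroup_power (*) (supp \<mu>) (Suc n)" "v \<in> supp \<mu>"
      by (rule set_times_elim)
    have "u * (v * y) \<in> supp \<nu>" "y * u * v \<in> supp \<nu>" using Suc.IH[OF uv(2)] 1 uv(3) Suc.prems(2) by blast+
    then show ?case using uv(1) by (simp add: mult.assoc)
  qed
  have "(\<Union>n\<in>{1..}. semigroup_power (*) (supp \<mu>) n) \<subseteq> {x. x * y \<in> supp \<nu>} \<inter> {x. y * x \<in> supp \<nu>}"
  proof
    fix x assume "x \<in> (\<Union>n\<in>{1..}. semigroup_power (*) (supp \<mu>) n)"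
    then obtain n where "n \<ge> 1" "x \<in> semigroup_power (*) (supp \<mu>) n" by auto
    then show "x \<in> {x. x * y \<in> supp \<nu>} \<inter> {x. y * x \<in> supp \<nu>}" using p[of x "n - 1" y] assms(2) by simp
  qed
  then have "S \<subseteq> {x. x * y \<in> supp \<nu>} \<inter> {x. y * x \<in> supp \<nu>}"
    unfolding support_semigroup_def
    by (rule closure_minimal) (intro closed_Int closed_mult_vimage closed_supp)
  then show "x * y \<in> supp \<nu>" "y * x \<in> supp \<nu>" using assms(1) by auto
qed

lemma supp_nu_subset_S: "supp \<nu> \<subseteq> S"
proof (rule supp_limit_subset[OF avg_lim avg_prob closed_S])
  show "supp (avg n) \<subseteq> S" for n using supp_avg_subset supp_pw_subset by blast
qed

lemma emeasure_nu_S: "emeasure \<nu> S = 1"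
proof -
  interpret prob_space \<nu> using borel_probsD[OF nu_prob] by simp
  have "AE x in \<nu>. x \<in> S" using AE_supp[OF nu_prob] by eventually_elim (use supp_nu_subset_S in blast)
  then show ?thesis using AE_in_set_eq_1[of S] closed_S borel_probsD(1)[OF nu_prob] by (simp add: emeasure_eq_measure)
qed

lemma avg_conv_eta: "limitin weak_topology (\<lambda>n. avg n \<^bold>* \<eta>) \<nu> sequentially"
  using limitin_conv_const(1)[OF avg_lim eta_prob] by (simp add: cluster_nu[OF eta])

text \<open>The averages of \<open>\<integral>f \<partial>(pw k \<^bold>* \<eta>)\<close> with \<open>f x\<close> the truncated distance of \<open>x\<close> to \<open>supp \<nu>\<close> tend to
  \<open>\<integral>f \<partial>\<nu> = 0\<close>, so \<open>\<integral>f \<partial>\<lambda> = 0\<close> for some cluster point \<open>\<lambda>\<close>.\<close>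

lemma ex_cluster_in_supp_nu: "\<exists>\<rho>\<in>\<K>. supp \<rho> \<subseteq> supp \<nu>"
proof -
  let ?J = "supp \<nu>"
  define f where "f x = min 1 (infdist x ?J)" for x
  have f01: "0 \<le> f x" "f x \<le> 1" for x by (auto simp: f_def infdist_nonneg)
  have f: "bounded_continuous f"
  proof
    show "continuous_on UNIV f" unfolding f_def by (intro continuous_intros)
    show "bounded (range f)" using f01 by (intro boundedI[of _ 1]) auto
  qed
  have J: "?J \<noteq> {}" by (rule supp_nonempty[OF nu_prob])
  have f0: "f x = 0 \<longleftrightarrow> x \<in> ?J" for x
    using in_closed_iff_infdist_zero[OF closed_supp J, of x] infdist_nonneg[of x ?J] by (auto simp: f_def min_def)
  have "AE x in \<nu>. f x = 0" using AE_supp[OF nu_prob] by eventually_elim (simp add: f0)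
  then have nu0: "(\<integral>x. f x \<partial>\<nu>) = 0" by (rule integral_eq_zero_AE)
  have lim0: "(\<lambda>n. \<integral>x. f x \<partial>(avg n \<^bold>* \<eta>)) \<longlonglongrightarrow> 0"
  proof -
    have "(\<lambda>n. \<integral>x. f x \<partial>(avg n \<^bold>* \<eta>)) \<longlonglongrightarrow> (\<integral>x. f x \<partial>\<nu>)"
      using avg_conv_eta f unfolding limitin_weak_topology by blast
    then show ?thesis by (simp only: nu0)
  qed
  have ex: "\<exists>k. (\<integral>x. f x \<partial>(pw k \<^bold>* \<eta>)) < \<epsilon>" if \<epsilon>: "\<epsilon> > 0" for \<epsilon>
  proof (rule ccontr)
    assume "\<not> (\<exists>k. (\<integral>x. f x \<partial>(pw k \<^bold>* \<eta>)) < \<epsilon>)"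
    then have ge: "\<epsilon> \<le> (\<integral>x. f x \<partial>(pw k \<^bold>* \<eta>))" for k by (simp add: not_less)
    have "\<epsilon> \<le> (\<integral>x. f x \<partial>(avg n \<^bold>* \<eta>))" for n
    proof -
      have "(\<Sum>k\<le>n. \<epsilon>) \<le> (\<Sum>k\<le>n. \<integral>x. f x \<partial>(pw k \<^bold>* \<eta>))" by (intro sum_mono ge)
      then show ?thesis unfolding integral_avg_conv(1)[OF eta_prob f] by (simp add: field_simps)
    qed
    then have "\<epsilon> \<le> 0" by (intro LIMSEQ_le_const[OF lim0]) auto
    then show False using \<epsilon> by simp
  qed
  have "1 / real (Suc i) > 0" for i by simp
  then have "\<forall>i. \<exists>k. (\<integral>x. f x \<partial>(pw k \<^bold>* \<eta>)) < 1 / real (Suc i)" using ex by blast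
  then obtain k where k: "\<And>i. (\<integral>x. f x \<partial>(pw (k i) \<^bold>* \<eta>)) < 1 / real (Suc i)" by metis
  have kK: "pw (k i) \<^bold>* \<eta> \<in> \<K>" for i by (rule pw_conv_cluster(1)[OF eta])
  obtain r \<rho> where r: "strict_mono (r :: nat \<Rightarrow> nat)" "\<rho> \<in> \<K>" "limitin weak_topology ((\<lambda>i. pw (k i) \<^bold>* \<eta>) \<circ> r) \<rho> sequentially"
    by (rule clusters_convergent_subsequence[of "\<lambda>i. pw (k i) \<^bold>* \<eta>", OF kK])
  have "(\<lambda>i. 1 / real (Suc i)) \<longlonglongrightarrow> 0" using LIMSEQ_inverse_real_of_nat by (simp add: inverse_eq_divide)
  from LIMSEQ_subseq_LIMSEQ[OF this r(1)] have z: "(\<lambda>i. 1 / real (Suc (r i))) \<longlonglongrightarrow> 0" by (simp add: o_def)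
  have "(\<lambda>i. \<integral>x. f x \<partial>(pw (k (r i)) \<^bold>* \<eta>)) \<longlonglongrightarrow> 0"
    by (rule tendsto_sandwich[OF _ _ tendsto_const z])
      (use k f01 in \<open>auto intro!: always_eventually less_imp_le integral_nonneg\<close>)
  moreover have "(\<lambda>i. \<integral>x. f x \<partial>(pw (k (r i)) \<^bold>* \<eta>)) \<longlonglongrightarrow> (\<integral>x. f x \<partial>\<rho>)"
    using r(3) f by (auto simp: limitin_weak_topology)
  ultimately have "(\<integral>x. f x \<partial>\<rho>) = 0" using LIMSEQ_unique by blast
  then have "AE x in \<rho>. f x = 0"
    using integral_nonneg_eq_0_iff_AE[OF integrable_bounded_continuous[OF cluster_prob[OF r(2)] f]] f01 by simp
  then have "AE x in \<rho>. x \<in> ?J" by (simp add: f0)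
  from supp_subset_closed[OF cluster_prob[OF r(2)] closed_supp this] show ?thesis using r(2) by blast
qed

text \<open>One cluster point carried by the ideal \<open>supp \<nu>\<close> pulls in all others,
  because each is a multiple of it.\<close>

lemma supp_cluster_subset_nu:
  assumes \<rho>: "\<rho> \<in> \<K>"
  shows "supp \<rho> \<subseteq> supp \<nu>"
proof -
  obtain \<sigma> where \<sigma>: "\<sigma> \<in> \<K>" "supp \<sigma> \<subseteq> supp \<nu>" using ex_cluster_in_supp_nu by blast
  obtain \<tau> where \<tau>: "\<tau> \<in> \<K>" "\<sigma> \<^bold>* \<tau> = \<rho>" using clusters_divide[OF \<sigma>(1) \<rho>] .
  have "supp (\<sigma> \<^bold>* \<tau>) \<subseteq> supp \<nu>"
    using S_mult_supp_nu(2) \<sigma>(2) supp_cluster_subset[OF \<tau>(1)]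
    by (intro supp_conv_subset cluster_prob \<sigma> \<tau> closed_supp) blast
  then show ?thesis by (simp add: \<tau>)
qed

text \<open>The powers themselves need not be cluster points, so the averages are first convolved
  with \<open>\<eta>\<close>: the limit is still \<open>\<nu>\<close>, while each term becomes a
  mixture of the cluster points obtained from \<open>pw k\<close> and \<open>\<eta>\<close>.\<close>

lemma supp_nu: "supp \<nu> = closure (\<Union>\<rho>\<in>\<K>. supp \<rho>)"
proof
  let ?A = "closure (\<Union>\<rho>\<in>\<K>. supp \<rho>)"
  show "?A \<subseteq> supp \<nu>" using supp_cluster_subset_nu by (intro closure_minimal closed_supp) blast
  show "supp \<nu> \<subseteq> ?A"
  proof (rule supp_limit_subset[OF avg_conv_eta conv_borel_probs[OF avg_prob eta_prob] closed_closure])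
    show "supp (avg n \<^bold>* \<eta>) \<subseteq> ?A" for n
    proof (rule supp_conv_subset[OF avg_prob eta_prob closed_closure])
      fix x y assume "x \<in> supp (avg n)" "y \<in> supp \<eta>"
      then obtain k where "x \<in> supp (pw k)" "y \<in> supp \<eta>" using supp_avg_subset by blast
      then have "x * y \<in> supp (pw k \<^bold>* \<eta>)" by (intro supp_mult pw_prob eta_prob)
      then show "x * y \<in> ?A" using pw_conv_cluster(1)[OF eta, of k] closure_subset[of "\<Union>\<rho>\<in>\<K>. supp \<rho>"] by blast
    qed
  qed
qed

sublocale E: idempotent_measure \<eta>
  by unfold_locales (use eta_prob unit[OF eta] in auto)

sublocale N: idempotent_measure \<nu>
  by unfold_locales (use nu_prob nu_idem in auto)

text \<open>An ideal of \<open>S\<close> inside \<open>supp \<nu>\<close> is also an ideal of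
  \<open>supp \<nu>\<close>, which is simple.\<close>

lemma kernel: "semigroup_kernel S (supp \<nu>)"
  unfolding semigroup_kernel_def
proof (intro conjI allI impI)
  show "semigroup_ideal S (supp \<nu>)"
    unfolding semigroup_ideal_def
    using supp_nonempty[OF nu_prob] supp_nu_subset_S S_mult_supp_nu by (auto simp: set_times_def)
  fix I assume I: "semigroup_ideal S I \<and> I \<subseteq> supp \<nu>"
  then have "semigroup_ideal (supp \<nu>) I"
    unfolding semigroup_ideal_def using supp_nu_subset_S by (auto simp: set_times_def) blast+
  moreover obtain e where "e \<in> idempotents (supp \<nu>)" using N.ex_idempotent by blast
  then interpret idempotent_measure_at \<nu> e by unfold_locales
  have "simple_semigroup (supp \<nu>)" using completely_simple_supp by (simp add: completely_simple_def)
  ultimately show "I = supp \<nu>" by (simp add: simple_semigroup_def)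
qed

end

section \<open>Cluster points as cosets\<close>

text \<open>Serves to give the coset group its continuous operations by transport from the group of
  cluster points.\<close>

lemma topological_group_homeomorphic:
  assumes XG: "topological_group X G" and H: "group H" and Y: "topspace Y = carrier H"
    and F: "F \<in> iso G H" "homeomorphic_map X Y F"
  shows "topological_group Y H"
proof -
  interpret G: group G using XG by (simp add: topological_group_def)
  interpret H: group H by fact
  have X: "topspace X = carrier G" using XG by (simp add: topological_group_def)
  interpret group_hom G H F using F(1) by unfold_locales (simp add: iso_def)
  obtain g where g: "homeomorphic_maps X Y F g" using F(2) homeomorphic_map_maps by blast
  have cF: "continuous_map X Y F" and cg: "continuous_map Y X g"
    and Fg: "\<And>y. y \<in> carrier H \<Longrightarrow> F (g y) = y"
    using g X Y by (auto simp: homeomorphic_maps_def)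
  have gm: "g y \<in> carrier G" if "y \<in> carrier H" for y
    using cg that X Y by (auto simp: continuous_map_def)
  have "continuous_map (prod_topology Y Y) Y (F \<circ> (\<lambda>(x, y). x \<otimes>\<^bsub>G\<^esub> y) \<circ> (\<lambda>z. (g (fst z), g (snd z))))"
  proof (intro continuous_map_compose[OF _ cF] continuous_map_compose)
    show "continuous_map (prod_topology Y Y) (prod_topology X X) (\<lambda>z. (g (fst z), g (snd z)))"
      unfolding continuous_map_paired
      by (intro conjI continuous_map_compose[OF continuous_map_fst cg, unfolded o_def]
          continuous_map_compose[OF continuous_map_snd cg, unfolded o_def])
    show "continuous_map (prod_topology X X) X (\<lambda>(x, y). x \<otimes>\<^bsub>G\<^esub> y)" using XG by (simp add: topological_group_def)
  qed
  then have m: "continuous_map (prod_topology Y Y) Y (\<lambda>(x, y). x \<otimes>\<^bsub>H\<^esub> y)"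
    by (rule continuous_map_eq) (auto simp: Y gm Fg)
  have "continuous_map Y Y (F \<circ> (\<lambda>x. inv\<^bsub>G\<^esub> x) \<circ> g)"
    using XG by (intro continuous_map_compose[OF _ cF] continuous_map_compose[OF cg]) (simp add: topological_group_def)
  then have i: "continuous_map Y Y (\<lambda>y. inv\<^bsub>H\<^esub> y)"
    by (rule continuous_map_eq) (auto simp: Y gm Fg)
  show ?thesis using m i H Y by (simp add: topological_group_def)
qed

lemma topspace_quotient_topology: "topspace (quotient_topology X q) = q ` topspace X"
proof
  show "topspace (quotient_topology X q) \<subseteq> q ` topspace X"
    using openin_topspace[of "quotient_topology X q"] unfolding openin_quotient_topology by blast
  have "{x \<in> topspace X. q x \<in> q ` topspace X} = topspace X" by blast
  then have "openin (quotient_topology X q) (q ` topspace X)" by (simp add: openin_quotient_topology)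
  then show "q ` topspace X \<subseteq> topspace (quotient_topology X q)" by (rule openin_subset)
qed

locale tight_powers_at = tight_powers_limit +
  fixes e
  assumes e_idempotent: "e \<in> idempotents (supp \<eta>)"
begin

sublocale E: idempotent_measure_at \<eta> e
  by unfold_locales (rule e_idempotent)

lemma e_supp_nu: "e \<in> supp \<nu>"
  using E.e_mem supp_cluster_subset_nu[OF eta] by blast

sublocale N: idempotent_measure_at \<nu> e
  by unfold_locales (use e_supp_nu E.ee in \<open>simp add: idempotents_def\<close>)

abbreviation "H \<equiv> rees_G (supp \<eta>) e"
abbreviation "G \<equiv> rees_G (supp \<nu>) e"
abbreviation "GG \<equiv> monoid_on (*) G e"
abbreviation "lawL \<equiv> left_law \<eta> e"
abbreviation "lawR \<equiv> right_law \<eta> e"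

lemma H_subset_G: "H \<subseteq> G"
  using supp_cluster_subset_nu[OF eta] by (auto simp: E.rees_G_eq N.rees_G_eq)

text \<open>The left Rees coordinate of \<open>supp \<nu>\<close> maps \<open>t * j\<close> to the left coordinate of \<open>t \<in> supp \<eta>\<close>, and
  such products are dense in \<open>supp \<nu>\<close> because \<open>\<eta> \<^bold>* \<nu> = \<nu>\<close>.\<close>

lemma rees_L_nu: "rees_L (supp \<nu>) e = rees_L (supp \<eta>) e"
proof
  show "rees_L (supp \<eta>) e \<subseteq> rees_L (supp \<nu>) e"
    using supp_cluster_subset_nu[OF eta] by (auto simp: E.rees_L_eq N.rees_L_eq)
  have "closed (supp \<nu> \<inter> rees_left (supp \<nu>) e -` supp \<eta>)"
    by (rule continuous_closed_preimage[OF N.continuous_rees(1) closed_supp closed_supp])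
  moreover have "t * j \<in> supp \<nu> \<inter> rees_left (supp \<nu>) e -` supp \<eta>" if t: "t \<in> supp \<eta>" and j: "j \<in> supp \<nu>" for t j
  proof -
    have tj: "t * j \<in> supp \<nu>" using t j supp_cluster_subset_nu[OF eta] N.mult_closed by blast
    let ?l = "rees_left (supp \<eta>) e t"
    have l: "?l \<in> supp \<eta>" "?l * e = ?l" using E.rees_left_mem[OF t] by (auto simp: E.rees_L_eq)
    have "t * j * e = ?l * (e * t) * j * e" by (simp only: E.rees_left_sandwich[OF t])
    also have "\<dots> = ?l * (e * (t * j) * e)" by (simp only: mult.assoc)
    finally have tje: "t * j * e = ?l * (e * (t * j) * e)" .
    have "rees_left (supp \<nu>) e (t * j) = ?l * (e * (t * j) * e) * N.sinv (t * j)"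
      unfolding N.rees_left_eq tje ..
    also have "\<dots> = ?l * (e * (t * j) * e * N.sinv (t * j))" by (simp only: mult.assoc)
    also have "\<dots> = ?l" by (simp only: N.sinv_right[OF tj] l)
    finally show ?thesis using tj l by simp
  qed
  ultimately have "supp (\<eta> \<^bold>* \<nu>) \<subseteq> supp \<nu> \<inter> rees_left (supp \<nu>) e -` supp \<eta>"
    by (intro supp_conv_subset eta_prob nu_prob)
  then have sub: "rees_left (supp \<nu>) e z \<in> supp \<eta>" if "z \<in> supp \<nu>" for z
    using that cluster_nu(1)[OF eta] by auto
  show "rees_L (supp \<nu>) e \<subseteq> rees_L (supp \<eta>) e"
  proof
    fix l assume "l \<in> rees_L (supp \<nu>) e"
    then have l: "l \<in> supp \<nu>" "l * e = l" "e * l = e" by (auto simp: N.rees_L_eq)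
    have "N.sinv l = e" unfolding N.sinv_def using l N.e_mem_rees_G E.ee by (intro N.rees_inverse_eqI) (auto simp: E.ee)
    then have "rees_left (supp \<nu>) e l = l" using l by (simp add: N.rees_left_eq)
    then show "l \<in> rees_L (supp \<eta>) e" using sub[OF l(1)] l by (simp add: E.rees_L_eq)
  qed
qed

text \<open>Mirror image of the argument for the left coordinate; density of the products
  \<open>j * t\<close> now comes from absorption of \<open>\<eta>\<close> by \<open>\<nu>\<close> on
  the right.\<close>

lemma rees_R_nu: "rees_R (supp \<nu>) e = rees_R (supp \<eta>) e"
proof
  show "rees_R (supp \<eta>) e \<subseteq> rees_R (supp \<nu>) e"
    using supp_cluster_subset_nu[OF eta] by (auto simp: E.rees_R_eq N.rees_R_eq)
  have "closed (supp \<nu> \<inter> rees_right (supp \<nu>) e -` supp \<eta>)"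
    by (rule continuous_closed_preimage[OF N.continuous_rees(2) closed_supp closed_supp])
  moreover have "j * t \<in> supp \<nu> \<inter> rees_right (supp \<nu>) e -` supp \<eta>" if j: "j \<in> supp \<nu>" and t: "t \<in> supp \<eta>" for t j
  proof -
    have jt: "j * t \<in> supp \<nu>" using t j supp_cluster_subset_nu[OF eta] N.mult_closed by blast
    let ?r = "rees_right (supp \<eta>) e t"
    have r: "?r \<in> supp \<eta>" "e * ?r = ?r" using E.rees_right_mem[OF t] by (auto simp: E.rees_R_eq)
    have "rees_right (supp \<nu>) e (j * t) = N.sinv (j * t) * (e * (j * t))"
      by (simp only: N.rees_right_eq mult.assoc)
    also have "\<dots> = N.sinv (j * t) * (e * (j * (t * e * ?r)))" by (simp only: E.rees_right_sandwich[OF t])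
    also have "\<dots> = N.sinv (j * t) * (e * (j * t) * e) * ?r" by (simp only: mult.assoc)
    also have "\<dots> = ?r" by (simp only: N.sinv_left[OF jt] r)
    finally have "rees_right (supp \<nu>) e (j * t) = ?r" .
    then show ?thesis using jt r by simp
  qed
  ultimately have "supp (\<nu> \<^bold>* \<eta>) \<subseteq> supp \<nu> \<inter> rees_right (supp \<nu>) e -` supp \<eta>"
    by (intro supp_conv_subset eta_prob nu_prob)
  then have sub: "rees_right (supp \<nu>) e z \<in> supp \<eta>" if "z \<in> supp \<nu>" for z
    using that cluster_nu(2)[OF eta] by auto
  show "rees_R (supp \<nu>) e \<subseteq> rees_R (supp \<eta>) e"
  proof
    fix r assume "r \<in> rees_R (supp \<nu>) e"
    then have r: "r \<in> supp \<nu>" "e * r = r" "r * e = e" by (auto simp: N.rees_R_eq)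
    have "N.sinv r = e" unfolding N.sinv_def using r N.e_mem_rees_G E.ee by (intro N.rees_inverse_eqI) (auto simp: E.ee)
    then have "rees_right (supp \<nu>) e r = r" using r by (simp add: N.rees_right_eq E.ee)
    then show "r \<in> rees_R (supp \<eta>) e" using sub[OF r(1)] r by (simp add: E.rees_R_eq)
  qed
qed

lemma eta_decomposition: "\<eta> = lawL \<^bold>* haar H \<^bold>* lawR"
  using E.decomposition[OF eta_prob E.idem E.idem] by (simp add: E.haar_rees_G)

lemma nu_decomposition: "\<nu> = lawL \<^bold>* haar G \<^bold>* lawR"
  using E.decomposition[OF nu_prob cluster_nu[OF eta]] by (simp add: N.haar_rees_G)

section \<open>Compression of cluster points into the group \<open>G\<close>\<close>

abbreviation "W \<equiv> E.corner e"

lemma haar_H: "haar H = W"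
  by (simp add: E.haar_rees_G E.corner_def)

text \<open>The middle factor in the decomposition of a cluster point. The outer laws are the same
  for all cluster points, so the compression determines the cluster point.\<close>

definition compression :: "'a measure \<Rightarrow> 'a measure" where
  "compression \<rho> = dirac e \<^bold>* \<rho> \<^bold>* dirac e"

lemma compression_prob: "\<rho> \<in> \<K> \<Longrightarrow> compression \<rho> \<in> borel_probs"
  by (simp add: compression_def conv_borel_probs prob_space_return_borel cluster_prob)

lemma compression_eta: "compression \<eta> = W"
  by (simp add: compression_def E.corner_def)

lemma compression_decomposition: "\<rho> \<in> \<K> \<Longrightarrow> \<rho> = lawL \<^bold>* compression \<rho> \<^bold>* lawR"
  unfolding compression_def by (rule E.decomposition) (auto simp: unit cluster_prob)

lemma compression_absorb: "\<rho> \<in> \<K> \<Longrightarrow> W \<^bold>* compression \<rho> = compression \<rho>" "\<rho> \<in> \<K> \<Longrightarrow> compression \<rho> \<^bold>* W = compression \<rho>"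
  unfolding compression_def by (rule E.corner_conv_absorb; simp add: unit cluster_prob)+

text \<open>The unit \<open>\<eta>\<close> is inserted between the two factors, and between
  \<open>\<eta>\<close> and \<open>\<sigma>\<close> an extra \<open>dirac e\<close> changes nothing;
  this supplies the inner \<open>dirac e\<close> of the product of compressions.\<close>

lemma compression_conv:
  assumes "\<rho> \<in> \<K>" "\<sigma> \<in> \<K>"
  shows "compression (\<rho> \<^bold>* \<sigma>) = compression \<rho> \<^bold>* compression \<sigma>"
proof -
  note P = cluster_prob[OF assms(1)] cluster_prob[OF assms(2)]
  have "\<rho> \<^bold>* (dirac e \<^bold>* \<sigma>) = \<rho> \<^bold>* \<eta> \<^bold>* (dirac e \<^bold>* \<sigma>)" by (simp add: unit assms)
  also have "\<dots> = \<rho> \<^bold>* (\<eta> \<^bold>* (dirac e \<^bold>* \<sigma>))" by (simp add: conv_simps P eta_prob)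
  also have "\<dots> = \<rho> \<^bold>* \<sigma>" by (simp add: E.conv_dirac_absorb(1)[OF P(2) unit(1)[OF assms(2)]])
  finally have "dirac e \<^bold>* (\<rho> \<^bold>* (dirac e \<^bold>* \<sigma>)) \<^bold>* dirac e = compression (\<rho> \<^bold>* \<sigma>)" by (simp add: compression_def)
  then show ?thesis by (simp add: compression_def conv_simps dirac_dirac_conv P E.ee)
qed

lemma compression_mem: "\<rho> \<in> \<K> \<Longrightarrow> z \<in> supp \<rho> \<Longrightarrow> e * z * e \<in> supp (compression \<rho>)"
  unfolding compression_def
  by (intro supp_mult conv_borel_probs prob_space_return_borel cluster_prob) (auto simp: supp_return)

lemma supp_compression_subset: "\<rho> \<in> \<K> \<Longrightarrow> supp (compression \<rho>) \<subseteq> G"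
  unfolding compression_def
proof (rule supp_conv3_subset)
  fix x y z assume "\<rho> \<in> \<K>" "x \<in> supp (dirac e)" "y \<in> supp \<rho>" "z \<in> supp (dirac e)"
  then show "x * y * z \<in> G" using supp_cluster_subset_nu[of \<rho>] N.sandwich_mem by (auto simp: supp_return)
qed (auto simp: prob_space_return_borel cluster_prob compact_imp_closed[OF N.compact_rees_G])

sublocale GG: group GG
  by (rule N.rees_G_group)

lemma G_simps:
  "x \<in> G \<Longrightarrow> e * x = x" "x \<in> G \<Longrightarrow> x * e = x"
  by (simp_all add: N.rees_G_eq)

lemma H_inverse: "h \<in> H \<Longrightarrow> \<exists>k\<in>H. k * h = e \<and> h * k = e"
  using E.rees_inverse_facts by blast

text \<open>With \<open>\<sigma>\<close> inverse to \<open>\<rho>\<close> and \<open>b\<close> in the support of \<open>compression \<sigma>\<close>, both \<open>b * a\<close> and \<open>b * x\<close> lie in \<open>H\<close>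
  for \<open>a\<close>, \<open>x\<close> in the support of \<open>compression \<rho>\<close>, so \<open>x\<close> and \<open>a\<close> differ by an element of \<open>H\<close>.\<close>

lemma supp_compression_quotient:
  assumes \<rho>: "\<rho> \<in> \<K>" and a: "a \<in> supp (compression \<rho>)" and x: "x \<in> supp (compression \<rho>)"
  shows "\<exists>h\<in>H. x = a * h" "\<exists>h\<in>H. x = h * a"
proof -
  obtain \<sigma> where \<sigma>: "\<sigma> \<in> \<K>" "\<rho> \<^bold>* \<sigma> = \<eta>" using clusters_divide[OF \<rho> eta] .
  have \<sigma>\<rho>: "\<sigma> \<^bold>* \<rho> = \<eta>" using conv_clusters_closed(2)[OF \<rho> \<sigma>(1)] \<sigma>(2) by simp
  obtain b where b: "b \<in> supp (compression \<sigma>)" using supp_nonempty[OF compression_prob[OF \<sigma>(1)]] by blast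
  have 1: "u * b \<in> H" "b * u \<in> H" if "u \<in> supp (compression \<rho>)" for u
    using supp_mult[OF compression_prob[OF \<rho>] compression_prob[OF \<sigma>(1)] that b] supp_mult[OF compression_prob[OF \<sigma>(1)] compression_prob[OF \<rho>] b that]
    by (simp_all add: compression_conv[symmetric] \<rho> \<sigma> \<sigma>\<rho> compression_eta E.supp_corner)
  have G: "a \<in> G" "x \<in> G" "b \<in> G" using a x b supp_compression_subset \<rho> \<sigma>(1) by blast+
  obtain c where c: "c \<in> G" "b * c = e" "c * b = e" using N.rees_inverse_facts[OF G(3)] by blast
  obtain k where k: "k \<in> H" "k * (b * a) = e" "b * a * k = e" using H_inverse[OF 1(2)[OF a]] by blast
  \<comment> \<open>From \<open>b * a * k = e\<close> it follows that \<open>a * k\<close> is the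
    inverse \<open>c\<close> of \<open>b\<close> in \<open>G\<close>, so multiplying it by
    \<open>b * x\<close> leaves \<open>x\<close>.\<close>
  have "a * (k * (b * x)) = c * b * (a * k) * (b * x)" using c G k by (simp add: G_simps mult.assoc[symmetric])
  also have "\<dots> = c * (b * a * k) * (b * x)" by (simp only: mult.assoc)
  also have "\<dots> = c * b * x" unfolding k(3) G_simps(2)[OF c(1)] by (simp only: mult.assoc)
  also have "\<dots> = x" using c G by (simp add: G_simps)
  finally show "\<exists>h\<in>H. x = a * h" using E.mult_rees_G[OF k(1) 1(2)[OF x]] by (intro bexI[of _ "k * (b * x)"]) auto
  obtain m where m: "m \<in> H" "m * (a * b) = e" "a * b * m = e" using H_inverse[OF 1(1)[OF a]] by blast
  have "x * b * m * a = x * b * m * (a * (b * c))" using c G by (simp add: G_simps)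
  also have "\<dots> = x * b * (m * (a * b)) * c" by (simp only: mult.assoc)
  also have "\<dots> = x * (b * e) * c" unfolding m(2) by (simp only: mult.assoc)
  also have "\<dots> = x" using c G by (simp add: G_simps mult.assoc)
  finally show "\<exists>h\<in>H. x = h * a" using E.mult_rees_G[OF 1(1)[OF x] m(1)] by (intro bexI[of _ "x * b * m"]) auto
qed

lemma W_absorb: "h \<in> H \<Longrightarrow> dirac h \<^bold>* W = W" "h \<in> H \<Longrightarrow> W \<^bold>* dirac h = W"
  using E.corner_invariant[OF E.e_mem] E.supp_corner by auto

text \<open>The convolution of \<open>dirac x\<close> with \<open>W\<close> is the same for all
  \<open>x\<close> in the support of the compression, since any two such points differ by a factor
  from \<open>H\<close>. Averaging over \<open>x\<close> gives the compression convolved with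
  \<open>W\<close>, which is the compression itself.\<close>

lemma compression_eq:
  assumes \<rho>: "\<rho> \<in> \<K>" and a: "a \<in> supp (compression \<rho>)"
  shows "compression \<rho> = dirac a \<^bold>* W" "compression \<rho> = W \<^bold>* dirac a"
proof -
  have aW: "dirac a \<^bold>* W \<in> borel_probs" "W \<^bold>* dirac a \<in> borel_probs"
    by (intro conv_borel_probs prob_space_return_borel E.corner_prob)+
  have "AE x in compression \<rho>. dirac x \<^bold>* W = dirac a \<^bold>* W"
    using AE_supp[OF compression_prob[OF \<rho>]]
  proof eventually_elim
    case (elim x)
    then obtain h where "h \<in> H" "x = a * h" using supp_compression_quotient(1)[OF \<rho> a] by blast
    then show ?case using dirac_dirac_conv[OF E.corner_prob, of a h e] W_absorb by simp
  qed
  then have "compression \<rho> \<^bold>* W = dirac a \<^bold>* W" by (rule conv_absorb_left[OF compression_prob[OF \<rho>] E.corner_prob aW(1)])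
  then show "compression \<rho> = dirac a \<^bold>* W" by (simp add: compression_absorb \<rho>)
  have "AE x in compression \<rho>. W \<^bold>* dirac x = W \<^bold>* dirac a"
    using AE_supp[OF compression_prob[OF \<rho>]]
  proof eventually_elim
    case (elim x)
    then obtain h where h: "h \<in> H" "x = h * a" using supp_compression_quotient(2)[OF \<rho> a] by blast
    have "W \<^bold>* dirac x = W \<^bold>* dirac h \<^bold>* dirac a" by (simp add: h conv_simps E.corner_prob)
    then show ?case using W_absorb(2)[OF h(1)] by simp
  qed
  then have "W \<^bold>* compression \<rho> = W \<^bold>* dirac a" by (rule conv_absorb_right[OF compression_prob[OF \<rho>] E.corner_prob aW(2)])
  then show "compression \<rho> = W \<^bold>* dirac a" by (simp add: compression_absorb \<rho>)
qed

lemma supp_compression: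
  assumes \<rho>: "\<rho> \<in> \<K>" and a: "a \<in> supp (compression \<rho>)"
  shows "supp (compression \<rho>) = a <#\<^bsub>GG\<^esub> H" "supp (compression \<rho>) = H #>\<^bsub>GG\<^esub> a"
proof -
  have "a * h \<in> supp (compression \<rho>)" "h * a \<in> supp (compression \<rho>)" if h: "h \<in> H" for h
    using supp_mult[OF compression_prob[OF \<rho>] E.corner_prob[of e] a, of h] supp_mult[OF E.corner_prob[of e] compression_prob[OF \<rho>] _ a, of h] h
    by (simp_all add: E.supp_corner compression_absorb \<rho>)
  then have 1: "a <#\<^bsub>GG\<^esub> H \<subseteq> supp (compression \<rho>)" "H #>\<^bsub>GG\<^esub> a \<subseteq> supp (compression \<rho>)"
    unfolding l_coset_def r_coset_def monoid_on_simps by blast+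
  have 2: "x \<in> a <#\<^bsub>GG\<^esub> H" "x \<in> H #>\<^bsub>GG\<^esub> a" if x: "x \<in> supp (compression \<rho>)" for x
    unfolding l_coset_def r_coset_def monoid_on_simps
    using supp_compression_quotient(1)[OF \<rho> a x] supp_compression_quotient(2)[OF \<rho> a x] by blast+
  show "supp (compression \<rho>) = a <#\<^bsub>GG\<^esub> H" by (rule equalityI[OF subsetI 1(1)]) (rule 2(1))
  show "supp (compression \<rho>) = H #>\<^bsub>GG\<^esub> a" by (rule equalityI[OF subsetI 1(2)]) (rule 2(2))
qed

text \<open>\<open>supp \<nu>\<close> is given as a closure, so a point of \<open>G\<close> is
  approached by points from the supports of possibly varying cluster points. Compactness extracts a
  limit \<open>\<rho>\<close> of these; as each compression is a translate of \<open>W\<close> by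
  any of its support points, the compression of \<open>\<rho>\<close> is the translate by
  \<open>g\<close>.\<close>

lemma G_covered:
  assumes g: "g \<in> G"
  shows "\<exists>\<rho>\<in>\<K>. g \<in> supp (compression \<rho>)"
proof -
  have "g \<in> supp \<nu>" using g unfolding N.rees_G_eq by blast
  then have "g \<in> closure (\<Union>\<rho>\<in>\<K>. supp \<rho>)" unfolding supp_nu .
  then obtain z where z: "\<forall>n. z n \<in> (\<Union>\<rho>\<in>\<K>. supp \<rho>)" "z \<longlonglongrightarrow> g" unfolding closure_sequential by blast
  then have "\<forall>n. \<exists>\<rho>. \<rho> \<in> \<K> \<and> z n \<in> supp \<rho>" by blast
  then obtain s where s: "\<And>n. s n \<in> \<K>" "\<And>n. z n \<in> supp (s n)" by metis
  obtain r \<rho> where r: "strict_mono (r :: nat \<Rightarrow> nat)" "\<rho> \<in> \<K>" "limitin weak_topology (s \<circ> r) \<rho> sequentially"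
    by (rule clusters_convergent_subsequence[OF s(1)])
  have "(\<lambda>n. e * z n * e) \<longlonglongrightarrow> e * g * e" by (intro tendsto_mult tendsto_const z(2))
  then have "(\<lambda>n. e * z n * e) \<longlonglongrightarrow> g" using G_simps[OF g] by simp
  from LIMSEQ_subseq_LIMSEQ[OF this r(1)] have ag: "(\<lambda>n. e * z (r n) * e) \<longlonglongrightarrow> g" by (simp add: o_def)
  have "limitin weak_topology (\<lambda>n. compression (s (r n))) (compression \<rho>) sequentially"
    unfolding compression_def using r(3) by (intro limitin_conv_const prob_space_return_borel) (simp add: o_def)
  moreover have "compression (s (r n)) = dirac (e * z (r n) * e) \<^bold>* W" for n
    by (rule compression_eq(1)[OF s(1) compression_mem[OF s(1) s(2)]])
  moreover have "limitin weak_topology (\<lambda>n. dirac (e * z (r n) * e) \<^bold>* W) (dirac g \<^bold>* W) sequentially"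
    by (intro limitin_conv_const limitin_dirac ag E.corner_prob)
  ultimately have "compression \<rho> = dirac g \<^bold>* W" by (intro limitin_weak_unique[OF _ _ sequentially_bot]) auto
  moreover have "g * e \<in> supp (dirac g \<^bold>* W)"
    using E.e_mem_rees_G E.supp_corner by (intro supp_mult prob_space_return_borel E.corner_prob) (auto simp: supp_return)
  ultimately have "g \<in> supp (compression \<rho>)" using G_simps(2)[OF g] by simp
  then show ?thesis using r(2) by (rule bexI)
qed

text \<open>Every point of \<open>G\<close> lies in the support of some compression, and this
  support is at once its left and its right coset of \<open>H\<close>.\<close>

lemma normal_H: "H \<lhd> GG"
proof (rule GG.normalI)
  show "subgroup H GG"
  proof (rule GG.subgroupI)
    fix a assume a: "a \<in> H"
    obtain k where k: "k \<in> H" "k * a = e" using H_inverse[OF a] by blast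
    have "inv\<^bsub>GG\<^esub> a = k" using GG.inv_equality[of k a] k a H_subset_G by auto
    then show "inv\<^bsub>GG\<^esub> a \<in> H" using k by simp
  qed (use H_subset_G E.e_mem_rees_G E.mult_rees_G in auto)
  show "\<forall>x\<in>carrier GG. H #>\<^bsub>GG\<^esub> x = x <#\<^bsub>GG\<^esub> H"
  proof
    fix x assume "x \<in> carrier GG"
    then obtain \<rho> where "\<rho> \<in> \<K>" "x \<in> supp (compression \<rho>)" using G_covered[of x] by auto
    then show "H #>\<^bsub>GG\<^esub> x = x <#\<^bsub>GG\<^esub> H" using supp_compression by metis
  qed
qed

section \<open>Isomorphism between cluster points and cosets\<close>

definition Psi :: "'a \<Rightarrow> 'a measure" where
  "Psi g = lawL \<^bold>* haar_coset g H \<^bold>* lawR"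

lemma Psi_eq: "\<rho> \<in> \<K> \<Longrightarrow> g \<in> supp (compression \<rho>) \<Longrightarrow> Psi g = \<rho>"
  using compression_decomposition[of \<rho>] compression_eq(1)[of \<rho> g] by (simp add: Psi_def haar_coset_def haar_H)

text \<open>The coset is obtained without choosing a representative, as a support.
  \<open>Psi\<close> leads back: it sends a point of \<open>G\<close> to the cluster point belonging
  to its coset.\<close>

abbreviation "F \<equiv> \<lambda>\<rho>. supp (compression \<rho>)"
abbreviation "\<T> \<equiv> subtopology weak_topology \<K>"

lemma Psi_cluster: "g \<in> G \<Longrightarrow> Psi g \<in> \<K>" "g \<in> G \<Longrightarrow> g \<in> F (Psi g)"
  using G_covered Psi_eq by metis+

lemma F_inj: "\<rho> \<in> \<K> \<Longrightarrow> \<sigma> \<in> \<K> \<Longrightarrow> F \<rho> = F \<sigma> \<Longrightarrow> \<rho> = \<sigma>"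
  using supp_nonempty[OF compression_prob] Psi_eq by (metis ex_in_conv)

lemma F_eq: "g \<in> G \<Longrightarrow> F (Psi g) = g <#\<^bsub>GG\<^esub> H"
  using Psi_cluster supp_compression(1) by blast

text \<open>A continuous surjection from a compact space onto a Hausdorff space is a quotient map,
  and \<open>G\<close> is compact.\<close>

lemma Psi_quotient: "quotient_map (top_of_set G) \<T> Psi"
proof (rule continuous_imp_quotient_map)
  have lim: "limitin weak_topology (\<lambda>n. Psi (s n)) (Psi z) sequentially" if "s \<longlonglongrightarrow> z" for s z
    unfolding Psi_def haar_coset_def haar_H
    by (intro limitin_conv_const limitin_dirac that E.corner_prob E.left_law_prob E.right_law_prob)
  show "continuous_map (top_of_set G) \<T> Psi"
  proof (rule continuous_map_sequentiallyI)
    show "metrizable_space (top_of_set G)" by (intro metrizable_space_subtopology metrizable_space_euclidean)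
    show "Psi \<in> topspace (top_of_set G) \<rightarrow> topspace \<T>" unfolding clusters_topspace using Psi_cluster by auto
    fix s z assume "range s \<subseteq> topspace (top_of_set G)" "limitin (top_of_set G) s z sequentially"
    then have "range s \<subseteq> G" "z \<in> G" "s \<longlonglongrightarrow> z" by (auto simp: limitin_subtopology)
    then show "limitin \<T> (Psi \<circ> s) (Psi z) sequentially"
      using lim Psi_cluster(1) by (auto simp: limitin_subtopology o_def image_subset_iff)
  qed
  show "Psi ` topspace (top_of_set G) = topspace \<T>"
  proof
    show "topspace \<T> \<subseteq> Psi ` topspace (top_of_set G)"
    proof
      fix \<rho> assume "\<rho> \<in> topspace \<T>"
      then have \<rho>: "\<rho> \<in> \<K>" by (simp add: clusters_topspace)
      obtain g where "g \<in> F \<rho>" using supp_nonempty[OF compression_prob[OF \<rho>]] by blast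
      then show "\<rho> \<in> Psi ` topspace (top_of_set G)" using Psi_eq[OF \<rho>] supp_compression_subset[OF \<rho>] by force
    qed
  qed (unfold clusters_topspace, use Psi_cluster in auto)
qed (use N.compact_rees_G weak_seq_compact_topology[OF seq_compact_clusters] in \<open>auto simp: compact_space_subtopology\<close>)

abbreviation "CT \<equiv> coset_topology (top_of_set G) GG H"
abbreviation "KK \<equiv> monoid_on (\<^bold>*) \<K> \<eta>"

lemma carrier_quotient: "carrier (GG Mod H) = F ` \<K>" "(\<lambda>g. g <#\<^bsub>GG\<^esub> H) ` G = F ` \<K>"
proof -
  have "(\<lambda>g. g <#\<^bsub>GG\<^esub> H) ` G = (\<lambda>g. H #>\<^bsub>GG\<^esub> g) ` G"
    using normal.coset_eq[OF normal_H] by (intro image_cong) auto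
  also have "\<dots> = carrier (GG Mod H)" by (auto simp: FactGroup_def RCOSETS_def)
  finally have 1: "(\<lambda>g. g <#\<^bsub>GG\<^esub> H) ` G = carrier (GG Mod H)" .
  show 2: "(\<lambda>g. g <#\<^bsub>GG\<^esub> H) ` G = F ` \<K>"
  proof (intro equalityI subsetI)
    fix X assume "X \<in> (\<lambda>g. g <#\<^bsub>GG\<^esub> H) ` G"
    then obtain g where g: "g \<in> G" "X = g <#\<^bsub>GG\<^esub> H" by blast
    then show "X \<in> F ` \<K>" using F_eq[OF g(1)] Psi_cluster(1)[OF g(1)] by blast
  next
    fix X assume "X \<in> F ` \<K>"
    then obtain \<rho> where \<rho>: "\<rho> \<in> \<K>" "X = F \<rho>" by blast
    obtain g where "g \<in> F \<rho>" using supp_nonempty[OF compression_prob[OF \<rho>(1)]] by blast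
    then show "X \<in> (\<lambda>g. g <#\<^bsub>GG\<^esub> H) ` G" using supp_compression(1)[OF \<rho>(1)] supp_compression_subset[OF \<rho>(1)] \<rho>(2) by blast
  qed
  show "carrier (GG Mod H) = F ` \<K>" using 1 2 by simp
qed

lemma F_iso: "F \<in> iso KK (GG Mod H)"
  unfolding iso_def
proof (intro CollectI conjI)
  show "bij_betw F (carrier KK) (carrier (GG Mod H))"
    unfolding bij_betw_def carrier_quotient(1) using F_inj by (auto intro: inj_onI)
  show "F \<in> hom KK (GG Mod H)"
  proof (rule homI)
    fix \<rho> \<sigma> assume "\<rho> \<in> carrier KK" "\<sigma> \<in> carrier KK"
    then have K: "\<rho> \<in> \<K>" "\<sigma> \<in> \<K>" by auto
    obtain a where a: "a \<in> F \<rho>" using supp_nonempty[OF compression_prob[OF K(1)]] by blast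
    obtain b where b: "b \<in> F \<sigma>" using supp_nonempty[OF compression_prob[OF K(2)]] by blast
    have ab: "a * b \<in> F (\<rho> \<^bold>* \<sigma>)" using supp_mult[OF compression_prob[OF K(1)] compression_prob[OF K(2)] a b] by (simp add: compression_conv K)
    have G: "a \<in> G" "b \<in> G" using a b supp_compression_subset K by blast+
    have "F \<rho> <#>\<^bsub>GG\<^esub> F \<sigma> = H #>\<^bsub>GG\<^esub> (a * b)"
      using normal.rcos_sum[OF normal_H, of a b] G supp_compression(2)[OF K(1) a] supp_compression(2)[OF K(2) b] by simp
    then show "F (\<rho> \<otimes>\<^bsub>KK\<^esub> \<sigma>) = F \<rho> \<otimes>\<^bsub>GG Mod H\<^esub> F \<sigma>"
      using supp_compression(2)[OF conv_clusters_closed(1)[OF K] ab] by (simp add: FactGroup_def)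
  qed (use carrier_quotient(1) in auto)
qed

lemma topspace_CT: "topspace CT = F ` \<K>"
  using carrier_quotient(2) by (simp add: coset_topology_def topspace_quotient_topology)

text \<open>Both topologies are quotients of the one on \<open>G\<close>, by \<open>Psi\<close> and
  by the coset map, and composing \<open>Psi\<close> with \<open>F\<close> gives the coset
  map.\<close>

lemma F_homeomorphic: "homeomorphic_map \<T> CT F"
  unfolding homeomorphic_map_def quotient_map_def
proof (intro conjI allI impI)
  show "F ` topspace \<T> = topspace CT" by (simp only: clusters_topspace topspace_CT)
  show "inj_on F (topspace \<T>)" unfolding clusters_topspace using F_inj by (auto intro: inj_onI)
  fix U assume U: "U \<subseteq> topspace CT"
  have q: "V \<subseteq> topspace \<T> \<Longrightarrow> openin \<T> V \<longleftrightarrow> openin (top_of_set G) {g \<in> topspace (top_of_set G). Psi g \<in> V}" for V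
    using Psi_quotient unfolding quotient_map_def by simp
  have "openin \<T> {\<rho> \<in> topspace \<T>. F \<rho> \<in> U} \<longleftrightarrow>
      openin (top_of_set G) {g \<in> topspace (top_of_set G). Psi g \<in> {\<rho> \<in> topspace \<T>. F \<rho> \<in> U}}"
    by (rule q) (rule Collect_restrict)
  also have "{g \<in> topspace (top_of_set G). Psi g \<in> {\<rho> \<in> topspace \<T>. F \<rho> \<in> U}} = {g \<in> topspace (top_of_set G). g <#\<^bsub>GG\<^esub> H \<in> U}"
    unfolding clusters_topspace using Psi_cluster(1) F_eq by auto
  also have "openin (top_of_set G) \<dots> \<longleftrightarrow> openin CT U"
    using U unfolding coset_topology_def openin_quotient_topology topspace_quotient_topology by simp
  finally show "openin \<T> {\<rho> \<in> topspace \<T>. F \<rho> \<in> U} = openin CT U" .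
qed

lemma F_polish_group_iso: "polish_group_iso \<T> KK CT (GG Mod H) F"
  unfolding polish_group_iso_def
proof (intro conjI F_iso F_homeomorphic)
  have top: "topological_group \<T> KK" using clusters_compact_group[OF eta eta_unit] by (simp add: compact_group_def)
  note T = weak_seq_compact_topology(3,4)[OF seq_compact_clusters]
  show "polish_group \<T> KK" using top T by (simp add: polish_group_def)
  have "topological_group CT (GG Mod H)"
    by (rule topological_group_homeomorphic[OF top normal.factorgroup_is_group[OF normal_H] _ F_iso F_homeomorphic])
      (simp only: topspace_CT carrier_quotient)
  moreover have hs: "\<T> homeomorphic_space CT" using F_homeomorphic by (rule homeomorphic_map_imp_homeomorphic_space)
  have "completely_metrizable_space CT" "second_countable CT"
    using T homeomorphic_completely_metrizable_space[OF hs] homeomorphic_space_second_countability[OF hs] by auto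
  ultimately show "polish_group CT (GG Mod H)" by (simp add: polish_group_def)
qed

lemma F_representation: "\<rho> \<in> \<K> \<Longrightarrow> g \<in> G \<Longrightarrow> F \<rho> = g <#\<^bsub>GG\<^esub> H \<Longrightarrow> \<rho> = lawL \<^bold>* haar_coset g H \<^bold>* lawR"
  using F_eq F_inj[of \<rho> "Psi g"] Psi_cluster(1) by (auto simp: Psi_def)

section \<open>The orbit of the unit under the powers, and a generator\<close>

abbreviation "orbit \<equiv> insert \<eta> {conv_power \<mu> k \<^bold>* \<eta> | k. k \<ge> 1}"

lemma orbit_subset: "orbit \<subseteq> \<K>"
proof -
  have "conv_power \<mu> k \<^bold>* \<eta> \<in> \<K>" if "k \<ge> 1" for k
    using pw_conv_cluster(1)[OF eta, of "k - 1"] that by (simp add: pw_def)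
  then show ?thesis using eta by auto
qed

text \<open>Multiplying a convergent sequence of powers by \<open>\<eta>\<close> moves it into the
  orbit and keeps its limit \<open>\<rho>\<close>, since \<open>\<eta>\<close> is the unit.
  Conversely the compact set of cluster points is closed in the Hausdorff weak topology.\<close>

lemma clusters_closure_orbit: "\<K> = weak_topology closure_of orbit"
proof
  have "compactin weak_topology \<K>"
    using weak_seq_compact_topology(1)[OF seq_compact_clusters] cluster_prob
    by (auto simp: compactin_subspace topspace_weak_topology)
  then have "closedin weak_topology \<K>" by (rule compactin_imp_closedin[OF Hausdorff_space_weak_topology])
  then show "weak_topology closure_of orbit \<subseteq> \<K>" by (rule closure_of_minimal[OF orbit_subset])
  show "\<K> \<subseteq> weak_topology closure_of orbit"
  proof
    fix \<rho> assume \<rho>: "\<rho> \<in> \<K>"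
    obtain r where r: "strict_mono r" "limitin weak_topology (\<lambda>i. pw (r i)) \<rho> sequentially"
      using \<rho> by (rule cluster_sequence)
    have "limitin weak_topology (\<lambda>i. pw (r i) \<^bold>* \<eta>) \<rho> sequentially"
      using limitin_conv_const(1)[OF r(2) eta_prob] by (simp add: unit \<rho>)
    moreover have "pw (r i) \<^bold>* \<eta> \<in> weak_topology closure_of orbit" for i
    proof -
      have "orbit \<subseteq> weak_topology closure_of orbit"
        using orbit_subset cluster_prob by (intro closure_of_subset) (auto simp: topspace_weak_topology)
      moreover have "pw (r i) \<^bold>* \<eta> \<in> orbit" unfolding pw_def by (intro insertI2 CollectI exI[of _ "Suc (r i)"]) auto
      ultimately show ?thesis by blast
    qed
    ultimately show "\<rho> \<in> weak_topology closure_of orbit"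
      by (intro limitin_closedin[OF _ closedin_closure_of]) auto
  qed
qed

text \<open>Any point of the coset of \<open>\<mu>\<close> convolved with \<open>\<eta>\<close> will
  do: compression is multiplicative and the inner \<open>\<eta>\<close> disappears as a unit, so
  multiplication by this point leads from the coset of one power to that of the next.\<close>

lemma generator:
  obtains \<gamma> where "\<gamma> \<in> G" "\<And>k. k \<ge> 1 \<Longrightarrow> \<gamma> [^]\<^bsub>GG\<^esub> (k :: nat) \<in> F (conv_power \<mu> k \<^bold>* \<eta>)"
proof -
  have m: "\<mu> \<^bold>* \<eta> \<in> \<K>" using pw_conv_cluster(1)[OF eta, of 0] by (simp add: pw_0)
  obtain \<gamma> where \<gamma>: "\<gamma> \<in> F (\<mu> \<^bold>* \<eta>)" using supp_nonempty[OF compression_prob[OF m]] by blast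
  have G: "\<gamma> \<in> G" using \<gamma> supp_compression_subset[OF m] by blast
  have "\<gamma> [^]\<^bsub>GG\<^esub> (Suc n) \<in> F (pw n \<^bold>* \<eta>)" for n
  proof (induction n)
    case 0 then show ?case using \<gamma> G by (simp add: pw_0 G_simps)
  next
    case (Suc n)
    note K = pw_conv_cluster(1)[OF eta, of n]
    have "\<gamma> [^]\<^bsub>GG\<^esub> (Suc n) * \<gamma> \<in> F (pw n \<^bold>* \<eta> \<^bold>* (\<mu> \<^bold>* \<eta>))"
      using supp_mult[OF compression_prob[OF K] compression_prob[OF m] Suc \<gamma>] by (simp only: compression_conv K m)
    also have "pw n \<^bold>* \<eta> \<^bold>* (\<mu> \<^bold>* \<eta>) = pw n \<^bold>* (\<eta> \<^bold>* (\<mu> \<^bold>* \<eta>))"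
      by (simp add: conv_assoc pw_prob eta_prob prob conv_borel_probs)
    also have "\<dots> = pw (Suc n) \<^bold>* \<eta>" using unit(1)[OF m] by (simp add: pw_Suc conv_assoc pw_prob eta_prob prob)
    finally show ?case by simp
  qed
  then have "\<gamma> [^]\<^bsub>GG\<^esub> k \<in> F (conv_power \<mu> k \<^bold>* \<eta>)" if "k \<ge> 1" for k :: nat
    using that by (metis Suc_diff_1 less_eq_Suc_le pw_def One_nat_def)
  then show ?thesis using that G by blast
qed

end

theorem theorem4p9:
  fixes \<mu> :: "'a::{polish_space, topological_semigroup_mult} measure"
  assumes "\<mu> \<in> borel_probs"
    and "tight_measures {conv_power \<mu> n | n. n \<ge> 1}"
  shows
    "let S = support_semigroup \<mu>;
         \<K> = conv_clusters \<mu>;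
         \<T> = subtopology weak_topology \<K>
     in \<exists>\<nu> \<eta>.
      \<comment> \<open>(i)\<close>
      \<nu> \<in> borel_probs_on S \<and> \<nu> \<^bold>* \<nu> = \<nu> \<and> \<mu> \<^bold>* \<nu> = \<nu> \<and> \<nu> \<^bold>* \<mu> = \<nu> \<and>
      limitin weak_topology (cesaro_mean \<mu>) \<nu> sequentially \<and>
      \<comment> \<open>(ii), with \<open>\<eta>\<close> the identity\<close>
      comm_group (monoid_on (\<^bold>*) \<K> \<eta>) \<and> compact_group \<T> (monoid_on (\<^bold>*) \<K> \<eta>) \<and>
      supp \<nu> = closure (\<Union>\<rho>\<in>\<K>. supp \<rho>) \<and>
      \<comment> \<open>(iii)\<close>
      completely_simple (supp \<eta>) \<and>
      (\<forall>e\<in>idempotents (supp \<eta>).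
        let L = rees_L (supp \<eta>) e; H = rees_G (supp \<eta>) e; R = rees_R (supp \<eta>) e;
            G = rees_G (supp \<nu>) e; GG = monoid_on (*) G e;
            \<eta>L = left_law \<eta> e; \<eta>R = right_law \<eta> e
        in
          supp \<eta> = L * H * R \<and>
          compact_group (top_of_set H) (monoid_on (*) H e) \<and>
          \<eta> = \<eta>L \<^bold>* haar H \<^bold>* \<eta>R \<and>
          \<comment> \<open>(iv)\<close>
          completely_simple (supp \<nu>) \<and> semigroup_kernel S (supp \<nu>) \<and> e \<in> supp \<nu> \<and>
          rees_L (supp \<nu>) e = L \<and> rees_R (supp \<nu>) e = R \<and> supp \<nu> = L * G * R \<and>
          compact_group (top_of_set G) GG \<and> H \<subseteq> G \<and>
          \<nu> = \<eta>L \<^bold>* haar G \<^bold>* \<eta>R \<and>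
          \<comment> \<open>(v)\<close>
          closedin (top_of_set G) H \<and> H \<lhd> GG \<and>
          (\<exists>F. polish_group_iso \<T> (monoid_on (\<^bold>*) \<K> \<eta>)
                 (coset_topology (top_of_set G) GG H) (GG Mod H) F \<and>
               (\<forall>\<rho>\<in>\<K>. \<forall>g\<in>G. F \<rho> = g <#\<^bsub>GG\<^esub> H \<longrightarrow>
                  \<rho> = \<eta>L \<^bold>* haar_coset g H \<^bold>* \<eta>R)) \<and>
          (\<exists>\<gamma>\<in>G.
             (\<forall>k\<ge>1. conv_power \<mu> k \<^bold>* \<eta> = \<eta>L \<^bold>* haar_coset (\<gamma> [^]\<^bsub>GG\<^esub> k) H \<^bold>* \<eta>R) \<and>
             \<K> = weak_topology closure_of (insert \<eta> {conv_power \<mu> k \<^bold>* \<eta> | k. k \<ge> 1}) \<and>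
             carrier (GG Mod H) = coset_topology (top_of_set G) GG H closure_of
               (insert H {(\<gamma> [^]\<^bsub>GG\<^esub> k) <#\<^bsub>GG\<^esub> H | k::nat. k \<ge> 1})))"
proof -
  interpret tight_powers \<mu> using assms by unfold_locales
  obtain \<nu> where \<nu>: "limitin weak_topology avg \<nu> sequentially" "\<And>k. pw k \<^bold>* \<nu> = \<nu>" "\<And>k. \<nu> \<^bold>* pw k = \<nu>" "\<nu> \<^bold>* \<nu> = \<nu>"
    using ex_avg_limit by blast
  obtain \<eta> where \<eta>: "\<eta> \<in> \<K>" "\<forall>\<rho>\<in>\<K>. \<eta> \<^bold>* \<rho> = \<rho>" using ex_identity by blast
  interpret tight_powers_limit \<mu> \<nu> \<eta> by unfold_locales (fact \<nu> \<eta>)+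
  \<comment> \<open>\<open>avg\<close> starts with the mean of one power, hence the offset
    1.\<close>
  have cesaro: "limitin weak_topology (cesaro_mean \<mu>) \<nu> sequentially"
    by (rule limitin_sequentially_offset_rev[of _ _ 1]) (use avg_lim in \<open>simp add: avg_def[abs_def]\<close>)
  have \<mu>\<nu>: "\<mu> \<^bold>* \<nu> = \<nu>" "\<nu> \<^bold>* \<mu> = \<nu>" using pw_nu[of 0] by (simp_all add: pw_0)
  have \<nu>S: "\<nu> \<in> borel_probs_on (support_semigroup \<mu>)"
    using nu_prob emeasure_nu_S by (simp add: borel_probs_on_def)
  \<comment> \<open>Complete simplicity of \<open>supp \<eta>\<close> mentions no idempotent, so one
    is chosen here; the decompositions below are proved for an arbitrary one.\<close>
  obtain e\<^sub>0 where "e\<^sub>0 \<in> idempotents (supp \<eta>)" using E.ex_idempotent by blast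
  then interpret E\<^sub>0: idempotent_measure_at \<eta> e\<^sub>0 by unfold_locales
  have at: "let L = rees_L (supp \<eta>) e; H = rees_G (supp \<eta>) e; R = rees_R (supp \<eta>) e;
            G = rees_G (supp \<nu>) e; GG = monoid_on (*) G e;
            \<eta>L = left_law \<eta> e; \<eta>R = right_law \<eta> e
        in
          supp \<eta> = L * H * R \<and>
          compact_group (top_of_set H) (monoid_on (*) H e) \<and>
          \<eta> = \<eta>L \<^bold>* haar H \<^bold>* \<eta>R \<and>
          completely_simple (supp \<nu>) \<and> semigroup_kernel (support_semigroup \<mu>) (supp \<nu>) \<and> e \<in> supp \<nu> \<and>
          rees_L (supp \<nu>) e = L \<and> rees_R (supp \<nu>) e = R \<and> supp \<nu> = L * G * R \<and>
          compact_group (top_of_set G) GG \<and> H \<subseteq> G \<and>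
          \<nu> = \<eta>L \<^bold>* haar G \<^bold>* \<eta>R \<and>
          closedin (top_of_set G) H \<and> H \<lhd> GG \<and>
          (\<exists>F. polish_group_iso (subtopology weak_topology (conv_clusters \<mu>)) (monoid_on (\<^bold>*) (conv_clusters \<mu>) \<eta>)
                 (coset_topology (top_of_set G) GG H) (GG Mod H) F \<and>
               (\<forall>\<rho>\<in>conv_clusters \<mu>. \<forall>g\<in>G. F \<rho> = g <#\<^bsub>GG\<^esub> H \<longrightarrow>
                  \<rho> = \<eta>L \<^bold>* haar_coset g H \<^bold>* \<eta>R)) \<and>
          (\<exists>\<gamma>\<in>G.
             (\<forall>k\<ge>1. conv_power \<mu> k \<^bold>* \<eta> = \<eta>L \<^bold>* haar_coset (\<gamma> [^]\<^bsub>GG\<^esub> k) H \<^bold>* \<eta>R) \<and>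
             conv_clusters \<mu> = weak_topology closure_of (insert \<eta> {conv_power \<mu> k \<^bold>* \<eta> | k. k \<ge> 1}) \<and>
             carrier (GG Mod H) = coset_topology (top_of_set G) GG H closure_of
               (insert H {(\<gamma> [^]\<^bsub>GG\<^esub> k) <#\<^bsub>GG\<^esub> H | k::nat. k \<ge> 1}))"
    if e: "e \<in> idempotents (supp \<eta>)" for e
  proof -
    interpret tight_powers_at \<mu> \<nu> \<eta> e by unfold_locales (rule e)
    obtain \<gamma> where \<gamma>: "\<gamma> \<in> G" "\<And>k. k \<ge> 1 \<Longrightarrow> \<gamma> [^]\<^bsub>GG\<^esub> (k :: nat) \<in> F (conv_power \<mu> k \<^bold>* \<eta>)"
      using generator by blast
    have orbit_cluster: "conv_power \<mu> k \<^bold>* \<eta> \<in> \<K>" if "k \<ge> 1" for k using orbit_subset that by blast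
    have power: "conv_power \<mu> k \<^bold>* \<eta> = lawL \<^bold>* haar_coset (\<gamma> [^]\<^bsub>GG\<^esub> k) H \<^bold>* lawR" if "k \<ge> 1" for k
      using Psi_eq[OF orbit_cluster[OF that] \<gamma>(2)[OF that]] by (simp add: Psi_def)
    have Fk: "F (conv_power \<mu> k \<^bold>* \<eta>) = (\<gamma> [^]\<^bsub>GG\<^esub> k) <#\<^bsub>GG\<^esub> H" if "k \<ge> 1" for k
      by (rule supp_compression(1)[OF orbit_cluster[OF that] \<gamma>(2)[OF that]])
    have F\<eta>: "F \<eta> = H" by (simp add: compression_eta E.supp_corner)
    have Forbit: "F ` orbit = insert H {(\<gamma> [^]\<^bsub>GG\<^esub> k) <#\<^bsub>GG\<^esub> H | k::nat. k \<ge> 1}"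
      using Fk by (auto simp: F\<eta> image_iff) metis+
    have Torbit: "\<T> closure_of orbit = \<K>"
      unfolding closure_of_subtopology using clusters_closure_orbit orbit_subset by (simp add: Int_absorb1)
    \<comment> \<open>Density in the coset group is the image under the homeomorphism
      \<open>F\<close> of the density already known in the group of cluster points.\<close>
    have "CT closure_of (F ` orbit) = F ` (\<T> closure_of orbit)"
      by (rule homeomorphic_map_closure_of[OF F_homeomorphic]) (simp only: clusters_topspace orbit_subset)
    then have closure: "CT closure_of (insert H {(\<gamma> [^]\<^bsub>GG\<^esub> k) <#\<^bsub>GG\<^esub> H | k::nat. k \<ge> 1}) = F ` \<K>"
      unfolding Forbit Torbit .
    have closed: "closedin (top_of_set G) H"
      by (rule closed_subset[OF H_subset_G compact_imp_closed[OF E.compact_rees_G]])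
    have \<nu>LGR: "supp \<nu> = rees_L (supp \<eta>) e * G * rees_R (supp \<eta>) e"
      using N.rees_product by (simp only: rees_L_nu rees_R_nu)
    show ?thesis
      unfolding Let_def
    proof (intro conjI)
      show "\<exists>F. polish_group_iso \<T> KK CT (GG Mod H) F \<and>
          (\<forall>\<rho>\<in>\<K>. \<forall>g\<in>G. F \<rho> = g <#\<^bsub>GG\<^esub> H \<longrightarrow> \<rho> = lawL \<^bold>* haar_coset g H \<^bold>* lawR)"
        by (intro exI[of _ F] conjI ballI impI F_polish_group_iso) (rule F_representation)
      show "\<exists>\<gamma>\<in>G. (\<forall>k\<ge>1. conv_power \<mu> k \<^bold>* \<eta> = lawL \<^bold>* haar_coset (\<gamma> [^]\<^bsub>GG\<^esub> k) H \<^bold>* lawR) \<and>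
          \<K> = weak_topology closure_of orbit \<and>
          carrier (GG Mod H) = CT closure_of (insert H {(\<gamma> [^]\<^bsub>GG\<^esub> k) <#\<^bsub>GG\<^esub> H | k::nat. k \<ge> 1})"
        unfolding carrier_quotient(1)
        by (intro bexI[OF _ \<gamma>(1)] conjI allI impI power clusters_closure_orbit closure[symmetric])
    qed (fact E.rees_product E.rees_G_compact_group eta_decomposition N.completely_simple_supp kernel e_supp_nu
        rees_L_nu rees_R_nu \<nu>LGR N.rees_G_compact_group H_subset_G nu_decomposition closed normal_H)+
  qed
  show ?thesis
    unfolding Let_def[of "support_semigroup \<mu>"] Let_def[of "conv_clusters \<mu>"] Let_def[of "subtopology weak_topology (conv_clusters \<mu>)"]
    by (intro exI[of _ \<nu>] exI[of _ \<eta>] conjI ballI \<nu>S \<nu>(4) \<mu>\<nu> cesaro clusters_comm_group \<eta>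
        clusters_compact_group supp_nu E\<^sub>0.completely_simple_supp at)
qed

end
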